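(* For every $n\ge2$ the boundary operator $d$ on the family $\mathcal P_{Mas}=\{P^n_{Mas}\mid n\ge0\}$ is given by $$dP^n_{Mas}=2St^{n-1}+(n-2)P^{n-1}_{Mas}+\sum_{s=0}^{n-2}\binom{n-2}{s}St^s\times P_\Gamma^{n-s-1}+\sum_{s=0}^{n-2}\binom{n-2}{s}St^{s+1}\times Pe^{n-s-2}+\sum_{s=0}^{n-3}\binom{n-2}{s}P^{s+2}_{Mas}\times Pe^{n-s-3}.$$ In particular, the family $\mathcal P_{Mas}$ has complexity $4$.
   Context: **Ring of polytopes.** $\mathcal P=\bigoplus_n\mathcal P_n$ is the free abelian group on combinatorial types of simple polytopes (graded by dimension), with addition corresponding to disjoint union and multiplication given by Cartesian product. $d:\mathcal P\to\mathcal P$ is the derivation sending a simple polytope to the disjoint union (sum) of its facets. **Nestohedra.** A building set on a finite nonempty set $V$ is a collection $B$ of nonempty subsets of $V$ containing all singletons and such that $S_1,S_2\in B$, $S_1\cap S_2\ne\varnothing$ imply $S_1\cup S_2\in B$; it is connected if $V\in B$. The nestohedron is the simple polytope $P_B=\sum_{S\in B}\operatorname{conv}(e_i\mid i\in S)\subset\mathbb R^V$ (Minkowski sum). For a connected simple graph $G$ on $[n+1]=\{1,\dots,n+1\}$ the graph-associahedron is $P_{B(G)}$, where $B(G)$ consists of the nonempty vertex subsets inducing connected subgraphs. **The families.** $Pe^n$ (permutohedron) is the graph-associahedron of the complete graph on $[n+1]$; $St^n$ (stellahedron) is that of the star graph on $[n+1]$. $P_\Gamma^0$ is a point, $P_\Gamma^1$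 a segment, and for $n\ge2$, $P_\Gamma^n=P_{B(\Gamma,n)}$, where $B(\Gamma,n)$ consists of all singletons of $[n+1]$, all subsets of $\{1,\dots,n\}$ with at least two elements, and all sets $\{1,n+1\}\cup J$ with $J\subseteq\{2,\dots,n\}$. $P^0_{Mas}$ is a point, $P^1_{Mas}$ a segment, and for $n\ge2$, $P^n_{Mas}=P_{B(P,n)}$, where $B(P,n)$ consists of all singletons of $[n+1]$, all sets $\{1,2\}\cup I$ with $I\subseteq\{3,\dots,n+1\}$, and all sets $\{1\}\cup J$ with $\varnothing\ne J\subseteq\{3,\dots,n\}$. **Complexity.** A family of polytopes $\mathcal F$ is a set of (combinatorial types of) polytopes such that for each $n\ge0$ the subset $\mathcal F_n$ of its $n$-dimensional members is nonempty and finite; it is a line family if each $\mathcal F_n$ has exactly one element. Let $\mathcal P_{\mathcal F}$ be the subring of $\mathcal P$ generated over $\mathbb Z$ by the members of $\mathcal F$; $\mathcal F$ is a $d$-family if $d(\mathcal P_{\mathcal F})\subseteq\mathcal P_{\mathcal F}$. The $d$-closure of $\mathcal F$ is the minimal extension of $\mathcal F$ in $\mathcal P$ to a $d$-family. $\mathcal F$ has complexity $k\ge1$ if its $d$-closure is a union of $k$ line families. *)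

theory Defs
  imports "HOL-Analysis.Analysis" "HOL-Analysis.Finite_Function_Topology"
begin

section \<open>Simple polytopes and combinatorial equivalence\<close>

text \<open>
  The library's \<^const>\<open>aff_dim\<close> and \<^const>\<open>facet_of\<close> are restricted to
  \<^class>\<open>euclidean_space\<close>, whose dimension is fixed by the type. The following versions live in an
  arbitrary real vector space, so that polytopes of all dimensions can be subsets of one type. The
  affine dimension is the dimension of the direction space; it is only meant for nonempty sets.
\<close>

definition adim :: "'a::real_vector set \<Rightarrow> nat" where
  "adim S = dim {x - y |x y. x \<in> S \<and> y \<in> S}"

definition is_facet :: "'a::real_vector set \<Rightarrow> 'a set \<Rightarrow> bool" where
  "is_facet F P \<longleftrightarrow> F face_of P \<and> F \<noteq> {} \<and> adim F + 1 = adim P"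

definition simple_polytope :: "'a::real_vector set \<Rightarrow> bool" where
  "simple_polytope P \<longleftrightarrow> polytope P \<and> P \<noteq> {} \<and>
     (\<forall>v. v extreme_point_of P \<longrightarrow> card {F. is_facet F P \<and> v \<in> F} = adim P)"

text \<open>Isomorphism of face lattices (including the empty face and the polytope itself).\<close>

definition comb_equiv :: "'a::real_vector set \<Rightarrow> 'b::real_vector set \<Rightarrow> bool" where
  "comb_equiv P Q \<longleftrightarrow> (\<exists>f. bij_betw f {F. F face_of P} {G. G face_of Q} \<and>
     (\<forall>F G. F face_of P \<longrightarrow> G face_of P \<longrightarrow> (f F \<subseteq> f G \<longleftrightarrow> F \<subseteq> G)))"


subsection \<open>Products and linear images\<close>

lemma diff_set_image:
  assumes "linear f"
  shows "{x - y |x y. x \<in> f ` S \<and> y \<in> f ` S} = f ` {x - y |x y. x \<in> S \<and> y \<in> S}"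
  using linear_diff[OF assms] by (force simp: image_iff)

lemma adim_linear_image:
  fixes f :: "'a::real_vector \<Rightarrow> 'b::real_vector"
  assumes "linear f" "inj f"
  shows "adim (f ` S) = adim S"
proof -
  let ?D = "{x - y |x y. x \<in> S \<and> y \<in> S}"
  obtain B where B: "B \<subseteq> ?D" "independent B" "?D \<subseteq> span B" "card B = dim ?D"
    by (rule basis_exists[of ?D])
  have "independent (f ` B)"
    using linear_independent_injective_image[OF assms(1) B(2)] assms(2) by (meson inj_on_subset subset_UNIV)
  moreover have "span (f ` B) = span (f ` ?D)"
  proof -
    have "span B = span ?D" unfolding span_eq using B(1,3) subset_trans[OF _ span_superset] by (intro conjI)
    then show ?thesis by (simp add: linear_span_image[OF assms(1)])
  qed
  ultimately have "dim (f ` ?D) = card (f ` B)"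
    by (simp add: dim_eq_card)
  also have "\<dots> = card B" using assms(2) by (meson card_image inj_on_subset subset_UNIV)
  finally show ?thesis using B(4) diff_set_image[OF assms(1)] by (simp add: adim_def)
qed

lemma polytope_finite_dim:
  assumes "polytope P"
  obtains W where "finite W" "{x - y |x y. x \<in> P \<and> y \<in> P} \<subseteq> span W"
proof -
  obtain W where W: "finite W" "P = convex hull W" using assms by (auto simp: polytope_def)
  have "P \<subseteq> span W" using W(2) by (simp add: hull_minimal span_superset subspace_imp_convex)
  then show ?thesis using that[OF W(1)] by (auto intro!: span_diff)
qed

lemma independent_Times:
  assumes "independent A" "independent B"
  shows "independent (A \<times> {0} \<union> {0} \<times> B)"
  unfolding dependent_def
proof safe
  fix a assume a: "a \<in> A" "(a, 0) \<in> span (A \<times> {0} \<union> {0} \<times> B - {(a, 0)})"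
  have "fst (a, 0::'b) \<in> span (fst ` (A \<times> {0} \<union> {0} \<times> B - {(a, 0)}))"
    using a(2) by (metis imageI linear_fst linear_span_image)
  also have "\<dots> \<subseteq> span (insert 0 (A - {a}))" by (rule span_mono) auto
  finally have "a \<in> span (A - {a})" by simp
  with a assms show False by (auto simp: dependent_def)
next
  fix a assume a: "a \<in> B" "(0, a) \<in> span (A \<times> {0} \<union> {0} \<times> B - {(0, a)})"
  have "snd (0::'a, a) \<in> span (snd ` (A \<times> {0} \<union> {0} \<times> B - {(0, a)}))"
    using a(2) by (metis imageI linear_snd linear_span_image)
  also have "\<dots> \<subseteq> span (insert 0 (B - {a}))" by (rule span_mono) auto
  finally have "a \<in> span (B - {a})" by simp
  with a assms show False by (auto simp: dependent_def)
qed

lemma adim_Times_aux: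
  fixes S :: "'a::real_vector set" and T :: "'b::real_vector set"
  assumes "finite W" "{x - y |x y. x \<in> S \<and> y \<in> S} \<subseteq> span W" "S \<noteq> {}"
    "finite W'" "{x - y |x y. x \<in> T \<and> y \<in> T} \<subseteq> span W'" "T \<noteq> {}"
  shows "adim (S \<times> T) = adim S + adim T"
proof -
  let ?D = "{x - y |x y. x \<in> S \<and> y \<in> S}" and ?E = "{x - y |x y. x \<in> T \<and> y \<in> T}"
  obtain A where A: "A \<subseteq> ?D" "independent A" "?D \<subseteq> span A" "card A = dim ?D"
    by (rule basis_exists[of ?D])
  obtain B where B: "B \<subseteq> ?E" "independent B" "?E \<subseteq> span B" "card B = dim ?E"
    by (rule basis_exists[of ?E])
  have fin: "finite A" "finite B"
    using independent_span_bound[of W A] independent_span_bound[of W' B] assms A B by auto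
  have nz: "0 \<notin> A" "0 \<notin> B" using A(2) B(2) dependent_zero by blast+
  let ?C = "A \<times> {0} \<union> {0} \<times> B"
  have eq: "{x - y |x y. x \<in> S \<times> T \<and> y \<in> S \<times> T} = ?D \<times> ?E" by force
  have z: "0 \<in> ?D" "0 \<in> ?E" using assms(3,6) by force+
  have "?C \<subseteq> ?D \<times> ?E" using A(1) B(1) z by blast
  moreover have "?D \<times> ?E \<subseteq> span ?C"
  proof safe
    fix a b assume a: "a \<in> S" "b \<in> S" fix c d assume c: "c \<in> T" "d \<in> T"
    have "(a - b, 0) \<in> (\<lambda>x. (x, 0)) ` span A" using A(3) a by blast
    also have "\<dots> = span ((\<lambda>x. (x, 0)) ` A)"
      by (rule linear_span_image[symmetric]) (auto intro!: linearI)
    finally have 1: "(a - b, 0) \<in> span ?C" by (rule subsetD[OF span_mono, rotated]) auto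
    have "(0, c - d) \<in> (\<lambda>x. (0, x)) ` span B" using B(3) c by blast
    also have "\<dots> = span ((\<lambda>x. (0, x)) ` B)"
      by (rule linear_span_image[symmetric]) (auto intro!: linearI)
    finally have 2: "(0, c - d) \<in> span ?C" by (rule subsetD[OF span_mono, rotated]) auto
    show "(a - b, c - d) \<in> span ?C" using span_add[OF 1 2] by simp
  qed
  ultimately have "span ?C = span (?D \<times> ?E)"
    unfolding span_eq using subset_trans[OF _ span_superset] by (intro conjI)
  then have "dim (?D \<times> ?E) = card ?C"
    by (rule dim_eq_card[OF _ independent_Times[OF A(2) B(2)]])
  also have "\<dots> = card (A \<times> {0::'b}) + card ({0::'a} \<times> B)"
    using fin nz by (intro card_Un_disjoint) auto
  also have "\<dots> = dim ?D + dim ?E" using A(4) B(4) by (simp add: card_cartesian_product)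
  finally show ?thesis unfolding adim_def eq .
qed

lemma adim_Times:
  fixes S :: "'a::real_vector set" and T :: "'b::real_vector set"
  assumes "polytope P" "polytope Q" "S \<subseteq> P" "T \<subseteq> Q" "S \<noteq> {}" "T \<noteq> {}"
  shows "adim (S \<times> T) = adim S + adim T"
proof -
  obtain W where W: "finite W" "{x - y |x y. x \<in> P \<and> y \<in> P} \<subseteq> span W"
    using polytope_finite_dim[OF assms(1)] by blast
  obtain W' where W': "finite W'" "{x - y |x y. x \<in> Q \<and> y \<in> Q} \<subseteq> span W'"
    using polytope_finite_dim[OF assms(2)] by blast
  have "{x - y |x y. x \<in> S \<and> y \<in> S} \<subseteq> span W" "{x - y |x y. x \<in> T \<and> y \<in> T} \<subseteq> span W'"
    using W W' assms(3,4) by blast+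
  with W(1) W'(1) assms(5,6) show ?thesis by (intro adim_Times_aux)
qed

lemma span_diff_convex:
  assumes "convex F" "F \<noteq> {}" "v \<in> span {x - y |x y. x \<in> F \<and> y \<in> F}"
  obtains c f g where "c \<ge> 0" "f \<in> F" "g \<in> F" "v = c *\<^sub>R (f - g)"
proof -
  let ?S = "{c *\<^sub>R (f - g) | c f g. c \<ge> 0 \<and> f \<in> F \<and> g \<in> F}"
  have "subspace ?S"
    unfolding subspace_def
  proof (intro conjI allI ballI)
    show "0 \<in> ?S" using assms(2) by force
  next
    fix x y assume "x \<in> ?S" "y \<in> ?S"
    then obtain c f g d h k where x: "x = c *\<^sub>R (f - g)" "y = d *\<^sub>R (h - k)" "c \<ge> 0" "d \<ge> 0"
      "f \<in> F" "g \<in> F" "h \<in> F" "k \<in> F" by blast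
    show "x + y \<in> ?S"
    proof (cases "c + d = 0")
      case True
      then have "c = 0" "d = 0" using x by auto
      then have "x + y = 0 *\<^sub>R (f - f)" using x by simp
      then show ?thesis using x by blast
    next
      case False
      then have p: "c + d > 0" using x by auto
      let ?u = "(c/(c+d)) *\<^sub>R f + (d/(c+d)) *\<^sub>R h" and ?v = "(c/(c+d)) *\<^sub>R g + (d/(c+d)) *\<^sub>R k"
      have s: "c/(c+d) + d/(c+d) = 1" using p by (simp add: add_divide_distrib[symmetric])
      have "?u \<in> F" "?v \<in> F" using convexD[OF assms(1)] x p s by auto
      moreover have "x + y = (c+d) *\<^sub>R (?u - ?v)"
        using p by (simp add: x scaleR_add_right scaleR_diff_right)
      moreover have "0 \<le> c + d" using p by simp
      ultimately show ?thesis by blast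
    qed
  next
    fix r x assume "x \<in> ?S"
    then obtain c f g where x: "x = c *\<^sub>R (f - g)" "c \<ge> 0" "f \<in> F" "g \<in> F" by blast
    show "r *\<^sub>R x \<in> ?S"
    proof (cases "r \<ge> 0")
      case True
      then have "r *\<^sub>R x = (r * c) *\<^sub>R (f - g)" "r * c \<ge> 0" using x by auto
      then show ?thesis using x by blast
    next
      case False
      then have "r *\<^sub>R x = (- r * c) *\<^sub>R (g - f)" "- r * c \<ge> 0" using x
        by (auto simp: scaleR_diff_right mult_nonpos_nonneg)
      then show ?thesis using x by blast
    qed
  qed
  moreover have "{x - y |x y. x \<in> F \<and> y \<in> F} \<subseteq> ?S"
  proof clarify
    fix x y assume "x \<in> F" "y \<in> F"
    then show "\<exists>c f g. x - y = c *\<^sub>R (f - g) \<and> 0 \<le> c \<and> f \<in> F \<and> g \<in> F"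
      by (intro exI[of _ 1] exI[of _ x] exI[of _ y]) auto
  qed
  ultimately have "v \<in> ?S" using assms(3) span_minimal by blast
  then show ?thesis using that by blast
qed

lemma adim_face_less:
  assumes P: "polytope P" and F: "F face_of P" "F \<noteq> {}" "F \<noteq> P"
  shows "adim F < adim P"
proof (rule ccontr)
  assume *: "\<not> adim F < adim P"
  let ?D = "{x - y |x y. x \<in> F \<and> y \<in> F}" and ?E = "{x - y |x y. x \<in> P \<and> y \<in> P}"
  have FP: "F \<subseteq> P" and cF: "convex F" using F(1) by (auto simp: face_of_def)
  obtain W where W: "finite W" "?E \<subseteq> span W"
    using polytope_finite_dim[OF P] by blast
  obtain A where A: "A \<subseteq> ?D" "independent A" "?D \<subseteq> span A" "card A = dim ?D"
    by (rule basis_exists[of ?D])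
  obtain B where B: "B \<subseteq> ?E" "independent B" "?E \<subseteq> span B" "card B = dim ?E"
    by (rule basis_exists[of ?E])
  have DE: "?D \<subseteq> ?E" using FP by blast
  have finB: "finite B" using independent_span_bound[OF W(1) B(2)] B(1) W(2) by auto
  have "?E \<subseteq> span A"
  proof
    fix u assume u: "u \<in> ?E"
    show "u \<in> span A"
    proof (rule ccontr)
      assume n: "u \<notin> span A"
      then have "independent (insert u A)" using A(2) by (simp add: independent_insert)
      moreover have "insert u A \<subseteq> span B" using u A(1) DE B(3) by blast
      ultimately have "finite (insert u A) \<and> card (insert u A) \<le> card B"
        by (rule independent_span_bound[OF finB])
      moreover have "u \<notin> A" using n span_base[of u A] by (rule contrapos_nn)
      ultimately have "card A + 1 \<le> card B" by (auto simp: card_insert_if)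
      then show False using * A(4) B(4) by (simp add: adim_def)
    qed
  qed
  then have sp: "?E \<subseteq> span ?D" using A(1) span_mono by blast
  have "P \<subseteq> F"
  proof
    fix x assume x: "x \<in> P"
    obtain x0 where x0: "x0 \<in> F" using F(2) by blast
    then have "x - x0 \<in> span ?D" using x FP sp by blast
    then obtain c f g where c: "c \<ge> 0" "f \<in> F" "g \<in> F" "x - x0 = c *\<^sub>R (f - g)"
      using span_diff_convex[OF cF F(2)] by blast
    have e: "x + c *\<^sub>R g = x0 + c *\<^sub>R f" using c(4) by (simp add: algebra_simps)
    show "x \<in> F"
    proof (cases "c = 0 \<or> x = g")
      case True then show ?thesis using c x0 by auto
    next
      case False
      then have p: "c > 0" using c by auto
      let ?t = "c / (1 + c)"
      have t: "1 - ?t = 1/(1+c)" "?t > 0" "?t < 1" using p by (auto simp: field_simps)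
      have "(1 - ?t) *\<^sub>R x0 + ?t *\<^sub>R f \<in> F"
        using convexD_alt[OF cF x0 c(2), of ?t] t by auto
      also have "(1 - ?t) *\<^sub>R x0 + ?t *\<^sub>R f = (1/(1+c)) *\<^sub>R (x0 + c *\<^sub>R f)"
        by (simp add: t scaleR_add_right)
      also have "\<dots> = (1 - ?t) *\<^sub>R x + ?t *\<^sub>R g"
        by (simp add: t scaleR_add_right flip: e)
      finally have "(1 - ?t) *\<^sub>R x + ?t *\<^sub>R g \<in> F" .
      moreover have "(1 - ?t) *\<^sub>R x + ?t *\<^sub>R g \<in> open_segment x g"
        using False t by (auto simp: in_segment)
      ultimately show ?thesis using face_ofD[OF F(1)] x c(3) FP by blast
    qed
  qed
  with FP F(3) show False by blast
qed

lemma face_of_Times_iff: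
  "C face_of (S \<times> T) \<longleftrightarrow> (\<exists>F G. F face_of S \<and> G face_of T \<and> C = F \<times> G)"
proof
  assume C: "C face_of (S \<times> T)"
  have sub: "C \<subseteq> S \<times> T" and cC: "convex C" using C by (auto simp: face_of_def)
  have rect: "(a, b) \<in> C \<and> (a', b') \<in> C" if "(a, b') \<in> C" "(a', b) \<in> C" for a b a' b'
  proof (cases "(a, b) = (a', b')")
    case True then show ?thesis using that by auto
  next
    case False
    have "(1/2) *\<^sub>R (a, b') + (1/2) *\<^sub>R (a', b) \<in> C"
      using convexD[OF cC that, of "1/2" "1/2"] by simp
    then have "(1 - 1/2) *\<^sub>R (a, b) + (1/2) *\<^sub>R (a', b') \<in> C" by (simp add: add.commute)
    moreover have "(1 - 1/2) *\<^sub>R (a, b) + (1/2) *\<^sub>R (a', b') \<in> open_segment (a, b) (a', b')"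
      using False unfolding in_segment by (intro conjI exI[of _ "1/2"]) auto
    ultimately show ?thesis using face_ofD[OF C] that sub by blast
  qed
  have "fst ` C face_of S"
    unfolding face_of_def
  proof (intro conjI ballI impI)
    show "fst ` C \<subseteq> S" using sub by auto
    show "convex (fst ` C)" using cC convex_linear_image linear_fst by blast
    fix a b x assume h: "a \<in> S" "b \<in> S" "x \<in> fst ` C" "x \<in> open_segment a b"
    then obtain y where y: "(x, y) \<in> C" by auto
    have "(x, y) \<in> open_segment (a, y) (b, y)" using h(4) by (auto simp: in_segment)
    then show "a \<in> fst ` C" "b \<in> fst ` C"
      using face_ofD[OF C, of "(x,y)" "(a,y)" "(b,y)"] y h sub by force+
  qed
  moreover have "snd ` C face_of T"
    unfolding face_of_def
  proof (intro conjI ballI impI)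
    show "snd ` C \<subseteq> T" using sub by auto
    show "convex (snd ` C)" using cC convex_linear_image linear_snd by blast
    fix a b x assume h: "a \<in> T" "b \<in> T" "x \<in> snd ` C" "x \<in> open_segment a b"
    then obtain y where y: "(y, x) \<in> C" by auto
    have "(y, x) \<in> open_segment (y, a) (y, b)" using h(4) by (auto simp: in_segment)
    then show "a \<in> snd ` C" "b \<in> snd ` C"
      using face_ofD[OF C, of "(y,x)" "(y,a)" "(y,b)"] y h sub by force+
  qed
  moreover have "C = fst ` C \<times> snd ` C"
  proof (intro equalityI subsetI)
    fix z assume "z \<in> fst ` C \<times> snd ` C"
    then obtain a b a' b' where z: "z = (a, b)" "(a, b') \<in> C" "(a', b) \<in> C" by auto
    show "z \<in> C" using rect[OF z(2,3)] z(1) by simp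
  next
    fix z assume "z \<in> C" then show "z \<in> fst ` C \<times> snd ` C" by (simp add: mem_Times_iff)
  qed
  ultimately show "\<exists>F G. F face_of S \<and> G face_of T \<and> C = F \<times> G" by blast
qed (auto intro: face_of_Times)

lemma polytope_convex: "polytope P \<Longrightarrow> convex P"
  by (auto simp: polytope_def)

lemma is_facet_Times:
  fixes P :: "'a::real_vector set" and Q :: "'b::real_vector set"
  assumes P: "polytope P" "P \<noteq> {}" and Q: "polytope Q" "Q \<noteq> {}"
  shows "is_facet C (P \<times> Q) \<longleftrightarrow>
    (\<exists>F. is_facet F P \<and> C = F \<times> Q) \<or> (\<exists>G. is_facet G Q \<and> C = P \<times> G)"
proof
  assume C: "is_facet C (P \<times> Q)"
  then obtain F G where FG: "F face_of P" "G face_of Q" "C = F \<times> G"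
    by (auto simp: is_facet_def face_of_Times_iff)
  have ne: "F \<noteq> {}" "G \<noteq> {}" using C FG by (auto simp: is_facet_def)
  have sub: "F \<subseteq> P" "G \<subseteq> Q" using FG by (auto simp: face_of_imp_subset)
  have d: "adim F + adim G + 1 = adim P + adim Q"
    using C adim_Times[OF P(1) Q(1) sub ne] adim_Times[OF P(1) Q(1) _ _ P(2) Q(2)] FG
    by (auto simp: is_facet_def)
  have 1: "F = P \<or> adim F < adim P" and 2: "G = Q \<or> adim G < adim Q"
    using adim_face_less P Q FG ne by blast+
  show "(\<exists>F. is_facet F P \<and> C = F \<times> Q) \<or> (\<exists>G. is_facet G Q \<and> C = P \<times> G)"
  proof (cases "F = P")
    case True
    then show ?thesis using d FG ne by (auto simp: is_facet_def)
  next
    case False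
    then have "G = Q" using 1 2 d by auto
    then show ?thesis using d FG ne by (auto simp: is_facet_def)
  qed
next
  have PP: "P face_of P" "Q face_of Q" using P Q polytope_convex face_of_refl by blast+
  assume "(\<exists>F. is_facet F P \<and> C = F \<times> Q) \<or> (\<exists>G. is_facet G Q \<and> C = P \<times> G)"
  then have "\<exists>F G. C = F \<times> G \<and> F face_of P \<and> G face_of Q \<and> F \<noteq> {} \<and> G \<noteq> {} \<and>
     adim F + adim G + 1 = adim P + adim Q"
  proof (elim disjE exE conjE)
    fix F assume "is_facet F P" "C = F \<times> Q"
    then show ?thesis using PP Q(2) by (intro exI[of _ F] exI[of _ Q]) (auto simp: is_facet_def)
  next
    fix G assume "is_facet G Q" "C = P \<times> G"
    then show ?thesis using PP P(2) by (intro exI[of _ P] exI[of _ G]) (auto simp: is_facet_def)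
  qed
  then obtain F G where FG: "C = F \<times> G" "F face_of P" "G face_of Q" "F \<noteq> {}" "G \<noteq> {}"
     "adim F + adim G + 1 = adim P + adim Q" by blast
  moreover have "F \<subseteq> P" "G \<subseteq> Q" using FG face_of_imp_subset by blast+
  ultimately show "is_facet C (P \<times> Q)"
    using adim_Times[OF P(1) Q(1), of F G] adim_Times[OF P(1) Q(1) _ _ P(2) Q(2)]
    by (auto simp: is_facet_def intro: face_of_Times)
qed

lemma extreme_point_of_Times:
  "v extreme_point_of (P \<times> Q) \<longleftrightarrow> fst v extreme_point_of P \<and> snd v extreme_point_of Q"
proof
  assume "v extreme_point_of (P \<times> Q)"
  then have "{v} face_of (P \<times> Q)" by (simp add: face_of_singleton)
  then obtain F G where "F face_of P" "G face_of Q" "{v} = F \<times> G" by (auto simp: face_of_Times_iff)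
  moreover have "F = {fst v} \<and> G = {snd v}"
  proof -
    have "{fst v} \<times> {snd v} = F \<times> G" using \<open>{v} = F \<times> G\<close> by simp
    then show ?thesis unfolding times_eq_iff by auto
  qed
  ultimately show "fst v extreme_point_of P \<and> snd v extreme_point_of Q"
    by (auto simp: face_of_singleton)
next
  assume "fst v extreme_point_of P \<and> snd v extreme_point_of Q"
  then have "{fst v} \<times> {snd v} face_of P \<times> Q" by (intro face_of_Times) (auto simp: face_of_singleton)
  then show "v extreme_point_of (P \<times> Q)" by (auto simp flip: face_of_singleton)
qed

lemma simple_finite_facets:
  assumes "simple_polytope P" "v extreme_point_of P"
  shows "finite {F. is_facet F P \<and> v \<in> F}"
proof (cases "adim P = 0")
  case True
  then have *: "{F. is_facet F P \<and> v \<in> F} = {}" by (auto simp: is_facet_def)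
  show ?thesis unfolding * by simp
next
  case False
  moreover have "card {F. is_facet F P \<and> v \<in> F} = adim P"
    using assms by (simp add: simple_polytope_def)
  ultimately have "card {F. is_facet F P \<and> v \<in> F} \<noteq> 0" by simp
  then show ?thesis by (rule card_ge_0_finite[OF neq0_conv[THEN iffD1]])
qed

lemma simple_polytope_Times:
  fixes P :: "'a::real_vector set" and Q :: "'b::real_vector set"
  assumes P: "simple_polytope P" and Q: "simple_polytope Q"
  shows "simple_polytope (P \<times> Q)"
  unfolding simple_polytope_def
proof (intro conjI allI impI)
  have p: "polytope P" "P \<noteq> {}" and q: "polytope Q" "Q \<noteq> {}"
    using assms by (auto simp: simple_polytope_def)
  show "polytope (P \<times> Q)" using p q polytope_Times by blast
  show "P \<times> Q \<noteq> {}" using p q by blast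
  fix v assume "v extreme_point_of (P \<times> Q)"
  then have v: "fst v extreme_point_of P" "snd v extreme_point_of Q"
    by (auto simp: extreme_point_of_Times)
  have vi: "fst v \<in> P" "snd v \<in> Q" using v by (auto simp: extreme_point_of_def)
  let ?A = "{F. is_facet F P \<and> fst v \<in> F}" and ?B = "{F. is_facet F Q \<and> snd v \<in> F}"
  have eq: "{C. is_facet C (P \<times> Q) \<and> v \<in> C} = (\<lambda>F. F \<times> Q) ` ?A \<union> (\<lambda>G. P \<times> G) ` ?B"
    using vi by (auto simp: is_facet_Times[OF p q] mem_Times_iff)
  have "is_facet F P \<Longrightarrow> F \<noteq> P" for F by (auto simp: is_facet_def)
  then have disj: "(\<lambda>F. F \<times> Q) ` ?A \<inter> (\<lambda>G. P \<times> G) ` ?B = {}"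
    using p q by (auto simp: times_eq_iff)
  have "inj_on (\<lambda>F. F \<times> Q) ?A" "inj_on (\<lambda>G. P \<times> G) ?B"
    using p q by (auto simp: inj_on_def times_eq_iff)
  then have "card {C. is_facet C (P \<times> Q) \<and> v \<in> C} = card ?A + card ?B"
    unfolding eq using simple_finite_facets[OF P v(1)] simple_finite_facets[OF Q v(2)] disj
    by (subst card_Un_disjoint) (auto simp: card_image)
  then show "card {C. is_facet C (P \<times> Q) \<and> v \<in> C} = adim (P \<times> Q)"
    using P Q v adim_Times[OF p(1) q(1) _ _ p(2) q(2)] by (auto simp: simple_polytope_def)
qed

lemma is_facet_linear_image:
  assumes "linear f" "inj f"
  shows "is_facet (f ` F) (f ` P) \<longleftrightarrow> is_facet F P"
  by (auto simp: is_facet_def face_of_linear_image[OF assms] adim_linear_image[OF assms])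

lemma simple_polytope_linear_image:
  assumes f: "linear f" "inj f" and P: "simple_polytope P"
  shows "simple_polytope (f ` P)"
  unfolding simple_polytope_def
proof (intro conjI allI impI)
  show "polytope (f ` P)" "f ` P \<noteq> {}"
    using P polytope_linear_image[OF f(1)] by (auto simp: simple_polytope_def)
  fix v assume v: "v extreme_point_of (f ` P)"
  then obtain w where w: "v = f w" "w \<in> P" by (auto simp: extreme_point_of_def)
  have "{f w} face_of f ` P" using v w by (simp add: face_of_singleton)
  then have "f ` {w} face_of f ` P" by simp
  then have ew: "w extreme_point_of P"
    using face_of_linear_image[OF f] by (simp only: face_of_singleton)
  have "{F. is_facet F (f ` P) \<and> v \<in> F} = (`) f ` {F. is_facet F P \<and> w \<in> F}"
  proof (safe)
    fix F assume F: "is_facet F (f ` P)" "v \<in> F"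
    then have "F \<subseteq> f ` P" by (simp add: is_facet_def face_of_imp_subset)
    then obtain G where "F = f ` G" by (rule subset_imageE)
    then show "F \<in> (`) f ` {F. is_facet F P \<and> w \<in> F}"
      using F w is_facet_linear_image[OF f] f by (auto simp: inj_image_mem_iff)
  qed (auto simp: w is_facet_linear_image[OF f])
  moreover have "inj_on ((`) f) X" for X using f(2) by (simp add: inj_on_def inj_image_eq_iff)
  ultimately show "card {F. is_facet F (f ` P) \<and> v \<in> F} = adim (f ` P)"
    using P ew by (simp add: card_image simple_polytope_def adim_linear_image[OF f])
qed

lemma comb_equiv_refl: "comb_equiv P P"
  unfolding comb_equiv_def by (intro exI[of _ id]) auto

lemma comb_equiv_sym: assumes "comb_equiv P Q" shows "comb_equiv Q P"
proof -
  obtain f where f: "bij_betw f {F. F face_of P} {G. G face_of Q}"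
    "\<And>F G. F face_of P \<Longrightarrow> G face_of P \<Longrightarrow> f F \<subseteq> f G \<longleftrightarrow> F \<subseteq> G"
    using assms unfolding comb_equiv_def by blast
  let ?g = "the_inv_into {F. F face_of P} f"
  have g: "bij_betw ?g {G. G face_of Q} {F. F face_of P}" using bij_betw_the_inv_into[OF f(1)] .
  have fg: "f (?g G) = G" if "G face_of Q" for G
    using f_the_inv_into_f_bij_betw[OF f(1)] that by simp
  have gf: "?g G face_of P" if "G face_of Q" for G
    using bij_betwE[OF g] that by auto
  show ?thesis unfolding comb_equiv_def
    using g f(2)[OF gf gf] fg by (intro exI[of _ ?g]) auto
qed

lemma comb_equiv_trans: assumes "comb_equiv P Q" "comb_equiv Q R" shows "comb_equiv P R"
proof -
  obtain f where f: "bij_betw f {F. F face_of P} {G. G face_of Q}"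
    "\<And>F G. F face_of P \<Longrightarrow> G face_of P \<Longrightarrow> f F \<subseteq> f G \<longleftrightarrow> F \<subseteq> G"
    using assms unfolding comb_equiv_def by blast
  obtain g where g: "bij_betw g {F. F face_of Q} {G. G face_of R}"
    "\<And>F G. F face_of Q \<Longrightarrow> G face_of Q \<Longrightarrow> g F \<subseteq> g G \<longleftrightarrow> F \<subseteq> G"
    using assms unfolding comb_equiv_def by blast
  show ?thesis unfolding comb_equiv_def
    using bij_betw_trans[OF f(1) g(1)] bij_betwE[OF f(1)] f(2) g(2)
    by (intro exI[of _ "g \<circ> f"]) auto
qed

lemma comb_equiv_linear_image:
  assumes "linear f" "inj f"
  shows "comb_equiv P (f ` P)"
  unfolding comb_equiv_def
  using assms by (intro exI[of _ "(`) f"])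
    (auto simp: bij_betw_def faces_of_linear_image inj_on_def inj_image_eq_iff inj_image_subset_iff)

lemma comb_equiv_empty:
  assumes "bij_betw f {F. F face_of P} {G. G face_of Q}"
    "\<And>F G. F face_of P \<Longrightarrow> G face_of P \<Longrightarrow> f F \<subseteq> f G \<longleftrightarrow> F \<subseteq> G"
  shows "f {} = {}"
proof -
  obtain E where "E face_of P" "f E = {}"
  proof -
    have "{} \<in> f ` {F. F face_of P}" using bij_betw_imp_surj_on[OF assms(1)] by simp
    then show ?thesis using that by auto
  qed
  then show ?thesis using assms(2)[of "{}" E] by auto
qed

lemma comb_equiv_Times:
  assumes "comb_equiv P P'" "comb_equiv Q Q'"
  shows "comb_equiv (P \<times> Q) (P' \<times> Q')"
proof -
  obtain f where f: "bij_betw f {F. F face_of P} {G. G face_of P'}"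
    "\<And>F G. F face_of P \<Longrightarrow> G face_of P \<Longrightarrow> f F \<subseteq> f G \<longleftrightarrow> F \<subseteq> G"
    using assms unfolding comb_equiv_def by blast
  obtain g where g: "bij_betw g {F. F face_of Q} {G. G face_of Q'}"
    "\<And>F G. F face_of Q \<Longrightarrow> G face_of Q \<Longrightarrow> g F \<subseteq> g G \<longleftrightarrow> F \<subseteq> G"
    using assms unfolding comb_equiv_def by blast
  have e: "F face_of P \<Longrightarrow> f F = {} \<longleftrightarrow> F = {}" "G face_of Q \<Longrightarrow> g G = {} \<longleftrightarrow> G = {}" for F G
    using comb_equiv_empty[OF f] comb_equiv_empty[OF g] f(2)[of F "{}"] g(2)[of G "{}"] by auto
  define h where "h C = f (fst ` C) \<times> g (snd ` C)" for C
  have h: "h (F \<times> G) = f F \<times> g G" if "F face_of P" "G face_of Q" for F G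
    using comb_equiv_empty[OF f] comb_equiv_empty[OF g] by (cases "F = {} \<or> G = {}") (auto simp: h_def)
  have mono: "h C \<subseteq> h D \<longleftrightarrow> C \<subseteq> D" if CD: "C face_of P \<times> Q" "D face_of P \<times> Q" for C D
  proof -
    obtain F G where C: "F face_of P" "G face_of Q" "C = F \<times> G"
      using CD(1) by (auto simp: face_of_Times_iff)
    obtain F' G' where D: "F' face_of P" "G' face_of Q" "D = F' \<times> G'"
      using CD(2) by (auto simp: face_of_Times_iff)
    show ?thesis
      unfolding C(3) D(3) h[OF C(1,2)] h[OF D(1,2)] times_subset_iff f(2)[OF C(1) D(1)]
        g(2)[OF C(2) D(2)] e(1)[OF C(1)] e(2)[OF C(2)] ..
  qed
  have "inj_on h {F. F face_of P \<times> Q}"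
  proof (rule inj_onI)
    fix C D assume "C \<in> {F. F face_of P \<times> Q}" "D \<in> {F. F face_of P \<times> Q}" "h C = h D"
    then show "C = D" using mono[of C D] mono[of D C] by simp
  qed
  moreover have "h ` {F. F face_of P \<times> Q} = {F. F face_of P' \<times> Q'}"
  proof (intro equalityI subsetI)
    fix C assume "C \<in> h ` {F. F face_of P \<times> Q}"
    then show "C \<in> {F. F face_of P' \<times> Q'}"
      using bij_betwE[OF f(1)] bij_betwE[OF g(1)] by (auto simp: face_of_Times_iff[of _ P Q] h intro!: face_of_Times)
  next
    fix C assume "C \<in> {F. F face_of P' \<times> Q'}"
    then obtain F' G' where C: "F' face_of P'" "G' face_of Q'" "C = F' \<times> G'"
      by (auto simp: face_of_Times_iff)
    have "F' \<in> f ` {F. F face_of P}" using C(1) bij_betw_imp_surj_on[OF f(1)] by simp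
    then obtain F where F: "F face_of P" "F' = f F" by auto
    have "G' \<in> g ` {F. F face_of Q}" using C(2) bij_betw_imp_surj_on[OF g(1)] by simp
    then obtain G where G: "G face_of Q" "G' = g G" by auto
    have "C = h (F \<times> G)" using C(3) F G h by simp
    moreover have "F \<times> G face_of P \<times> Q" by (rule face_of_Times[OF F(1) G(1)])
    ultimately show "C \<in> h ` {F. F face_of P \<times> Q}" by simp
  qed
  ultimately have "bij_betw h {F. F face_of P \<times> Q} {G. G face_of P' \<times> Q'}"
    by (simp add: bij_betw_def)
  then show ?thesis unfolding comb_equiv_def using mono by (intro exI[of _ h]) simp
qed


section \<open>The ring of simple polytopes\<close>

text \<open>
  Every polytope is a subset of some $\mathbb{R}^n$, hence of the space of finitely supported real
  sequences; a simple polytope in this space spans a finite-dimensional affine subspace.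
\<close>

type_synonym rinf = "nat \<Rightarrow>\<^sub>0 real"

lift_definition interleave :: "rinf \<Rightarrow> rinf \<Rightarrow> rinf" is
  "\<lambda>x y n. if even n then x (n div 2) else y (n div 2)"
proof -
  fix x y :: "nat \<Rightarrow> real"
  assume xy: "finite {n. x n \<noteq> 0}" "finite {n. y n \<noteq> 0}"
  have "{n. (if even n then x (n div 2) else y (n div 2)) \<noteq> 0} \<subseteq>
    (\<lambda>n. 2 * n) ` {n. x n \<noteq> 0} \<union> (\<lambda>n. 2 * n + 1) ` {n. y n \<noteq> 0}"
  proof
    fix n assume n: "n \<in> {n. (if even n then x (n div 2) else y (n div 2)) \<noteq> 0}"
    show "n \<in> (\<lambda>n. 2 * n) ` {n. x n \<noteq> 0} \<union> (\<lambda>n. 2 * n + 1) ` {n. y n \<noteq> 0}"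
    proof (cases "even n")
      case True then show ?thesis using n by (intro UnI1 image_eqI[of _ _ "n div 2"]) auto
    next
      case False then show ?thesis using n by (intro UnI2 image_eqI[of _ _ "n div 2"]) auto
    qed
  qed
  then show "finite {n. (if even n then x (n div 2) else y (n div 2)) \<noteq> 0}"
    by (rule finite_subset) (use xy in simp)
qed

lemma lookup_interleave:
  "Poly_Mapping.lookup (interleave x y) n =
     (if even n then Poly_Mapping.lookup x (n div 2) else Poly_Mapping.lookup y (n div 2))"
  by (simp add: interleave.rep_eq)

lemma lookup_scaleR_poly_mapping:
  "Poly_Mapping.lookup (r *\<^sub>R x) n = r *\<^sub>R Poly_Mapping.lookup (x :: 'a \<Rightarrow>\<^sub>0 'b::real_vector) n"
proof -
  have "finite {n. r *\<^sub>R Poly_Mapping.lookup x n \<noteq> 0}"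
    by (rule finite_subset[OF _ finite_lookup[of x]]) auto
  then show ?thesis by (simp add: scaleR_poly_mapping_def)
qed

definition cart_prod :: "rinf set \<Rightarrow> rinf set \<Rightarrow> rinf set" where
  "cart_prod P Q = (\<lambda>(x, y). interleave x y) ` (P \<times> Q)"

lemma linear_interleave: "linear (\<lambda>(x, y). interleave x y)"
  by (rule linearI)
    (auto intro!: poly_mapping_eqI simp: lookup_interleave lookup_add lookup_scaleR_poly_mapping)

lemma inj_interleave: "inj (\<lambda>(x, y). interleave x y)"
proof (rule injI, clarify)
  fix x y x' y' assume e: "interleave x y = interleave x' y'"
  have "Poly_Mapping.lookup (interleave x y) (2 * n) = Poly_Mapping.lookup (interleave x' y') (2 * n)"
    "Poly_Mapping.lookup (interleave x y) (2 * n + 1) = Poly_Mapping.lookup (interleave x' y') (2 * n + 1)"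
    for n by (simp_all only: e)
  then show "x = x' \<and> y = y'" by (auto intro!: poly_mapping_eqI simp: lookup_interleave)
qed

lemma simple_polytope_cart_prod:
  "simple_polytope P \<Longrightarrow> simple_polytope Q \<Longrightarrow> simple_polytope (cart_prod P Q)"
  unfolding cart_prod_def
  by (intro simple_polytope_linear_image linear_interleave inj_interleave simple_polytope_Times)

lemma comb_equiv_cart_prod: "comb_equiv (P \<times> Q) (cart_prod P Q)"
  unfolding cart_prod_def
  by (intro comb_equiv_linear_image linear_interleave inj_interleave)

lemma comb_equiv_cart_prod_cong:
  "comb_equiv P P' \<Longrightarrow> comb_equiv Q Q' \<Longrightarrow> comb_equiv (cart_prod P Q) (cart_prod P' Q')"
  by (rule comb_equiv_trans[OF comb_equiv_sym[OF comb_equiv_cart_prod]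
        comb_equiv_trans[OF comb_equiv_Times comb_equiv_cart_prod]])

lemma comb_equiv_cart_prod_commute: "comb_equiv (cart_prod P Q) (cart_prod Q P)"
proof -
  have "comb_equiv (P \<times> Q) (prod.swap ` (P \<times> Q))"
    by (intro comb_equiv_linear_image linearI) auto
  then show ?thesis
    unfolding product_swap
    by (rule comb_equiv_trans[OF comb_equiv_sym[OF comb_equiv_cart_prod]
          comb_equiv_trans[OF _ comb_equiv_cart_prod]])
qed

lemma comb_equiv_cart_prod_assoc:
  "comb_equiv (cart_prod (cart_prod P Q) R) (cart_prod P (cart_prod Q R))"
proof -
  let ?f = "\<lambda>((x, y), z). (x, (y, z))"
  have "comb_equiv ((P \<times> Q) \<times> R) (?f ` ((P \<times> Q) \<times> R))"
    by (intro comb_equiv_linear_image linearI) (auto simp: inj_on_def)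
  also have "?f ` ((P \<times> Q) \<times> R) = P \<times> (Q \<times> R)" by force
  finally have *: "comb_equiv ((P \<times> Q) \<times> R) (P \<times> (Q \<times> R))" .
  have 1: "comb_equiv ((P \<times> Q) \<times> R) (cart_prod (cart_prod P Q) R)"
    by (rule comb_equiv_trans[OF comb_equiv_Times[OF comb_equiv_cart_prod comb_equiv_refl]
          comb_equiv_cart_prod])
  have 2: "comb_equiv (P \<times> (Q \<times> R)) (cart_prod P (cart_prod Q R))"
    by (rule comb_equiv_trans[OF comb_equiv_Times[OF comb_equiv_refl comb_equiv_cart_prod]
          comb_equiv_cart_prod])
  show ?thesis using comb_equiv_trans[OF comb_equiv_sym[OF 1] comb_equiv_trans[OF * 2]] .
qed

lemma comb_equiv_cart_prod_point: "comb_equiv (cart_prod {0} P) P"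
proof -
  have "comb_equiv P ((\<lambda>x. (0 :: rinf, x)) ` P)"
    by (intro comb_equiv_linear_image linearI) (auto simp: inj_on_def)
  also have "(\<lambda>x. (0 :: rinf, x)) ` P = {0} \<times> P" by auto
  finally have "comb_equiv P ({0 :: rinf} \<times> P)" .
  then show ?thesis
    by (rule comb_equiv_sym[OF comb_equiv_trans[OF _ comb_equiv_cart_prod]])
qed

lemma simple_polytope_point: "simple_polytope {a :: 'a::real_vector}"
proof -
  have "polytope {a}" unfolding polytope_def by (intro exI[of _ "{a}"]) simp
  moreover have "adim {a} = 0"
  proof -
    have "dim {0 :: 'a} = card ({} :: 'a set)" by (rule dim_eq_card) (simp_all add: independent_empty span_insert_0)
    then show ?thesis by (simp add: adim_def)
  qed
  moreover have "card {F. is_facet F {a} \<and> v \<in> F} = 0" for v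
  proof -
    have *: "{F. is_facet F {a} \<and> v \<in> F} = {}"
      using \<open>adim {a} = 0\<close> by (auto simp: is_facet_def)
    show ?thesis unfolding * by simp
  qed
  ultimately show ?thesis unfolding simple_polytope_def by simp
qed

quotient_type simple_type = "rinf set" /
  partial: "\<lambda>P Q. simple_polytope P \<and> simple_polytope Q \<and> comb_equiv P Q"
proof (rule part_equivpI)
  show "\<exists>P :: rinf set. simple_polytope P \<and> simple_polytope P \<and> comb_equiv P P"
    using simple_polytope_point comb_equiv_refl by blast
qed (auto simp: symp_def transp_def intro: comb_equiv_sym comb_equiv_trans)

text \<open>
  Combinatorial types form a commutative monoid under the Cartesian product, written additively here
  because the library's type \<^typ>\<open>'m \<Rightarrow>\<^sub>0 'r\<close> of finitely supported functions is the monoid ring of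
  an additively written monoid. The neutral element is the point.
\<close>

instantiation simple_type :: comm_monoid_add
begin

lift_definition zero_simple_type :: simple_type is "{0}"
  by (simp add: simple_polytope_point comb_equiv_refl)

lift_definition plus_simple_type :: "simple_type \<Rightarrow> simple_type \<Rightarrow> simple_type" is cart_prod
  by (simp add: simple_polytope_cart_prod comb_equiv_cart_prod_cong)

instance
proof
  fix a b c :: simple_type
  show "a + b + c = a + (b + c)"
    by transfer (simp add: simple_polytope_cart_prod comb_equiv_cart_prod_assoc)
  show "a + b = b + a"
    by transfer (simp add: simple_polytope_cart_prod comb_equiv_cart_prod_commute)
  show "0 + a = a"
    by transfer (simp add: simple_polytope_cart_prod simple_polytope_point comb_equiv_cart_prod_point)
qed

end

text \<open>
  The ring is the free abelian group on the combinatorial types with the bilinear extension of the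
  Cartesian product, i.e. the integral monoid ring.
\<close>

type_synonym polytope_ring = "simple_type \<Rightarrow>\<^sub>0 int"

definition type_dim :: "simple_type \<Rightarrow> nat" where
  "type_dim p = adim (rep_simple_type p)"

text \<open>Only meaningful for simple polytopes.\<close>

definition comb_type :: "rinf set \<Rightarrow> simple_type" where
  "comb_type P = abs_simple_type P"

definition gen :: "simple_type \<Rightarrow> polytope_ring" where
  "gen p = Poly_Mapping.single p 1"

text \<open>
  The additive extension of the map sending a simple polytope to the sum of its facets; facets of
  simple polytopes are simple, and their types depend only on the type of the polytope. Since the
  facets of a product are the products of a facet of one factor with the other factor, this map is
  a derivation.
\<close>

definition facet_sum :: "simple_type \<Rightarrow> polytope_ring" where
  "facet_sum p = (\<Sum>F\<in>{F. is_facet F (rep_simple_type p)}. gen (comb_type F))"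

definition bd :: "polytope_ring \<Rightarrow> polytope_ring" where
  "bd x = (\<Sum>p\<in>Poly_Mapping.keys x. of_int (Poly_Mapping.lookup x p) * facet_sum p)"


section \<open>Families of polytopes and complexity\<close>

definition polytope_family :: "simple_type set \<Rightarrow> bool" where
  "polytope_family F \<longleftrightarrow> (\<forall>n. {p \<in> F. type_dim p = n} \<noteq> {} \<and> finite {p \<in> F. type_dim p = n})"

definition line_family :: "simple_type set \<Rightarrow> bool" where
  "line_family F \<longleftrightarrow> polytope_family F \<and> (\<forall>n. card {p \<in> F. type_dim p = n} = 1)"

inductive_set subring_generated :: "simple_type set \<Rightarrow> polytope_ring set"
  for F :: "simple_type set" where
  one: "1 \<in> subring_generated F"
| gen: "p \<in> F \<Longrightarrow> gen p \<in> subring_generated F"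
| diff: "x \<in> subring_generated F \<Longrightarrow> y \<in> subring_generated F \<Longrightarrow> x - y \<in> subring_generated F"
| mult: "x \<in> subring_generated F \<Longrightarrow> y \<in> subring_generated F \<Longrightarrow> x * y \<in> subring_generated F"

definition d_family :: "simple_type set \<Rightarrow> bool" where
  "d_family F \<longleftrightarrow> polytope_family F \<and> bd ` subring_generated F \<subseteq> subring_generated F"

text \<open>``The minimal extension to a d-family'' is read as the least one with respect to inclusion.\<close>

definition is_d_closure :: "simple_type set \<Rightarrow> simple_type set \<Rightarrow> bool" where
  "is_d_closure F G \<longleftrightarrow> F \<subseteq> G \<and> d_family G \<and> (\<forall>H. F \<subseteq> H \<and> d_family H \<longrightarrow> G \<subseteq> H)"

definition union_of_line_families :: "nat \<Rightarrow> simple_type set \<Rightarrow> bool" where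
  "union_of_line_families k G \<longleftrightarrow>
     (\<exists>L :: nat \<Rightarrow> simple_type set. (\<forall>i<k. line_family (L i)) \<and> G = (\<Union>i<k. L i))"

text \<open>
  Line families may overlap, so a union of \<open>k\<close> of them can also be a union of more than \<open>k\<close>;
  the complexity is the least possible number.
\<close>

definition has_complexity :: "simple_type set \<Rightarrow> nat \<Rightarrow> bool" where
  "has_complexity F k \<longleftrightarrow> polytope_family F \<and> k \<ge> 1 \<and>
     (\<exists>G. is_d_closure F G \<and> union_of_line_families k G \<and>
          (\<forall>j<k. \<not> union_of_line_families j G))"


section \<open>Nestohedra and the four families\<close>

text \<open>Minkowski sum of simplices; the sum over \<open>B\<close> is the one of \<^theory>\<open>HOL-Library.Set_Algebras\<close>.\<close>

definition nestohedron :: "nat set set \<Rightarrow> rinf set" where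
  "nestohedron B = (\<Sum>S\<in>B. convex hull ((\<lambda>i. Poly_Mapping.single i 1) ` S))"

definition induces_connected :: "nat set set \<Rightarrow> nat set \<Rightarrow> bool" where
  "induces_connected E S \<longleftrightarrow>
     (\<forall>u\<in>S. \<forall>v\<in>S. (u, v) \<in> {(x, y). x \<in> S \<and> y \<in> S \<and> {x, y} \<in> E}\<^sup>*)"

definition graph_building_set :: "nat set \<Rightarrow> nat set set \<Rightarrow> nat set set" where
  "graph_building_set V E = {S. S \<subseteq> V \<and> S \<noteq> {} \<and> induces_connected E S}"

definition graph_associahedron :: "nat set \<Rightarrow> nat set set \<Rightarrow> rinf set" where
  "graph_associahedron V E = nestohedron (graph_building_set V E)"

definition complete_edges :: "nat \<Rightarrow> nat set set" where
  "complete_edges n = {{i, j} |i j. i \<in> {1..n+1} \<and> j \<in> {1..n+1} \<and> i \<noteq> j}"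

text \<open>The centre of the star is the vertex 1.\<close>

definition star_edges :: "nat \<Rightarrow> nat set set" where
  "star_edges n = {{1, j} |j. j \<in> {2..n+1}}"

definition B_Gamma :: "nat \<Rightarrow> nat set set" where
  "B_Gamma n = {{i} |i. i \<in> {1..n+1}} \<union> {S. S \<subseteq> {1..n} \<and> card S \<ge> 2}
     \<union> {{1, n+1} \<union> J |J. J \<subseteq> {2..n}}"

definition B_Mas :: "nat \<Rightarrow> nat set set" where
  "B_Mas n = {{i} |i. i \<in> {1..n+1}} \<union> {{1, 2} \<union> I |I. I \<subseteq> {3..n+1}}
     \<union> {{1} \<union> J |J. J \<noteq> {} \<and> J \<subseteq> {3..n}}"

definition point_type :: simple_type where
  "point_type = comb_type {0}"

definition segment_type :: simple_type where
  "segment_type = comb_type (closed_segment 0 (Poly_Mapping.single 0 1))"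

definition Pe :: "nat \<Rightarrow> simple_type" where
  "Pe n = comb_type (graph_associahedron {1..n+1} (complete_edges n))"

definition St :: "nat \<Rightarrow> simple_type" where
  "St n = comb_type (graph_associahedron {1..n+1} (star_edges n))"

definition P_Gamma :: "nat \<Rightarrow> simple_type" where
  "P_Gamma n = (if n = 0 then point_type else if n = 1 then segment_type
     else comb_type (nestohedron (B_Gamma n)))"

definition P_Mas :: "nat \<Rightarrow> simple_type" where
  "P_Mas n = (if n = 0 then point_type else if n = 1 then segment_type
     else comb_type (nestohedron (B_Mas n)))"

end

theory Submission
  imports Defs
begin

text \<open>
  The nestohedron of a connected building set \<open>B\<close> on \<open>V\<close> is the convex hull of the points
  \<open>p(c) = \<Sum>T\<in>B. e (c T)\<close>, where \<open>c\<close> selects an element of each member of \<open>B\<close>. If \<open>p(c)\<close> and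
  \<open>p(c')\<close> lie in a face, then exchanging a single selected element keeps both points in the face, since
  their sum does not change. Hence a face is described by the sets \<open>\<phi>(T) \<subseteq> T\<close> of elements that are
  selected in it, and \<open>\<phi>\<close> obeys a consistency axiom of rational choice: if \<open>i \<in> \<phi>(T)\<close>, \<open>j \<in> \<phi>(T')\<close>
  and \<open>i, j \<in> T \<inter> T'\<close>, then \<open>i \<in> \<phi>(T')\<close>. This yields that every proper face lies in the face
  \<open>F\<^sub>S\<close> where the coordinate sum over \<open>S\<close> is minimal, for a maximal \<open>S \<in> B\<close> disjoint from \<open>\<phi>(V)\<close>, and that
  every vertex lies on exactly \<open>card V - 1\<close> of these faces. As a Minkowski sum, \<open>F\<^sub>S\<close> splits into the
  nestohedra of the restriction to \<open>S\<close> and of the contraction of \<open>S\<close>, up to multiplicities of summands, which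
  do not affect the combinatorial type. The boundary formula is then a count of subsets.

  For the complexity, a product of polytopes is recognized by its facets: those coming from one factor meet all
  those coming from the other one. In the nestohedra of \<open>Pe\<close>, \<open>St\<close> and \<open>P\<^sub>\<Gamma>\<close>, disjointness of facets
  connects all facets, so these types are indecomposable and belong to every d-family in whose
  ring they occur. In dimension 3 the four types have different numbers of facets.
\<close>

section \<open>Faces of polytopes in real vector spaces\<close>

text \<open>Facets, dimension and simplicity are defined linearly, inside the infinite-dimensional
  \<open>rinf\<close>, whereas a type remembers only the face lattice and \<open>facet_sum\<close>
  is evaluated on an arbitrary representative. These notions therefore have to be recovered from the
  face order before a concrete nestohedron may replace that representative; the geometric input is
  that every proper nonempty face lies in a facet. As \<open>comb_type\<close> is meaningful on
  simple polytopes only, simplicity of the facets accompanies every boundary computation.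

  The four families are what restriction and contraction make of \<open>B(P, n)\<close>: contracting
  a set with \<open>a\<close> but neither \<open>b\<close> nor \<open>c\<close> still ties
  \<open>c\<close> to \<open>b\<close>, which gives \<Gamma>; contracting \<open>b\<close> or
  \<open>c\<close> lifts the tie and leaves a star; contracting a set with both \<open>a\<close> and
  \<open>b\<close> leaves all nonempty sets. For minimality of the closure the facets of single
  vertices are enough: a singleton restricts to a point, so the facet is the contraction alone, with
  no second factor to split off.\<close>

lemma face_convex_combination2:
  assumes "F face_of S" "a \<in> S" "b \<in> S" "0 < t" "t < 1" "(1 - t) *\<^sub>R a + t *\<^sub>R b \<in> F"
  shows "a \<in> F" "b \<in> F"
proof -
  have "a \<in> F \<and> b \<in> F"
  proof (cases "a = b")
    case True
    then have "(1 - t) *\<^sub>R a + t *\<^sub>R b = a" by (simp add: scaleR_diff_left)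
    then show ?thesis using assms True by auto
  next
    case False
    then have "(1 - t) *\<^sub>R a + t *\<^sub>R b \<in> open_segment a b" using assms by (auto simp: in_segment)
    then show ?thesis using face_ofD assms by blast
  qed
  then show "a \<in> F" "b \<in> F" by auto
qed

lemma weighted_sum_concentrated:
  fixes u :: "'a::real_vector \<Rightarrow> real"
  assumes "finite E" "\<And>e. e \<in> E \<Longrightarrow> 0 \<le> u e" "sum u E = 1" "e \<in> E" "u e = 1"
  shows "(\<Sum>x\<in>E. u x *\<^sub>R x) = e"
proof -
  have "sum u (E - {e}) = 0" using assms by (simp add: sum_diff1)
  then have "u x = 0" if "x \<in> E - {e}" for x
    using sum_nonneg_eq_0_iff[of "E - {e}" u] assms that by auto
  then have "(\<Sum>x\<in>E - {e}. u x *\<^sub>R x) = 0" by (intro sum.neutral) auto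
  then show ?thesis using assms by (simp add: sum.remove[of E e])
qed

lemma weighted_sum_split:
  fixes u :: "'a::real_vector \<Rightarrow> real"
  assumes "finite E" "e \<in> E" "u e \<noteq> 1"
  shows "(\<Sum>x\<in>E. u x *\<^sub>R x) = (1 - u e) *\<^sub>R (\<Sum>x\<in>E - {e}. (u x / (1 - u e)) *\<^sub>R x) + u e *\<^sub>R e"
  using assms by (simp add: sum.remove[of E e] scaleR_sum_right)

lemma weights_rescaled:
  fixes u :: "'a::real_vector \<Rightarrow> real"
  assumes "finite E" "\<And>e. e \<in> E \<Longrightarrow> 0 \<le> u e" "sum u E = 1" "e \<in> E" "u e \<noteq> 1"
  shows "u e < 1" "(\<Sum>x\<in>E - {e}. u x / (1 - u e)) = 1" "\<And>x. x \<in> E - {e} \<Longrightarrow> 0 \<le> u x / (1 - u e)"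
proof -
  have s: "sum u (E - {e}) = 1 - u e" using assms by (simp add: sum_diff1)
  have "0 \<le> sum u (E - {e})" using assms by (intro sum_nonneg) auto
  with s assms(5) show l: "u e < 1" by auto
  show "(\<Sum>x\<in>E - {e}. u x / (1 - u e)) = 1"
    using s l by (simp flip: sum_divide_distrib)
  show "0 \<le> u x / (1 - u e)" if "x \<in> E - {e}" for x using assms l that by auto
qed

text \<open>Splitting off \<open>e\<close> reduces many points to two: the other weights, divided by
  \<open>1 - u e\<close>, average to a point of \<open>S\<close>.\<close>

lemma face_convex_combination:
  assumes F: "F face_of S" "convex S" and E: "finite E" "E \<subseteq> S"
    and u: "\<And>e. e \<in> E \<Longrightarrow> 0 \<le> u e" "sum u E = 1" "(\<Sum>x\<in>E. u x *\<^sub>R x) \<in> F" and e: "e \<in> E" "u e > 0"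
  shows "e \<in> F"
proof (cases "u e = 1")
  case True
  then show ?thesis using weighted_sum_concentrated[of E u e] assms by auto
next
  case False
  note w = weights_rescaled[OF E(1) u(1,2) e(1) False]
  let ?y = "\<Sum>x\<in>E - {e}. (u x / (1 - u e)) *\<^sub>R x"
  have "?y \<in> S" using E w by (intro convex_sum F(2)) auto
  moreover have "(1 - u e) *\<^sub>R ?y + u e *\<^sub>R e \<in> F"
    using u(3) unfolding weighted_sum_split[where u=u, OF E(1) e(1) False] .
  ultimately show ?thesis using face_convex_combination2(2)[OF F(1)] e E w(1) by blast
qed

text \<open>A generator that enters a point of \<open>F\<close> with positive weight lies in
  \<open>F\<close> itself, so the weights outside \<open>W \<inter> F\<close> vanish.\<close>

lemma face_of_convex_hull_finite:
  assumes W: "finite W" and F: "F face_of convex hull W"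
  shows "F = convex hull (W \<inter> F)"
proof
  show "convex hull (W \<inter> F) \<subseteq> F"
    using F by (intro hull_minimal) (auto simp: face_of_imp_convex)
  show "F \<subseteq> convex hull (W \<inter> F)"
  proof
    fix x assume x: "x \<in> F"
    then have "x \<in> convex hull W" using face_of_imp_subset[OF F] by auto
    then obtain u where u: "\<And>w. w \<in> W \<Longrightarrow> 0 \<le> u w" "sum u W = 1" "(\<Sum>w\<in>W. u w *\<^sub>R w) = x"
      unfolding convex_hull_finite[OF W] by auto
    have z: "u w = 0" if "w \<in> W - W \<inter> F" for w
      using face_convex_combination[OF F convex_convex_hull W hull_subset, of u w] u x that
      by force
    have "sum u (W \<inter> F) = sum u W" "(\<Sum>w\<in>W \<inter> F. u w *\<^sub>R w) = (\<Sum>w\<in>W. u w *\<^sub>R w)"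
      by (rule sum.mono_neutral_left; use W z in simp)+
    then show "x \<in> convex hull (W \<inter> F)"
      using u W by (auto simp: convex_hull_finite intro!: exI[of _ u])
  qed
qed

lemma face_of_polytope: "polytope P \<Longrightarrow> F face_of P \<Longrightarrow> polytope F"
  unfolding polytope_def using face_of_convex_hull_finite by (metis finite_Int)

lemma finite_faces: assumes "polytope P" shows "finite {F. F face_of P}"
proof -
  obtain W where W: "finite W" "P = convex hull W" using assms by (auto simp: polytope_def)
  have "{F. F face_of P} \<subseteq> (\<lambda>A. convex hull A) ` Pow W"
    using face_of_convex_hull_finite[OF W(1)] W(2) by (blast intro: image_eqI)
  then show ?thesis using W(1) finite_subset by blast
qed

text \<open>If \<open>w\<close> lies strictly between \<open>a\<close> and \<open>b\<close>, mixing
  their coefficients represents \<open>w\<close> by \<open>W\<close>. With a coefficient of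
  \<open>w\<close> other than 1 one could solve for \<open>w\<close> in terms of the other
  generators; hence \<open>a\<close> and \<open>b\<close> both have coefficient 1 at
  \<open>w\<close> and coincide with it.\<close>

lemma extreme_point_of_irredundant:
  assumes W: "finite W" "w \<in> W" "w \<notin> convex hull (W - {w})"
  shows "w extreme_point_of (convex hull W)"
  unfolding extreme_point_of_def
proof (intro conjI ballI notI)
  show "w \<in> convex hull W" using W(2) hull_inc by fast
  fix a b assume ab: "a \<in> convex hull W" "b \<in> convex hull W" "w \<in> open_segment a b"
  obtain \<alpha> where \<alpha>: "\<And>x. x \<in> W \<Longrightarrow> 0 \<le> \<alpha> x" "sum \<alpha> W = 1" "(\<Sum>x\<in>W. \<alpha> x *\<^sub>R x) = a"
    using ab(1) unfolding convex_hull_finite[OF W(1)] by auto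
  obtain \<beta> where \<beta>: "\<And>x. x \<in> W \<Longrightarrow> 0 \<le> \<beta> x" "sum \<beta> W = 1" "(\<Sum>x\<in>W. \<beta> x *\<^sub>R x) = b"
    using ab(2) unfolding convex_hull_finite[OF W(1)] by auto
  obtain t where t: "0 < t" "t < 1" "w = (1 - t) *\<^sub>R a + t *\<^sub>R b" "a \<noteq> b"
    using ab(3) by (auto simp: in_segment)
  define \<gamma> where "\<gamma> x = (1 - t) * \<alpha> x + t * \<beta> x" for x
  have \<gamma>: "\<And>x. x \<in> W \<Longrightarrow> 0 \<le> \<gamma> x" "sum \<gamma> W = 1"
    using \<alpha> \<beta> t by (auto simp: \<gamma>_def sum.distrib simp flip: sum_distrib_left)
  have w: "(\<Sum>x\<in>W. \<gamma> x *\<^sub>R x) = w"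
    unfolding t(3) \<gamma>_def \<alpha>(3)[symmetric] \<beta>(3)[symmetric]
    by (simp add: scaleR_add_left sum.distrib scaleR_sum_right)
  have "\<gamma> w = 1"
  proof (rule ccontr)
    assume n: "\<gamma> w \<noteq> 1"
    note r = weights_rescaled[OF W(1) \<gamma> W(2) n]
    have "(1 - \<gamma> w) *\<^sub>R w = (1 - \<gamma> w) *\<^sub>R (\<Sum>x\<in>W - {w}. (\<gamma> x / (1 - \<gamma> w)) *\<^sub>R x)"
      using weighted_sum_split[where u=\<gamma>, OF W(1,2) n] w by (simp add: scaleR_diff_left algebra_simps)
    then have "w = (\<Sum>x\<in>W - {w}. (\<gamma> x / (1 - \<gamma> w)) *\<^sub>R x)" using r(1) by simp
    then have "w \<in> convex hull (W - {w})"
      using r(2,3) W(1) by (auto simp: convex_hull_finite intro!: exI[of _ "\<lambda>x. \<gamma> x / (1 - \<gamma> w)"])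
    with W(3) show False by simp
  qed
  moreover have le: "\<alpha> w \<le> 1" "\<beta> w \<le> 1"
    using member_le_sum[of w W \<alpha>] member_le_sum[of w W \<beta>] \<alpha> \<beta> W by auto
  ultimately have "\<alpha> w = 1 \<and> \<beta> w = 1"
  proof -
    have "(1 - t) * (1 - \<alpha> w) + t * (1 - \<beta> w) = 0"
      using \<open>\<gamma> w = 1\<close> by (simp add: \<gamma>_def algebra_simps)
    moreover have "0 \<le> (1 - t) * (1 - \<alpha> w)" "0 \<le> t * (1 - \<beta> w)" using le t by auto
    ultimately have "(1 - t) * (1 - \<alpha> w) = 0 \<and> t * (1 - \<beta> w) = 0" by linarith
    then show ?thesis using t by auto
  qed
  then have "a = w" "b = w"
    using weighted_sum_concentrated[OF W(1) \<alpha>(1,2) W(2)] weighted_sum_concentrated[OF W(1) \<beta>(1,2) W(2)]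
      \<alpha>(3) \<beta>(3) by auto
  with t(4) show False by simp
qed

text \<open>A generating set of least cardinality has no redundant point, so all its points are
  extreme.\<close>

lemma polytope_extreme_point_exists:
  assumes "polytope P" "P \<noteq> {}"
  obtains v where "v extreme_point_of P"
proof -
  let ?Q = "\<lambda>W. finite W \<and> P = convex hull W"
  obtain W where W: "?Q W" and min: "\<And>W'. ?Q W' \<Longrightarrow> card W \<le> card W'"
    using ex_has_least_nat[of ?Q _ card] assms(1) unfolding polytope_def by metis
  obtain w where w: "w \<in> W" using W assms(2) by fastforce
  have "w \<notin> convex hull (W - {w})"
  proof
    assume "w \<in> convex hull (W - {w})"
    then have "convex hull (insert w (W - {w})) = convex hull (W - {w})" by (rule hull_redundant)
    then have "?Q (W - {w})" using W w by (simp add: insert_absorb)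
    then have "card W \<le> card (W - {w})" by (rule min)
    then show False using W w by (metis card_Diff1_less not_less)
  qed
  then show ?thesis using extreme_point_of_irredundant w W that by blast
qed

section \<open>Every proper nonempty face lies in a facet\<close>

lemma face_member_of_span:
  assumes F: "F face_of P" and x: "x \<in> P" "x0 \<in> F" "x - x0 \<in> span {y - z |y z. y \<in> F \<and> z \<in> F}"
  shows "x \<in> F"
proof -
  have cF: "convex F" and FP: "F \<subseteq> P" using F by (auto simp: face_of_def)
  obtain c f g where c: "c \<ge> 0" "f \<in> F" "g \<in> F" "x - x0 = c *\<^sub>R (f - g)"
    using span_diff_convex[OF cF _ x(3)] x(2) by blast
  show ?thesis
  proof (cases "c = 0")
    case True then show ?thesis using c x by auto
  next
    case False
    then have p: "c > 0" using c by auto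
    \<comment> \<open>From \<open>x + c g = x0 + c f\<close>, division by \<open>1 + c\<close> shows
      that a proper convex combination of \<open>x\<close> and \<open>g\<close> equals one of
      \<open>x0\<close> and \<open>f\<close>, hence lies in \<open>F\<close>.\<close>
    let ?t = "c / (1 + c)"
    have t: "1 - ?t = 1/(1+c)" "?t > 0" "?t < 1" using p by (auto simp: field_simps)
    have e: "x + c *\<^sub>R g = x0 + c *\<^sub>R f" using c(4) by (simp add: algebra_simps)
    have "(1 - ?t) *\<^sub>R x + ?t *\<^sub>R g = (1/(1+c)) *\<^sub>R (x + c *\<^sub>R g)"
      by (simp add: t scaleR_add_right)
    also have "\<dots> = (1 - ?t) *\<^sub>R x0 + ?t *\<^sub>R f" unfolding e by (simp add: t scaleR_add_right)
    also have "\<dots> \<in> F" using convexD_alt[OF cF x(2) c(2), of ?t] t by auto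
    finally show ?thesis
      using face_convex_combination2(1)[OF F x(1) _ t(2,3)] c(3) FP by blast
  qed
qed

text \<open>The identity minus a projection onto \<open>U\<close>; it stands in for the quotient map
  by \<open>U\<close>.\<close>

lemma exists_linear_with_kernel:
  fixes U :: "'a::real_vector set"
  assumes "subspace U"
  obtains f :: "'a \<Rightarrow> 'a" where "linear f" "\<And>x. f x = 0 \<longleftrightarrow> x \<in> U"
proof -
  have "\<exists>g. range g \<subseteq> U \<and> linear g \<and> (\<forall>v\<in>U. g (id v) = v)"
    using linear_exists_left_inverse_on[of id U] assms linear_id by auto
  then obtain g where g: "range g \<subseteq> U" "linear g" "\<And>v. v \<in> U \<Longrightarrow> g v = v" by auto
  have "linear (\<lambda>x. x - g x)" using g(2) by (intro linear_compose_sub linear_ident)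
  moreover have "x - g x = 0 \<longleftrightarrow> x \<in> U" for x using g(1,3) by (metis eq_iff_diff_eq_0 rangeI subsetD)
  ultimately show ?thesis using that by blast
qed

text \<open>Take \<open>G\<close> of greatest dimension among the proper faces containing
  \<open>F\<close>. Modulo the directions of \<open>G\<close>, the polytope sits in a pointed,
  finitely generated cone. An extreme ray of this cone pulls back to a face \<open>H\<close>
  strictly larger than \<open>G\<close>, so \<open>H = P\<close> by the choice of \<open>G\<close>,
  and \<open>P\<close> has just one direction more than \<open>G\<close>.\<close>

lemma face_in_facet:
  fixes P :: "'a::real_vector set"
  assumes P: "polytope P" and F: "F face_of P" "F \<noteq> {}" "F \<noteq> P"
  obtains G where "is_facet G P" "F \<subseteq> G"
proof -
  let ?Q = "\<lambda>G. G face_of P \<and> F \<subseteq> G \<and> G \<noteq> P"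
  have "adim G < adim P" if "?Q G" for G using adim_face_less[OF P] that F(2) by blast
  then obtain G where G: "?Q G" and max: "\<And>H. ?Q H \<Longrightarrow> adim H \<le> adim G"
    using ex_has_greatest_nat[of ?Q F adim "adim P"] F by (metis less_imp_le_nat order_refl)
  then have GP: "G face_of P" "G \<noteq> P" "G \<noteq> {}" using F(2) by auto
  have maximal: "H = P" if "H face_of P" "G \<subseteq> H" "H \<noteq> G" for H
  proof (rule ccontr)
    assume "H \<noteq> P"
    then have "adim H \<le> adim G" using that G by (intro max) auto
    moreover have "adim G < adim H"
      using that GP face_of_subset[OF GP(1) that(2) face_of_imp_subset[OF that(1)]]
      by (intro adim_face_less[OF face_of_polytope[OF P that(1)]]) auto
    ultimately show False by simp
  qed
  obtain g0 where g0: "g0 \<in> G" using GP(3) by blast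
  obtain W where W: "finite W" "P = convex hull W" using P by (auto simp: polytope_def)
  have cP: "convex P" by (rule polytope_convex[OF P])
  have WP: "W \<subseteq> P" unfolding W(2) by (rule hull_subset)
  let ?D = "{y - z |y z. y \<in> G \<and> z \<in> G}"
  obtain \<pi> :: "'a \<Rightarrow> 'a" where \<pi>: "linear \<pi>" "\<And>x. \<pi> x = 0 \<longleftrightarrow> x \<in> span ?D"
    using exists_linear_with_kernel[OF subspace_span] by blast
  have inG: "x \<in> G \<longleftrightarrow> \<pi> (x - g0) = 0" if "x \<in> P" for x
    
  proof
    assume "x \<in> G"
    then have "x - g0 \<in> ?D" using g0 by blast
    then show "\<pi> (x - g0) = 0" unfolding \<pi>(2) by (rule span_base)
  next
    assume "\<pi> (x - g0) = 0"
    then show "x \<in> G" unfolding \<pi>(2) by (rule face_member_of_span[OF GP(1) that g0])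
  qed
  have \<pi>_comb: "\<pi> ((\<Sum>w\<in>E. u w *\<^sub>R w) - g0) = (\<Sum>w\<in>E. u w *\<^sub>R \<pi> (w - g0))"
    if "sum u E = 1" for u :: "'a \<Rightarrow> real" and E
  proof -
    have "(\<Sum>w\<in>E. u w *\<^sub>R w) - g0 = (\<Sum>w\<in>E. u w *\<^sub>R (w - g0))"
      using that by (simp add: scaleR_diff_right sum_subtractf flip: scaleR_sum_left)
    then show ?thesis by (simp add: linear_sum[OF \<pi>(1)] linear_scale[OF \<pi>(1)])
  qed
  define cone where "cone E = {(\<Sum>w\<in>E. c w *\<^sub>R \<pi> (w - g0)) | c. \<forall>w\<in>E. 0 \<le> (c w :: real)}" for E
  have coneI: "(\<Sum>w\<in>E. c w *\<^sub>R \<pi> (w - g0)) \<in> cone E" if "\<And>w. w \<in> E \<Longrightarrow> 0 \<le> (c w :: real)" for c E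
    using that by (auto simp: cone_def)
  have cone_add: "x + y \<in> cone E" if xy: "x \<in> cone E" "y \<in> cone E" for x y E
  proof -
    obtain c d where "x = (\<Sum>w\<in>E. c w *\<^sub>R \<pi> (w - g0))" "y = (\<Sum>w\<in>E. d w *\<^sub>R \<pi> (w - g0))"
      "\<forall>w\<in>E. 0 \<le> c w" "\<forall>w\<in>E. 0 \<le> d w" using xy by (auto simp: cone_def)
    then show ?thesis
      using coneI[of E "\<lambda>w. c w + d w"] by (simp add: scaleR_add_left sum.distrib)
  qed
  have cone_scale: "t *\<^sub>R x \<in> cone E" if x: "x \<in> cone E" "0 \<le> t" for x t E
  proof -
    obtain c where "x = (\<Sum>w\<in>E. c w *\<^sub>R \<pi> (w - g0))" "\<forall>w\<in>E. 0 \<le> c w"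
      using x by (auto simp: cone_def)
    then show ?thesis
      using coneI[of E "\<lambda>w. t * c w"] x by (simp add: scaleR_sum_right)
  qed
  have cone_zero: "0 \<in> cone E" for E using coneI[of E "\<lambda>_. 0"] by simp
  have cone_sum: "(\<Sum>w\<in>S. c w *\<^sub>R x w) \<in> cone E"
    if "\<And>w. w \<in> S \<Longrightarrow> 0 \<le> c w \<and> x w \<in> cone E" for c x S E
    using that by (induction S rule: infinite_finite_induct) (auto simp: cone_zero cone_add cone_scale)
  \<comment> \<open>A set of generators modulo the span of \<open>G\<close> that is minimal: each of its members spans an extreme ray.\<close>
  let ?R = "\<lambda>E. E \<subseteq> W - G \<and> (\<forall>w\<in>W. \<pi> (w - g0) \<in> cone E)"
  have "?R (W - G)"
  proof (intro conjI ballI)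
    fix w assume w: "w \<in> W"
    show "\<pi> (w - g0) \<in> cone (W - G)"
    proof (cases "w \<in> G")
      case True then show ?thesis using inG w WP cone_zero by auto
    next
      case False
      have "(\<Sum>x\<in>W - G. (if x = w then 1 else 0) *\<^sub>R \<pi> (x - g0)) \<in> cone (W - G)"
        by (rule coneI) auto
      also have "(\<Sum>x\<in>W - G. (if x = w then 1 else 0) *\<^sub>R \<pi> (x - g0)) = \<pi> (w - g0)"
        using W(1) w False by (subst sum.remove[of _ w]) auto
      finally show ?thesis .
    qed
  qed simp
  then obtain E where E: "?R E" and min: "\<And>E'. ?R E' \<Longrightarrow> card E \<le> card E'"
    using ex_has_least_nat[of ?R "W - G" card] by blast
  have finE: "finite E" using E W(1) by (meson finite_Diff finite_subset)
  have EW: "E \<subseteq> W" using E by blast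
  have P_cone: "\<pi> (x - g0) \<in> cone E" if "x \<in> P" for x
  proof -
    obtain u where "\<forall>w\<in>W. 0 \<le> u w" "sum u W = 1" "(\<Sum>w\<in>W. u w *\<^sub>R w) = x"
      using \<open>x \<in> P\<close> unfolding W(2) convex_hull_finite[OF W(1)] by blast
    then show ?thesis using \<pi>_comb[of u W] cone_sum[of W u "\<lambda>w. \<pi> (w - g0)" E] E by auto
  qed
  \<comment> \<open>With normalised weights, a vanishing nonnegative combination is a point of
    \<open>P\<close> sent to 0, hence a point of \<open>G\<close>; a generator with positive weight
    would then lie in \<open>G\<close>, although \<open>E\<close> avoids \<open>G\<close>.\<close>
  have pointed: "c e = 0" if "\<And>w. w \<in> E \<Longrightarrow> 0 \<le> c w" "(\<Sum>w\<in>E. c w *\<^sub>R \<pi> (w - g0)) = 0" "e \<in> E" for c e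
  proof (rule ccontr)
    assume n: "c e \<noteq> 0"
    have s: "sum c E > 0" using n that(1)[OF that(3)] by (intro sum_pos2[OF finE that(3)] that(1)) auto
    let ?u = "\<lambda>w. c w / sum c E"
    have u: "sum ?u E = 1" "\<And>w. w \<in> E \<Longrightarrow> 0 \<le> ?u w" using s that by (auto simp flip: sum_divide_distrib)
    have EP: "E \<subseteq> P" using EW WP by blast
    have xP: "(\<Sum>w\<in>E. ?u w *\<^sub>R w) \<in> P" using u EP finE by (intro convex_sum cP) auto
    have "\<pi> ((\<Sum>w\<in>E. ?u w *\<^sub>R w) - g0) = (1 / sum c E) *\<^sub>R (\<Sum>w\<in>E. c w *\<^sub>R \<pi> (w - g0))"
      unfolding \<pi>_comb[OF u(1)] by (simp add: scaleR_sum_right)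
    then have xG: "(\<Sum>w\<in>E. ?u w *\<^sub>R w) \<in> G" unfolding inG[OF xP] that(2) by simp
    have "0 < ?u e" using s n that(1)[OF that(3)] by simp
    then have "e \<in> G"
      by (rule face_convex_combination[OF GP(1) cP finE EP, of ?u e, OF u(2,1) xG that(3), rotated -1])
    with E \<open>e \<in> E\<close> show False by blast
  qed
  have "E \<noteq> {}"
  proof
    assume "E = {}"
    then have "P \<subseteq> G" using P_cone inG by (auto simp: cone_def)
    with GP face_of_imp_subset show False by blast
  qed
  then obtain e where e: "e \<in> E" by blast
  \<comment> \<open>Otherwise the remaining generators would generate the same cone and
    \<open>E\<close> would not be minimal.\<close>
  have nc: "\<pi> (e - g0) \<notin> cone (E - {e})"
  proof
    assume a: "\<pi> (e - g0) \<in> cone (E - {e})"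
    have gen: "\<pi> (w - g0) \<in> cone (E - {e})" if "w \<in> E" for w
    proof (cases "w = e")
      case False
      have "(\<Sum>x\<in>E - {e}. (if x = w then 1 else 0) *\<^sub>R \<pi> (x - g0)) \<in> cone (E - {e})"
        by (rule coneI) auto
      also have "(\<Sum>x\<in>E - {e}. (if x = w then 1 else 0) *\<^sub>R \<pi> (x - g0)) = \<pi> (w - g0)"
        using finE that False by (subst sum.remove[of _ w]) auto
      finally show ?thesis .
    qed (use a in simp)
    have "x \<in> cone (E - {e})" if "x \<in> cone E" for x
    proof -
      obtain c where c: "x = (\<Sum>w\<in>E. c w *\<^sub>R \<pi> (w - g0))" "\<forall>w\<in>E. 0 \<le> c w"
        using \<open>x \<in> cone E\<close> unfolding cone_def by blast
      show ?thesis unfolding c(1) by (rule cone_sum) (use c(2) gen in blast)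
    qed
    then have "card E \<le> card (E - {e})" using E by (intro min) auto
    then show False using e finE by (metis card_Diff1_less not_less)
  qed
  let ?r = "\<pi> (e - g0)"
  define H where "H = {x \<in> P. \<exists>t\<ge>0. \<pi> (x - g0) = t *\<^sub>R ?r}"
  have "H face_of P"
    unfolding face_of_def
  proof (intro conjI ballI impI)
    show "H \<subseteq> P" by (auto simp: H_def)
    show "convex H"
      unfolding convex_alt
    proof (intro ballI allI impI)
      fix x y u assume h: "x \<in> H" "y \<in> H" "0 \<le> u \<and> u \<le> (1::real)"
      obtain s t where st: "0 \<le> s" "0 \<le> t" "\<pi> (x - g0) = s *\<^sub>R ?r" "\<pi> (y - g0) = t *\<^sub>R ?r"
        using h by (auto simp: H_def)
      have "(1 - u) *\<^sub>R x + u *\<^sub>R y - g0 = (1 - u) *\<^sub>R (x - g0) + u *\<^sub>R (y - g0)"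
        by (simp add: algebra_simps)
      then have "\<pi> ((1 - u) *\<^sub>R x + u *\<^sub>R y - g0) = ((1 - u) * s + u * t) *\<^sub>R ?r"
        using st by (simp add: linear_add[OF \<pi>(1)] linear_scale[OF \<pi>(1)] scaleR_add_left)
      moreover have "(1 - u) *\<^sub>R x + u *\<^sub>R y \<in> P"
        using h convexD_alt[OF cP] by (auto simp: H_def)
      ultimately show "(1 - u) *\<^sub>R x + u *\<^sub>R y \<in> H"
        using h st unfolding H_def by (auto intro!: exI[of _ "(1 - u) * s + u * t"])
    qed
    fix a b x assume h: "a \<in> P" "b \<in> P" "x \<in> H" "x \<in> open_segment a b"
    obtain t where t: "0 < t" "t < 1" "x = (1 - t) *\<^sub>R a + t *\<^sub>R b" using h by (auto simp: in_segment)
    obtain s where s: "0 \<le> s" "\<pi> (x - g0) = s *\<^sub>R ?r" using h by (auto simp: H_def)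
    obtain \<alpha> where \<alpha>: "\<pi> (a - g0) = (\<Sum>w\<in>E. \<alpha> w *\<^sub>R \<pi> (w - g0))" "\<forall>w\<in>E. 0 \<le> \<alpha> w"
      using P_cone[OF h(1)] by (auto simp: cone_def)
    obtain \<beta> where \<beta>: "\<pi> (b - g0) = (\<Sum>w\<in>E. \<beta> w *\<^sub>R \<pi> (w - g0))" "\<forall>w\<in>E. 0 \<le> \<beta> w"
      using P_cone[OF h(2)] by (auto simp: cone_def)
    define \<gamma> where "\<gamma> w = (1 - t) * \<alpha> w + t * \<beta> w" for w
    have \<gamma>0: "\<And>w. w \<in> E \<Longrightarrow> 0 \<le> \<gamma> w" using \<alpha> \<beta> t by (auto simp: \<gamma>_def)
    have "x - g0 = (1 - t) *\<^sub>R (a - g0) + t *\<^sub>R (b - g0)" using t by (simp add: algebra_simps)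
    then have "\<pi> (x - g0) = (1 - t) *\<^sub>R \<pi> (a - g0) + t *\<^sub>R \<pi> (b - g0)"
      by (simp add: linear_add[OF \<pi>(1)] linear_scale[OF \<pi>(1)])
    also have "\<dots> = (\<Sum>w\<in>E. \<gamma> w *\<^sub>R \<pi> (w - g0))"
      unfolding \<alpha> \<beta> \<gamma>_def by (simp add: scaleR_sum_right scaleR_add_left sum.distrib)
    also have "\<dots> = \<gamma> e *\<^sub>R ?r + (\<Sum>w\<in>E - {e}. \<gamma> w *\<^sub>R \<pi> (w - g0))"
      using finE e by (simp add: sum.remove)
    finally have eq: "(s - \<gamma> e) *\<^sub>R ?r = (\<Sum>w\<in>E - {e}. \<gamma> w *\<^sub>R \<pi> (w - g0))"
      using s by (simp add: algebra_simps)
    \<comment> \<open>If \<open>s\<close> exceeded \<open>\<gamma> e\<close>, the ray of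
      \<open>e\<close> would be generated by the others, against \<open>nc\<close>; otherwise moving
      the term across yields a vanishing nonnegative combination, and \<open>pointed\<close>
      applies.\<close>
    have rest: "\<gamma> w = 0" if w: "w \<in> E - {e}" for w
    proof (cases "s - \<gamma> e > 0")
      case True
      have "(1 / (s - \<gamma> e)) *\<^sub>R ((s - \<gamma> e) *\<^sub>R ?r) \<in> cone (E - {e})"
        unfolding eq using \<gamma>0 True by (intro cone_scale coneI) auto
      then show ?thesis using nc True by simp
    next
      case False
      let ?c = "\<lambda>w. if w = e then \<gamma> e - s else \<gamma> w"
      have "(\<Sum>w\<in>E. ?c w *\<^sub>R \<pi> (w - g0)) = (\<gamma> e - s) *\<^sub>R ?r + (\<Sum>w\<in>E - {e}. ?c w *\<^sub>R \<pi> (w - g0))"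
        using finE e by (simp add: sum.remove)
      also have "(\<Sum>w\<in>E - {e}. ?c w *\<^sub>R \<pi> (w - g0)) = (\<Sum>w\<in>E - {e}. \<gamma> w *\<^sub>R \<pi> (w - g0))"
        by (intro sum.cong) auto
      also have "\<dots> = (s - \<gamma> e) *\<^sub>R ?r" by (rule eq[symmetric])
      finally have "(\<Sum>w\<in>E. ?c w *\<^sub>R \<pi> (w - g0)) = 0" by (simp add: algebra_simps)
      then have "?c w = 0" using False \<gamma>0 w by (intro pointed) auto
      then show ?thesis using w by auto
    qed
    have \<alpha>\<beta>: "\<alpha> w = 0" "\<beta> w = 0" if "w \<in> E - {e}" for w
    proof -
      have "(1 - t) * \<alpha> w + t * \<beta> w = 0" using rest[OF that] by (simp add: \<gamma>_def)
      moreover have "0 \<le> (1 - t) * \<alpha> w" "0 \<le> t * \<beta> w" using t \<alpha>(2) \<beta>(2) that by auto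
      ultimately have "(1 - t) * \<alpha> w = 0 \<and> t * \<beta> w = 0" by linarith
      then show "\<alpha> w = 0" "\<beta> w = 0" using t by auto
    qed
    have "\<pi> (a - g0) = \<alpha> e *\<^sub>R ?r" "\<pi> (b - g0) = \<beta> e *\<^sub>R ?r"
      unfolding \<alpha>(1) \<beta>(1) using finE e \<alpha>\<beta> by (simp_all add: sum.remove)
    then show "a \<in> H" "b \<in> H" using h \<alpha>(2) \<beta>(2) e by (auto simp: H_def)
  qed
  moreover have "G \<subseteq> H"
  proof
    fix x assume "x \<in> G"
    then show "x \<in> H" using inG GP face_of_imp_subset by (fastforce simp: H_def intro: exI[of _ 0])
  qed
  moreover have "e \<in> H" "e \<notin> G" using E e WP unfolding H_def by (auto intro!: exI[of _ 1])
  ultimately have HP: "H = P" using maximal by blast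
  obtain A where A: "A \<subseteq> ?D" "independent A" "?D \<subseteq> span A" "card A = dim ?D"
    by (rule basis_exists[of ?D])
  obtain Z where Z: "finite Z" "{x - y |x y. x \<in> P \<and> y \<in> P} \<subseteq> span Z"
    using polytope_finite_dim[OF P] by blast
  have "A \<subseteq> span Z" using A(1) Z(2) GP(1) face_of_imp_subset by blast
  then have finA: "finite A" using independent_span_bound[OF Z(1) A(2)] by blast
  have sp: "span ?D = span A" unfolding span_eq using A(3) subset_trans[OF A(1) span_superset] by (rule conjI)
  have dir: "x - g0 \<in> span (insert (e - g0) A)" if "x \<in> P" for x
  proof -
    obtain t where t: "\<pi> (x - g0) = t *\<^sub>R ?r" using \<open>x \<in> P\<close> HP unfolding H_def by blast
    then have "\<pi> ((x - g0) - t *\<^sub>R (e - g0)) = 0"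
      by (simp add: linear_diff[OF \<pi>(1)] linear_scale[OF \<pi>(1)])
    then show ?thesis unfolding \<pi>(2) sp span_breakdown_eq by blast
  qed
  have "{x - y |x y. x \<in> P \<and> y \<in> P} \<subseteq> span (insert (e - g0) A)"
  proof clarify
    fix x y assume "x \<in> P" "y \<in> P"
    then have "(x - g0) - (y - g0) \<in> span (insert (e - g0) A)" by (intro span_diff dir)
    then show "x - y \<in> span (insert (e - g0) A)" by simp
  qed
  then have "adim P \<le> card (insert (e - g0) A)"
    unfolding adim_def using finA by (intro dim_le_card) auto
  also have "\<dots> \<le> adim G + 1" using A(4) finA by (simp add: adim_def card_insert_if)
  finally have "adim G + 1 = adim P" using adim_face_less[OF P GP(1,3,2)] by simp
  then show ?thesis using that G GP by (auto simp: is_facet_def)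
qed

section \<open>Combinatorial invariance of facets, dimension and simplicity\<close>

text \<open>The condition on dimensions turns into one on inclusions alone, which an isomorphism of
  face lattices preserves.\<close>

lemma is_facet_iff_maximal:
  assumes P: "polytope P" "P \<noteq> {}"
  shows "is_facet F P \<longleftrightarrow> F face_of P \<and> F \<noteq> {} \<and> F \<noteq> P \<and>
    (\<forall>G. G face_of P \<longrightarrow> F \<subseteq> G \<longrightarrow> G = F \<or> G = P)"
proof (intro iffI conjI allI impI)
  assume F: "is_facet F P"
  then show Ff: "F face_of P" "F \<noteq> {}" "F \<noteq> P" by (auto simp: is_facet_def)
  fix G assume G: "G face_of P" "F \<subseteq> G"
  show "G = F \<or> G = P"
  proof (rule ccontr)
    assume n: "\<not> (G = F \<or> G = P)"
    have "F face_of G" using face_of_subset[OF Ff(1) G(2) face_of_imp_subset[OF G(1)]] .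
    then have "adim F < adim G"
      using n Ff adim_face_less[OF face_of_polytope[OF P(1) G(1)]] by blast
    moreover have "adim G < adim P" using n Ff G by (intro adim_face_less[OF P(1) G(1)]) auto
    ultimately show False using F by (simp add: is_facet_def)
  qed
next
  assume *: "F face_of P \<and> F \<noteq> {} \<and> F \<noteq> P \<and> (\<forall>G. G face_of P \<longrightarrow> F \<subseteq> G \<longrightarrow> G = F \<or> G = P)"
  then obtain H where H: "is_facet H P" "F \<subseteq> H" using face_in_facet[OF P(1), of F] by blast
  then have "H = F" using * by (auto simp: is_facet_def)
  then show "is_facet F P" using H by simp
qed

lemma adim_singleton: "adim {a :: 'a::real_vector} = 0"
proof -
  have "dim {0 :: 'a} = card ({} :: 'a set)"
    by (rule dim_eq_card) (simp_all add: independent_empty span_insert_0)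
  then show ?thesis by (simp add: adim_def)
qed

lemma positive_adim_facet_exists:
  assumes P: "polytope P" "P \<noteq> {}" "adim P \<noteq> 0"
  obtains F where "is_facet F P"
proof -
  obtain v where v: "v extreme_point_of P" using polytope_extreme_point_exists P by blast
  then have "{v} face_of P" by (simp add: face_of_singleton)
  moreover have "{v} \<noteq> P" using P(3) adim_singleton by metis
  ultimately show ?thesis using face_in_facet[OF P(1)] that by blast
qed

section \<open>Transport along an isomorphism of face lattices\<close>

locale face_lattice_iso =
  fixes P :: "'a::real_vector set" and Q :: "'b::real_vector set" and f
  assumes P: "polytope P" "P \<noteq> {}" and Q: "polytope Q"
    and bij: "bij_betw f {F. F face_of P} {G. G face_of Q}"
    and mono: "F face_of P \<Longrightarrow> G face_of P \<Longrightarrow> f F \<subseteq> f G \<longleftrightarrow> F \<subseteq> G"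
begin

lemma face: "F face_of P \<Longrightarrow> f F face_of Q"
  using bij_betwE[OF bij] by auto

lemma eq_iff: "F face_of P \<Longrightarrow> G face_of P \<Longrightarrow> f F = f G \<longleftrightarrow> F = G"
  using mono[of F G] mono[of G F] by auto

lemma surj: "G face_of Q \<Longrightarrow> \<exists>F. F face_of P \<and> G = f F"
  using bij_betw_imp_surj_on[OF bij] by (metis (mono_tags) image_iff mem_Collect_eq)

lemma empty: "f {} = {}"
  by (rule comb_equiv_empty[OF bij mono])

lemma empty_iff: "F face_of P \<Longrightarrow> f F = {} \<longleftrightarrow> F = {}"
  using eq_iff[of F "{}"] empty by simp

lemma P_face: "P face_of P" by (simp add: face_of_refl polytope_convex P)

lemma top: "f P = Q"
proof -
  have "Q face_of Q" by (simp add: face_of_refl polytope_convex Q)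
  then obtain F where F: "F face_of P" "Q = f F" using surj by blast
  then have "Q \<subseteq> f P" using mono[OF F(1) P_face] face_of_imp_subset by blast
  then show ?thesis using face_of_imp_subset[OF face[OF P_face]] by blast
qed

lemma Q_nonempty: "Q \<noteq> {}"
  using empty_iff[OF P_face] top P by auto

lemma is_facet_iff: assumes F: "F face_of P" shows "is_facet (f F) Q \<longleftrightarrow> is_facet F P"
proof -
  have "(\<forall>G. G face_of Q \<longrightarrow> f F \<subseteq> G \<longrightarrow> G = f F \<or> G = Q) \<longleftrightarrow>
    (\<forall>G. G face_of P \<longrightarrow> F \<subseteq> G \<longrightarrow> G = F \<or> G = P)" (is "?l \<longleftrightarrow> ?r")
  proof
    assume l: ?l
    show ?r
    proof (intro allI impI)
      fix G assume G: "G face_of P" "F \<subseteq> G"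
      then have "f G = f F \<or> f G = f P" using l F face mono top by simp
      then show "G = F \<or> G = P" using G F P_face eq_iff by auto
    qed
  next
    assume r: ?r
    show ?l
    proof (intro allI impI)
      fix H assume H: "H face_of Q" "f F \<subseteq> H"
      then obtain G where "G face_of P" "H = f G" using surj by blast
      then show "H = f F \<or> H = Q" using r H F mono top by auto
    qed
  qed
  then show ?thesis
    unfolding is_facet_iff_maximal[OF P] is_facet_iff_maximal[OF Q Q_nonempty]
    using F face empty_iff eq_iff[OF F P_face] top by auto
qed

lemma facets: "{G. is_facet G Q} = f ` {F. is_facet F P}"
proof (intro equalityI subsetI)
  fix G assume "G \<in> {G. is_facet G Q}"
  then have G: "is_facet G Q" by simp
  then obtain F where F: "F face_of P" "G = f F" using surj unfolding is_facet_def by blast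
  with G have "is_facet F P" using is_facet_iff by blast
  with F show "G \<in> f ` {F. is_facet F P}" by blast
next
  fix G assume "G \<in> f ` {F. is_facet F P}"
  then obtain F where "is_facet F P" "G = f F" by blast
  then show "G \<in> {G. is_facet G Q}" using is_facet_iff unfolding is_facet_def by blast
qed

lemma restrict: assumes F: "F face_of P" "F \<noteq> {}" shows "face_lattice_iso F (f F) f"
proof
  show "polytope F" "F \<noteq> {}" "polytope (f F)"
    using F face_of_polytope P Q face by blast+
  have sub: "G face_of F \<longleftrightarrow> G face_of P \<and> G \<subseteq> F" for G by (rule face_of_face[OF F(1)])
  have sub': "G face_of f F \<longleftrightarrow> G face_of Q \<and> G \<subseteq> f F" for G by (rule face_of_face[OF face[OF F(1)]])
  show "bij_betw f {G. G face_of F} {G. G face_of f F}"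
    unfolding bij_betw_def
  proof
    show "inj_on f {G. G face_of F}" using eq_iff sub by (auto simp: inj_on_def)
    show "f ` {G. G face_of F} = {G. G face_of f F}"
    proof (intro equalityI subsetI)
      fix H assume "H \<in> {G. G face_of f F}"
      then have H: "H face_of Q" "H \<subseteq> f F" using sub' by auto
      then obtain G where "G face_of P" "H = f G" using surj by blast
      then show "H \<in> f ` {G. G face_of F}" using H mono F sub by auto
    next
      fix H assume "H \<in> f ` {G. G face_of F}"
      then obtain G where "G face_of P" "G \<subseteq> F" "H = f G" using sub by auto
      then show "H \<in> {G. G face_of f F}" unfolding mem_Collect_eq sub' using face mono F(1) by blast
    qed
  qed
  show "f G \<subseteq> f H \<longleftrightarrow> G \<subseteq> H" if "G face_of F" "H face_of F" for G H
    using that sub mono by blast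
qed

lemma comb_equiv: "comb_equiv P Q"
  unfolding comb_equiv_def using bij mono by blast

lemma comb_equiv_restrict: "F face_of P \<Longrightarrow> comb_equiv F (f F)"
  using face_lattice_iso.comb_equiv[OF restrict] empty comb_equiv_refl[of "{}"]
  by (cases "F = {}") (auto simp: comb_equiv_def)

end

lemma comb_equiv_obtain:
  fixes P :: "'a::real_vector set" and Q :: "'b::real_vector set"
  assumes "comb_equiv P Q" "polytope P" "P \<noteq> {}" "polytope Q"
  obtains f where "face_lattice_iso P Q f"
  using assms unfolding comb_equiv_def face_lattice_iso_def by blast

text \<open>Induction on the dimension: an isomorphism takes a facet to a facet and restricts to an
  isomorphism between them, and on both sides a facet has one dimension less.\<close>

lemma adim_comb_equiv:
  fixes P :: "'a::real_vector set" and Q :: "'b::real_vector set"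
  assumes "comb_equiv P Q" "polytope P" "P \<noteq> {}" "polytope Q"
  shows "adim P = adim Q"
  using assms
proof (induction "adim P" arbitrary: P Q)
  case 0
  obtain f where "face_lattice_iso P Q f" using comb_equiv_obtain 0 by blast
  then interpret face_lattice_iso P Q f .
  show ?case
  proof (rule ccontr)
    assume "adim P \<noteq> adim Q"
    then obtain G where "is_facet G Q" using positive_adim_facet_exists Q Q_nonempty 0(1) by metis
    then obtain F where "is_facet F P" using facets by blast
    with 0(1) show False by (simp add: is_facet_def)
  qed
next
  case (Suc d)
  obtain f where "face_lattice_iso P Q f" using comb_equiv_obtain Suc.prems by blast
  then interpret face_lattice_iso P Q f .
  obtain F where F: "is_facet F P" using positive_adim_facet_exists P Suc(2) by (metis nat.distinct(1))
  then have Ff: "F face_of P" "F \<noteq> {}" "d = adim F" using Suc(2) by (auto simp: is_facet_def)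
  have "adim F = adim (f F)"
    using Ff face_of_polytope[OF P(1)] face_of_polytope[OF Q] face by (intro Suc(1) comb_equiv_restrict) blast+
  moreover have "is_facet (f F) Q" using F Ff is_facet_iff by blast
  ultimately show ?case using F by (simp add: is_facet_def)
qed

text \<open>The face corresponding to a vertex \<open>v\<close> of \<open>Q\<close> is nonempty, so
  it has a vertex \<open>u\<close>, and \<open>{u}\<close> can only go to \<open>{v}\<close>. The
  facets through \<open>u\<close> and those through \<open>v\<close> therefore correspond.\<close>

lemma simple_polytope_comb_equiv:
  fixes P :: "'a::real_vector set" and Q :: "'b::real_vector set"
  assumes eq: "comb_equiv P Q" and sP: "simple_polytope P" and Q: "polytope Q"
  shows "simple_polytope Q"
proof -
  have P: "polytope P" "P \<noteq> {}" using sP by (auto simp: simple_polytope_def)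
  obtain f where "face_lattice_iso P Q f" using comb_equiv_obtain eq P Q by blast
  then interpret face_lattice_iso P Q f .
  show ?thesis
    unfolding simple_polytope_def
  proof (intro conjI allI impI Q Q_nonempty)
    fix v assume "v extreme_point_of Q"
    then have v: "{v} face_of Q" by (simp add: face_of_singleton)
    then obtain A where A: "A face_of P" "{v} = f A" using surj by blast
    then have "A \<noteq> {}" using empty by auto
    then obtain u where "u extreme_point_of A"
      using polytope_extreme_point_exists face_of_polytope P A by blast
    then have "{u} face_of A" by (simp add: face_of_singleton)
    then have u: "{u} face_of P" "{u} \<subseteq> A" using face_of_face[OF A(1)] by auto
    then have "f {u} \<subseteq> {v}" "f {u} \<noteq> {}" using A mono empty_iff by auto
    then have fu: "f {u} = {v}" by blast
    have "{G. is_facet G Q \<and> v \<in> G} = f ` {F. is_facet F P \<and> u \<in> F}"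
    proof -
      have "v \<in> f F \<longleftrightarrow> u \<in> F" if "is_facet F P" for F
        using mono[OF u(1), of F] that fu by (auto simp: is_facet_def)
      moreover have "{G. is_facet G Q \<and> v \<in> G} = {G \<in> f ` {F. is_facet F P}. v \<in> G}"
        unfolding facets[symmetric] by auto
      ultimately show ?thesis by auto
    qed
    moreover have "inj_on f {F. is_facet F P \<and> u \<in> F}"
      using eq_iff by (auto simp: inj_on_def is_facet_def)
    ultimately have "card {G. is_facet G Q \<and> v \<in> G} = card {F. is_facet F P \<and> u \<in> F}"
      by (simp add: card_image)
    also have "\<dots> = adim P"
      using sP u(1) by (simp add: simple_polytope_def face_of_singleton)
    also have "\<dots> = adim Q" by (rule adim_comb_equiv[OF eq P Q])
    finally show "card {G. is_facet G Q \<and> v \<in> G} = adim Q" .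
  qed
qed

section \<open>Types of simple polytopes and their ring\<close>

lemma simple_rep: "simple_polytope (rep_simple_type p)"
  using Quotient_rep_reflp[OF Quotient_simple_type] by blast

lemma comb_type_rep: "comb_type (rep_simple_type p) = p"
  unfolding comb_type_def by (rule Quotient_abs_rep[OF Quotient_simple_type])

lemma comb_type_eq_iff:
  "simple_polytope P \<Longrightarrow> simple_polytope Q \<Longrightarrow> comb_type P = comb_type Q \<longleftrightarrow> comb_equiv P Q"
  using Quotient_rel[OF Quotient_simple_type, of P Q] comb_equiv_refl
  by (auto simp: comb_type_def)

lemma comb_equiv_rep: "simple_polytope P \<Longrightarrow> comb_equiv P (rep_simple_type (comb_type P))"
  using comb_type_eq_iff[OF _ simple_rep, of P "comb_type P"] comb_type_rep by simp

lemma comb_type_cart_prod: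
  "simple_polytope P \<Longrightarrow> simple_polytope Q \<Longrightarrow> comb_type (cart_prod P Q) = comb_type P + comb_type Q"
  unfolding comb_type_def by (rule plus_simple_type.abs_eq[symmetric]) (auto intro: comb_equiv_refl)

lemma comb_type_zero: "comb_type {0} = 0"
  by (simp add: comb_type_def zero_simple_type_def)

lemma adim_comb_equiv_simple:
  "comb_equiv P Q \<Longrightarrow> simple_polytope P \<Longrightarrow> simple_polytope Q \<Longrightarrow> adim P = adim Q"
  unfolding simple_polytope_def by (rule adim_comb_equiv) auto

lemma type_dim_comb_type: "simple_polytope P \<Longrightarrow> type_dim (comb_type P) = adim P"
  unfolding type_dim_def using adim_comb_equiv_simple[OF comb_equiv_rep _ simple_rep] by simp

lemma finite_facets: "polytope P \<Longrightarrow> finite {F. is_facet F P}"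
  using finite_faces by (rule finite_subset[rotated]) (auto simp: is_facet_def)

lemma comb_equiv_singleton:
  fixes a :: "'a::real_vector" and b :: "'b::real_vector"
  shows "comb_equiv {a} {b}"
proof -
  have face: "{F. F face_of {c}} = {{}, {c}}" for c :: "'c::real_vector"
  proof -
    have "{c} face_of {c}" by (simp add: face_of_refl)
    then show ?thesis using face_of_imp_subset[of _ "{c}"] by (auto simp: subset_singleton_iff)
  qed
  have "bij_betw (\<lambda>F. if F = {} then {} else {b}) {F. F face_of {a}} {G. G face_of {b}}"
    unfolding face bij_betw_def by (auto simp: inj_on_def)
  moreover have "(if F = {} then {} else {b}) \<subseteq> (if G = {} then {} else {b}) \<longleftrightarrow> F \<subseteq> G"
    if "F face_of {a}" "G face_of {a}" for F G
    using that face_of_imp_subset[of _ "{a}"] by (auto simp: subset_singleton_iff)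
  ultimately show ?thesis unfolding comb_equiv_def by blast
qed

lemma type_dim_eq_0_iff: "type_dim p = 0 \<longleftrightarrow> p = 0"
proof
  let ?P = "rep_simple_type p"
  assume "type_dim p = 0"
  then have d: "adim ?P = 0" by (simp add: type_dim_def)
  have P: "polytope ?P" "?P \<noteq> {}" using simple_rep[of p] by (auto simp: simple_polytope_def)
  then obtain v where v: "v extreme_point_of ?P" using polytope_extreme_point_exists by blast
  then have "?P = {v}" using adim_face_less[OF P(1), of "{v}"] d by (auto simp: face_of_singleton)
  then have "p = comb_type {v}" using comb_type_rep by metis
  then show "p = 0"
    using comb_type_eq_iff[OF simple_polytope_point simple_polytope_point] comb_equiv_singleton
      comb_type_zero by metis
next
  assume "p = 0"
  then show "type_dim p = 0"
    using type_dim_comb_type[OF simple_polytope_point, of 0] adim_singleton by (simp add: comb_type_zero)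
qed

text \<open>Facet types carry information only if the facets are simple. This is recorded as a
  property of the type; for nestohedra it comes from the product structure of their facets.\<close>

definition facets_simple :: "simple_type \<Rightarrow> bool" where
  "facets_simple p \<longleftrightarrow> (\<forall>F. is_facet F (rep_simple_type p) \<longrightarrow> simple_polytope F)"

lemma comb_equiv_facets:
  fixes P Q :: "rinf set"
  assumes sP: "simple_polytope P" "\<And>F. is_facet F P \<Longrightarrow> simple_polytope F"
    and Q: "simple_polytope Q" and eq: "comb_equiv P Q"
  obtains f where "bij_betw f {F. is_facet F P} {G. is_facet G Q}"
    "\<And>F. is_facet F P \<Longrightarrow> simple_polytope (f F) \<and> comb_type (f F) = comb_type F"
proof -
  have P': "polytope P" "P \<noteq> {}" "polytope Q" using sP Q by (auto simp: simple_polytope_def)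
  obtain f where "face_lattice_iso P Q f" using comb_equiv_obtain eq P' by blast
  then interpret face_lattice_iso P Q f .
  have "bij_betw f {F. is_facet F P} {G. is_facet G Q}"
    unfolding bij_betw_def facets using eq_iff by (auto simp: inj_on_def is_facet_def)
  moreover have "simple_polytope (f F) \<and> comb_type (f F) = comb_type F" if F: "is_facet F P" for F
  proof -
    have Ff: "F face_of P" using F by (simp add: is_facet_def)
    have s: "simple_polytope (f F)"
      using simple_polytope_comb_equiv[OF comb_equiv_restrict[OF Ff] sP(2)[OF F]]
        face_of_polytope[OF P'(3) face[OF Ff]] by blast
    then show ?thesis using comb_type_eq_iff[OF sP(2)[OF F] s] comb_equiv_restrict[OF Ff] by simp
  qed
  ultimately show ?thesis using that by blast
qed

text \<open>The facets of \<open>P\<close> biject with those of the chosen representative of its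
  type and have the same types, so every computation on the representative can be made on
  \<open>P\<close>.\<close>

lemma
  assumes P: "simple_polytope P" "\<And>F. is_facet F P \<Longrightarrow> simple_polytope F"
  shows facet_sum_comb_type: "facet_sum (comb_type P) = (\<Sum>F\<in>{F. is_facet F P}. gen (comb_type F))"
    and facets_simple_comb_type: "facets_simple (comb_type P)"
    and card_facets_rep: "card {F. is_facet F (rep_simple_type (comb_type P))} = card {F. is_facet F P}"
proof -
  obtain f where f: "bij_betw f {F. is_facet F P} {G. is_facet G (rep_simple_type (comb_type P))}"
    "\<And>F. is_facet F P \<Longrightarrow> simple_polytope (f F) \<and> comb_type (f F) = comb_type F"
    using comb_equiv_facets[OF P simple_rep comb_equiv_rep[OF P(1)]] by blast
  show "facet_sum (comb_type P) = (\<Sum>F\<in>{F. is_facet F P}. gen (comb_type F))"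
    unfolding facet_sum_def sum.reindex_bij_betw[OF f(1), symmetric] using f(2) by (intro sum.cong) auto
  show "facets_simple (comb_type P)"
    unfolding facets_simple_def
  proof (intro allI impI)
    fix G assume "is_facet G (rep_simple_type (comb_type P))"
    then have "G \<in> f ` {F. is_facet F P}" using bij_betw_imp_surj_on[OF f(1)] by simp
    then show "simple_polytope G" using f(2) by blast
  qed
  show "card {F. is_facet F (rep_simple_type (comb_type P))} = card {F. is_facet F P}"
    using bij_betw_same_card[OF f(1)] by simp
qed

section \<open>Facets and facet sums of products\<close>

lemma gen_add: "gen (p + q) = gen p * gen q"
  by (simp add: gen_def mult_single)

lemma gen_zero: "gen 0 = 1"
  by (simp add: gen_def single_one)

lemma bd_gen: "bd (gen p) = facet_sum p"
  by (simp add: bd_def gen_def)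

lemma
  fixes P Q :: "rinf set"
  assumes P: "polytope P" "P \<noteq> {}" and Q: "polytope Q" "Q \<noteq> {}"
  shows facets_cart_prod: "{C. is_facet C (cart_prod P Q)} =
      (\<lambda>F. cart_prod F Q) ` {F. is_facet F P} \<union> (\<lambda>G. cart_prod P G) ` {G. is_facet G Q}" (is ?A)
    and facets_cart_prod_disjoint: "(\<lambda>F. cart_prod F Q) ` {F. is_facet F P} \<inter>
      (\<lambda>G. cart_prod P G) ` {G. is_facet G Q} = {}" (is ?B)
    and inj_on_facets_cart_prod: "inj_on (\<lambda>F. cart_prod F Q) {F. is_facet F P}"
      "inj_on (\<lambda>G. cart_prod P G) {G. is_facet G Q}" (is ?D)
proof -
  let ?i = "\<lambda>(x, y). interleave x y"
  note i = linear_interleave inj_interleave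
  have eq: "cart_prod A B = cart_prod A' B' \<longleftrightarrow> A \<times> B = A' \<times> B'" for A B A' B'
    unfolding cart_prod_def by (rule inj_image_eq_iff[OF i(2)])
  have "is_facet C (cart_prod P Q) \<longleftrightarrow> (\<exists>D. is_facet D (P \<times> Q) \<and> C = ?i ` D)" for C
  proof
    assume C: "is_facet C (cart_prod P Q)"
    then have "C \<subseteq> ?i ` (P \<times> Q)" by (simp add: is_facet_def face_of_imp_subset cart_prod_def)
    then obtain D where "C = ?i ` D" by (rule subset_imageE)
    then show "\<exists>D. is_facet D (P \<times> Q) \<and> C = ?i ` D"
      using C is_facet_linear_image[OF i] unfolding cart_prod_def by blast
  qed (use is_facet_linear_image[OF i] in \<open>auto simp: cart_prod_def\<close>)
  then show ?A unfolding is_facet_Times[OF P Q] by (auto simp: cart_prod_def)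
  have "is_facet F P \<Longrightarrow> F \<noteq> P \<and> F \<noteq> {}" for F by (auto simp: is_facet_def)
  then show ?B using P Q by (auto simp: eq times_eq_iff)
  show "inj_on (\<lambda>F. cart_prod F Q) {F. is_facet F P}" ?D
    using P Q by (auto simp: inj_on_def eq times_eq_iff)
qed

text \<open>The facets of the product form two disjoint groups, one for each factor; summing over
  them gives the Leibniz rule.\<close>

lemma
  assumes "facets_simple p" "facets_simple q"
  shows facets_simple_add: "facets_simple (p + q)"
    and facet_sum_add: "facet_sum (p + q) = facet_sum p * gen q + gen p * facet_sum q"
proof -
  let ?P = "rep_simple_type p" and ?Q = "rep_simple_type q"
  have P: "polytope ?P" "?P \<noteq> {}" and Q: "polytope ?Q" "?Q \<noteq> {}"
    using simple_rep[of p] simple_rep[of q] by (auto simp: simple_polytope_def)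
  have pq: "p + q = comb_type (cart_prod ?P ?Q)"
    by (simp add: comb_type_cart_prod simple_rep comb_type_rep)
  have s: "simple_polytope F" if "is_facet F (cart_prod ?P ?Q)" for F
  proof -
    have "F \<in> {C. is_facet C (cart_prod ?P ?Q)}" using that by simp
    then show ?thesis
      unfolding facets_cart_prod[OF P Q] using assms
      by (auto simp: facets_simple_def simple_rep intro!: simple_polytope_cart_prod)
  qed
  have c: "simple_polytope (cart_prod ?P ?Q)" by (simp add: simple_polytope_cart_prod simple_rep)
  show "facets_simple (p + q)" unfolding pq by (rule facets_simple_comb_type[OF c s])
  have 1: "gen (comb_type (cart_prod F ?Q)) = gen (comb_type F) * gen q" if "is_facet F ?P" for F
    using assms that by (simp add: comb_type_cart_prod facets_simple_def simple_rep comb_type_rep gen_add)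
  have 2: "gen (comb_type (cart_prod ?P F)) = gen p * gen (comb_type F)" if "is_facet F ?Q" for F
    using assms that by (simp add: comb_type_cart_prod facets_simple_def simple_rep comb_type_rep gen_add)
  have "facet_sum (p + q) = (\<Sum>C\<in>{C. is_facet C (cart_prod ?P ?Q)}. gen (comb_type C))"
    unfolding pq by (rule facet_sum_comb_type[OF c s])
  also have "\<dots> = (\<Sum>F\<in>{F. is_facet F ?P}. gen (comb_type (cart_prod F ?Q))) +
      (\<Sum>G\<in>{G. is_facet G ?Q}. gen (comb_type (cart_prod ?P G)))"
    unfolding facets_cart_prod[OF P Q]
    using finite_facets P Q facets_cart_prod_disjoint[OF P Q] inj_on_facets_cart_prod[OF P Q]
    by (subst sum.union_disjoint) (auto simp: sum.reindex)
  also have "\<dots> = facet_sum p * gen q + gen p * facet_sum q"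
    unfolding facet_sum_def sum_distrib_left sum_distrib_right using 1 2 by simp
  finally show "facet_sum (p + q) = facet_sum p * gen q + gen p * facet_sum q" .
qed

text \<open>The multiplicative monoid generated by \<open>F\<close>, in additive notation. It
  contains every monomial that can occur in the generated subring.\<close>

inductive_set products :: "simple_type set \<Rightarrow> simple_type set" for F where
  zero: "0 \<in> products F"
| add: "p \<in> F \<Longrightarrow> q \<in> products F \<Longrightarrow> p + q \<in> products F"

lemma products_add: "p \<in> products F \<Longrightarrow> q \<in> products F \<Longrightarrow> p + q \<in> products F"
  by (induction rule: products.induct) (auto simp: add.assoc intro: products.add)

lemma products_base: "p \<in> F \<Longrightarrow> p \<in> products F"
  using products.add[OF _ products.zero] by force

lemma keys_subring_generated: "x \<in> subring_generated F \<Longrightarrow> Poly_Mapping.keys x \<subseteq> products F"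
proof (induction rule: subring_generated.induct)
  case one
  then show ?case by (simp add: products.zero flip: gen_zero) (simp add: gen_def products.zero)
next
  case (gen p)
  then show ?case by (simp add: gen_def products_base)
next
  case (diff x y)
  then show ?case using keys_diff[of x y] by blast
next
  case (mult x y)
  then show ?case using keys_mult[of x y] products_add by blast
qed

lemma subring_generated_zero: "0 \<in> subring_generated F"
  using subring_generated.diff[OF subring_generated.one subring_generated.one] by simp

lemma subring_generated_uminus: "x \<in> subring_generated F \<Longrightarrow> - x \<in> subring_generated F"
  using subring_generated.diff[OF subring_generated_zero] by force

lemma subring_generated_add:
  "x \<in> subring_generated F \<Longrightarrow> y \<in> subring_generated F \<Longrightarrow> x + y \<in> subring_generated F"
  using subring_generated.diff[OF _ subring_generated_uminus] by force

lemma subring_generated_sum: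
  "(\<And>i. i \<in> I \<Longrightarrow> f i \<in> subring_generated F) \<Longrightarrow> sum f I \<in> subring_generated F"
  by (induction I rule: infinite_finite_induct) (auto simp: subring_generated_zero subring_generated_add)

lemma subring_generated_of_int: "of_int k \<in> subring_generated F"
proof -
  have n: "of_nat n \<in> subring_generated F" for n
    by (induction n) (auto simp: subring_generated_zero subring_generated_add subring_generated.one)
  show ?thesis
    using n[of "nat k"] subring_generated_uminus[OF n[of "nat (- k)"]] by (cases "k \<ge> 0") auto
qed

lemma gen_products: "p \<in> products F \<Longrightarrow> gen p \<in> subring_generated F"
  by (induction rule: products.induct) (auto simp: gen_zero gen_add intro: subring_generated.intros)

text \<open>Generators suffice: by the Leibniz rule both conditions pass to products, and
  \<open>bd\<close> is a sum over the monomials.\<close>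

lemma bd_subring_generated:
  assumes F: "\<And>p. p \<in> F \<Longrightarrow> facets_simple p \<and> facet_sum p \<in> subring_generated F"
  shows "bd ` subring_generated F \<subseteq> subring_generated F"
proof clarify
  fix x assume x: "x \<in> subring_generated F"
  have "facets_simple p \<and> facet_sum p \<in> subring_generated F" if "p \<in> products F" for p
    using that
  proof induction
    case zero
    have *: "\<not> is_facet G {0 :: rinf}" for G by (simp add: is_facet_def adim_singleton)
    have "facets_simple 0" "facet_sum 0 = 0"
      using facets_simple_comb_type[OF simple_polytope_point[of 0]]
        facet_sum_comb_type[OF simple_polytope_point[of 0]] * by (auto simp: comb_type_zero)
    then show ?case by (simp add: subring_generated_zero)
  next
    case (add p q)
    then show ?case
      using F[of p] by (auto simp: facet_sum_add intro!: facets_simple_add subring_generated_add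
          subring_generated.mult subring_generated.gen gen_products products_base)
  qed
  then show "bd x \<in> subring_generated F"
    unfolding bd_def using keys_subring_generated[OF x]
    by (intro subring_generated_sum subring_generated.mult subring_generated_of_int) blast+
qed

text \<open>All coefficients in a sum of generators are nonnegative, so nothing cancels and each
  facet type really is a monomial of an element of the subring.\<close>

lemma facet_types_in_products:
  assumes H: "d_family H" and p: "p \<in> H" "facet_sum p = (\<Sum>i\<in>I. gen (t i))"
    and i: "finite I" "i \<in> I"
  shows "t i \<in> products H"
proof -
  have "bd (gen p) \<in> subring_generated H"
    using H subring_generated.gen[OF p(1)] unfolding d_family_def by blast
  then have keys: "Poly_Mapping.keys (facet_sum p) \<subseteq> products H"
    unfolding bd_gen by (rule keys_subring_generated)
  have "Poly_Mapping.lookup (gen (t i)) (t i) \<le> (\<Sum>j\<in>I. Poly_Mapping.lookup (gen (t j)) (t i))"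
    using i by (intro member_le_sum) (auto simp: gen_def lookup_single when_def)
  also have "\<dots> = Poly_Mapping.lookup (facet_sum p) (t i)"
    unfolding p(2) by (simp add: lookup_sum)
  finally have "t i \<in> Poly_Mapping.keys (facet_sum p)"
    by (auto simp: gen_def in_keys_iff)
  with keys show ?thesis by blast
qed

definition indecomposable :: "simple_type \<Rightarrow> bool" where
  "indecomposable p \<longleftrightarrow> p \<noteq> 0 \<and> (\<forall>a b. p = a + b \<longrightarrow> a = 0 \<or> b = 0)"

text \<open>A product equal to an indecomposable type has only one nontrivial factor, which must be
  a member of \<open>F\<close>.\<close>

lemma indecomposable_in_products: "p \<in> products F \<Longrightarrow> indecomposable p \<Longrightarrow> p \<in> F"
proof (induction rule: products.induct)
  case (add p q)
  then consider "p = 0" | "q = 0" unfolding indecomposable_def by blast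
  then show ?case using add by cases auto
qed (simp add: indecomposable_def)

text \<open>
  In a product, a facet coming from one factor meets every facet coming from the other one.
\<close>

lemma indecomposableI:
  assumes P: "simple_polytope P" and C: "is_facet C P"
    and conn: "\<And>F. is_facet F P \<Longrightarrow> F = C \<or> F \<inter> C = {} \<or> (\<exists>G. is_facet G P \<and> F \<inter> G = {} \<and> G \<inter> C = {})"
  shows "indecomposable (comb_type P)"
  unfolding indecomposable_def
proof (intro conjI allI impI)
  have "adim P \<noteq> 0" using C by (auto simp: is_facet_def)
  then show "comb_type P \<noteq> 0" using type_dim_comb_type[OF P] type_dim_eq_0_iff by metis
  fix a b assume ab: "comb_type P = a + b"
  show "a = 0 \<or> b = 0"
  proof (rule ccontr)
    assume "\<not> (a = 0 \<or> b = 0)"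
    let ?A = "rep_simple_type a" and ?B = "rep_simple_type b"
    have n: "adim ?A \<noteq> 0" "adim ?B \<noteq> 0"
      using \<open>\<not> (a = 0 \<or> b = 0)\<close> type_dim_eq_0_iff by (auto simp: type_dim_def)
    have A: "polytope ?A" "?A \<noteq> {}" and B: "polytope ?B" "?B \<noteq> {}"
      using simple_rep[of a] simple_rep[of b] by (auto simp: simple_polytope_def)
    have s: "simple_polytope (cart_prod ?A ?B)" by (simp add: simple_polytope_cart_prod simple_rep)
    have "comb_type P = comb_type (cart_prod ?A ?B)"
      by (simp add: ab comb_type_cart_prod simple_rep comb_type_rep)
    then have "comb_equiv P (cart_prod ?A ?B)" using comb_type_eq_iff P s by blast
    then obtain f where "face_lattice_iso P (cart_prod ?A ?B) f"
      using comb_equiv_obtain P s unfolding simple_polytope_def by blast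
    then interpret face_lattice_iso P "cart_prod ?A ?B" f .
    define L where "L = (\<lambda>F. cart_prod F ?B) ` {F. is_facet F ?A}"
    define R where "R = (\<lambda>G. cart_prod ?A G) ` {G. is_facet G ?B}"
    have img: "f ` {F. is_facet F P} = L \<union> R"
      unfolding L_def R_def using facets facets_cart_prod[OF A B] by simp
    have LR: "L \<inter> R = {}" unfolding L_def R_def by (rule facets_cart_prod_disjoint[OF A B])
    have meet: "X \<inter> Y \<noteq> {}" if X: "X \<in> L" "Y \<in> R" for X Y
    proof -
      obtain F G where FG: "is_facet F ?A" "is_facet G ?B" "X = cart_prod F ?B" "Y = cart_prod ?A G"
        using X unfolding L_def R_def by blast
      then obtain x y where "x \<in> F" "y \<in> G" "x \<in> ?A" "y \<in> ?B"
        using face_of_imp_subset unfolding is_facet_def by blast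
      then have "interleave x y \<in> X \<inter> Y" using FG by (force simp: cart_prod_def)
      then show ?thesis by blast
    qed
    have disj: "f F \<inter> f G = {}" if FG: "is_facet F P" "is_facet G P" "F \<inter> G = {}" for F G
    proof -
      have Ff: "F face_of P" "G face_of P" using FG by (auto simp: is_facet_def)
      have "(f F \<inter> f G) face_of (cart_prod ?A ?B)" using face Ff face_of_Int by blast
      then obtain K where K: "K face_of P" "f F \<inter> f G = f K" using surj by blast
      then have "K \<subseteq> F" "K \<subseteq> G" using mono Ff by blast+
      then have "K = {}" using FG by blast
      then show ?thesis using K empty by simp
    qed
    have mem: "f F \<in> L \<or> f F \<in> R" if "is_facet F P" for F
      using that img by blast
    have same: "f F \<in> L \<longleftrightarrow> f G \<in> L" if FG: "is_facet F P" "is_facet G P" "F \<inter> G = {}" for F G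
      using meet[of "f F" "f G"] meet[of "f G" "f F"] disj[OF FG] mem[OF FG(1)] mem[OF FG(2)]
      by (auto simp: Int_commute)
    \<comment> \<open>Disjoint facets belong to the same group, so the assumed chain of disjoint
      facets places every facet in the group of \<open>C\<close>. Both groups are nonempty, since
      both factors have positive dimension.\<close>
    have all: "f F \<in> L \<longleftrightarrow> f C \<in> L" if F: "is_facet F P" for F
      using conn[OF F]
    proof (elim disjE exE conjE)
      assume "F \<inter> C = {}" then show ?thesis by (rule same[OF F C])
    next
      fix G assume "is_facet G P" "F \<inter> G = {}" "G \<inter> C = {}"
      then show ?thesis using same[OF F, of G] same[OF _ C, of G] by simp
    qed simp
    obtain F G where "is_facet F ?A" "is_facet G ?B"
      using positive_adim_facet_exists[OF A n(1)] positive_adim_facet_exists[OF B n(2)] by metis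
    then have "cart_prod F ?B \<in> L" "cart_prod ?A G \<in> R" unfolding L_def R_def by simp_all
    then have "cart_prod F ?B \<in> f ` {F. is_facet F P}" "cart_prod ?A G \<in> f ` {F. is_facet F P}"
      unfolding img by blast+
    then obtain F' G' where FG: "is_facet F' P" "is_facet G' P" "cart_prod F ?B = f F'" "cart_prod ?A G = f G'"
      by auto
    then have "f G' \<in> L" "f G' \<in> R"
      using all[OF FG(1)] all[OF FG(2)] \<open>cart_prod F ?B \<in> L\<close> \<open>cart_prod ?A G \<in> R\<close> FG(3,4) by metis+
    then show False using LR by blast
  qed
qed

section \<open>Minkowski sums\<close>

text \<open>\<open>G\<close> is \<open>F\<close> with the second summand stretched by
  \<open>c\<close>. A point may have several representations \<open>x + c y\<close>; the crux is
  that membership in \<open>G\<close> can be tested on any of them.\<close>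

lemma
  fixes X Y :: "'a::real_vector set"
  assumes X: "convex X" and Y: "convex Y" and F: "F face_of X + Y" and c: "0 < c"
  defines "G \<equiv> {x + c *\<^sub>R y | x y. x \<in> X \<and> y \<in> Y \<and> x + y \<in> F}"
  shows rescaled_summand_face: "G face_of X + (\<lambda>y. c *\<^sub>R y) ` Y" (is ?A)
    and rescaled_summand_mem_iff: "x \<in> X \<Longrightarrow> y \<in> Y \<Longrightarrow> x + c *\<^sub>R y \<in> G \<longleftrightarrow> x + y \<in> F" (is "_ \<Longrightarrow> _ \<Longrightarrow> ?B")
proof -
  have cF: "convex F" using F by (simp add: face_of_imp_convex)
  have XY: "x + y \<in> X + Y" if "x \<in> X" "y \<in> Y" for x y using that by blast
  have exchange: "x + y' \<in> F" if h: "x \<in> X" "y \<in> Y" "x' \<in> X" "y' \<in> Y" "x + y \<in> F" "x' + y' \<in> F" for x y x' y'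
  proof -
    have "(1 - 1/2) *\<^sub>R (x + y') + (1/2) *\<^sub>R (x' + y) = (1/2) *\<^sub>R (x + y) + (1/2) *\<^sub>R (x' + y')"
      by (simp add: algebra_simps)
    also have "\<dots> \<in> F" using h by (intro convexD[OF cF]) auto
    finally show ?thesis using face_convex_combination2(1)[OF F XY XY, of x y' x' y "1/2"] h by simp
  qed
  have segX: "x1 + y \<in> F" "x2 + y \<in> F"
    if h: "x1 \<in> X" "x2 \<in> X" "y \<in> Y" "0 < t" "t < 1" "(1 - t) *\<^sub>R x1 + t *\<^sub>R x2 + y \<in> F" for x1 x2 y t
  proof -
    have "(1 - t) *\<^sub>R (x1 + y) + t *\<^sub>R (x2 + y) = (1 - t) *\<^sub>R x1 + t *\<^sub>R x2 + y" by (simp add: algebra_simps)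
    then show "x1 + y \<in> F" "x2 + y \<in> F"
      using face_convex_combination2[OF F XY XY, of x1 y x2 y t] h by auto
  qed
  have segY: "x + y1 \<in> F" "x + y2 \<in> F"
    if h: "y1 \<in> Y" "y2 \<in> Y" "x \<in> X" "0 < t" "t < 1" "x + ((1 - t) *\<^sub>R y1 + t *\<^sub>R y2) \<in> F" for y1 y2 x t
  proof -
    have "(1 - t) *\<^sub>R (x + y1) + t *\<^sub>R (x + y2) = x + ((1 - t) *\<^sub>R y1 + t *\<^sub>R y2)" by (simp add: algebra_simps)
    then show "x + y1 \<in> F" "x + y2 \<in> F"
      using face_convex_combination2[OF F XY XY, of x y1 x y2 t] h by auto
  qed
  have mem: "x + c *\<^sub>R y \<in> G \<longleftrightarrow> x + y \<in> F" if xy: "x \<in> X" "y \<in> Y" for x y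
  proof
    assume "x + c *\<^sub>R y \<in> G"
    then obtain \<alpha> \<beta> where ab: "\<alpha> \<in> X" "\<beta> \<in> Y" "\<alpha> + \<beta> \<in> F" "x + c *\<^sub>R y = \<alpha> + c *\<^sub>R \<beta>"
      unfolding G_def by blast
    consider "c = 1" | "c < 1" | "1 < c" by linarith
    then show "x + y \<in> F"
    proof cases
      case 1 then show ?thesis using ab by simp
    next
      case 2
      \<comment> \<open>Chosen so that \<open>x + ?y = \<alpha> + \<beta>\<close> is in
        \<open>F\<close>. As \<open>?y\<close> is a proper convex combination of
        \<open>\<beta>\<close> and \<open>y\<close>, the point \<open>x + y\<close> must be in
        \<open>F\<close> as well.\<close>
      let ?y = "(1 - c) *\<^sub>R \<beta> + c *\<^sub>R y"
      have yY: "?y \<in> Y" using convexD_alt[OF Y ab(2) xy(2), of c] 2 c by simp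
      have "x + ?y = \<alpha> + \<beta>" using ab(4) by (simp add: algebra_simps)
      then have xF: "x + ?y \<in> F" using ab by simp
      then show ?thesis using segY(2)[OF ab(2) xy(2) xy(1) c 2] by simp
    next
      case 3
      \<comment> \<open>After division by \<open>c\<close> the two summands exchange roles, and
        \<open>1/c\<close> is a proper weight.\<close>
      let ?x = "(1 - 1/c) *\<^sub>R \<alpha> + (1/c) *\<^sub>R x"
      have xX: "?x \<in> X" using convexD_alt[OF X ab(1) xy(1), of "1/c"] 3 by simp
      have "(1/c) *\<^sub>R (x + c *\<^sub>R y) = (1/c) *\<^sub>R (\<alpha> + c *\<^sub>R \<beta>)" using ab(4) by simp
      then have "(1/c) *\<^sub>R x + y = (1/c) *\<^sub>R \<alpha> + \<beta>" using c by (simp add: scaleR_add_right)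
      then have "?x + y = \<alpha> + \<beta>" by (simp add: algebra_simps)
      then have "?x + y \<in> F" using ab by simp
      then show ?thesis using segX(2)[OF ab(1) xy(1) xy(2), of "1/c"] 3 by simp
    qed
  next
    assume "x + y \<in> F"
    with xy show "x + c *\<^sub>R y \<in> G" unfolding G_def by blast
  qed
  show ?A
    unfolding face_of_def
  proof (intro conjI ballI impI)
    show "G \<subseteq> X + (\<lambda>y. c *\<^sub>R y) ` Y" unfolding G_def by blast
    have comb: "(1 - u) *\<^sub>R (x + c *\<^sub>R y) + u *\<^sub>R (x' + c *\<^sub>R y') =
        ((1 - u) *\<^sub>R x + u *\<^sub>R x') + c *\<^sub>R ((1 - u) *\<^sub>R y + u *\<^sub>R y')" for u :: real and x y x' y' :: 'a
      by (simp add: scaleR_add_right mult.commute add_ac)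
    show "convex G"
      unfolding convex_alt
    proof (intro ballI allI impI)
      fix g h u assume gh: "g \<in> G" "h \<in> G" and u: "0 \<le> u \<and> u \<le> (1::real)"
      obtain x y where xy: "g = x + c *\<^sub>R y" "x \<in> X" "y \<in> Y" "x + y \<in> F" using gh unfolding G_def by blast
      obtain x' y' where xy': "h = x' + c *\<^sub>R y'" "x' \<in> X" "y' \<in> Y" "x' + y' \<in> F" using gh unfolding G_def by blast
      have "(1 - u) *\<^sub>R (x + y) + u *\<^sub>R (x' + y') \<in> F" using xy xy' u convexD_alt[OF cF] by auto
      moreover have "(1 - u) *\<^sub>R (x + y) + u *\<^sub>R (x' + y') =
          ((1 - u) *\<^sub>R x + u *\<^sub>R x') + ((1 - u) *\<^sub>R y + u *\<^sub>R y')" by (simp add: algebra_simps)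
      moreover have "(1 - u) *\<^sub>R x + u *\<^sub>R x' \<in> X" "(1 - u) *\<^sub>R y + u *\<^sub>R y' \<in> Y"
        using xy xy' u convexD_alt[OF X] convexD_alt[OF Y] by auto
      ultimately show "(1 - u) *\<^sub>R g + u *\<^sub>R h \<in> G" using mem unfolding xy(1) xy'(1) comb by simp
    qed
    fix a b g assume h: "a \<in> X + (\<lambda>y. c *\<^sub>R y) ` Y" "b \<in> X + (\<lambda>y. c *\<^sub>R y) ` Y" "g \<in> G" "g \<in> open_segment a b"
    obtain x y where xy: "a = x + c *\<^sub>R y" "x \<in> X" "y \<in> Y" using h(1) by (auto elim!: set_plus_elim)
    obtain x' y' where xy': "b = x' + c *\<^sub>R y'" "x' \<in> X" "y' \<in> Y" using h(2) by (auto elim!: set_plus_elim)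
    obtain t where t: "0 < t" "t < 1" "g = (1 - t) *\<^sub>R a + t *\<^sub>R b" using h(4) by (auto simp: in_segment)
    have "(1 - t) *\<^sub>R x + t *\<^sub>R x' \<in> X" "(1 - t) *\<^sub>R y + t *\<^sub>R y' \<in> Y"
      using xy xy' t convexD_alt[OF X] convexD_alt[OF Y] by auto
    then have *: "(1 - t) *\<^sub>R x + t *\<^sub>R x' + ((1 - t) *\<^sub>R y + t *\<^sub>R y') \<in> F"
      using mem h(3) unfolding t(3) xy(1) xy'(1) comb by simp
    have "(1 - t) *\<^sub>R x + t *\<^sub>R x' + ((1 - t) *\<^sub>R y + t *\<^sub>R y') =
      (1 - t) *\<^sub>R (x + y) + t *\<^sub>R (x' + y')" by (simp add: algebra_simps)
    then have "x + y \<in> F" "x' + y' \<in> F"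
      using face_convex_combination2[OF F XY[OF xy(2,3)] XY[OF xy'(2,3)] t(1,2)] * by auto
    then show "a \<in> G" "b \<in> G" using mem xy xy' by auto
  qed
  show "x \<in> X \<Longrightarrow> y \<in> Y \<Longrightarrow> ?B" by (rule mem)
qed

lemma comb_equiv_rescaled_summand:
  fixes X Y :: "'a::real_vector set"
  assumes X: "convex X" and Y: "convex Y" and c: "0 < c"
  shows "comb_equiv (X + Y) (X + (\<lambda>y. c *\<^sub>R y) ` Y)"
proof -
  define f where "f F = {x + c *\<^sub>R y | x y. x \<in> X \<and> y \<in> Y \<and> x + y \<in> F}" for F
  have mem: "x + c *\<^sub>R y \<in> f F \<longleftrightarrow> x + y \<in> F" if "F face_of X + Y" "x \<in> X" "y \<in> Y" for F x y
    unfolding f_def by (rule rescaled_summand_mem_iff[OF X Y that(1) c that(2,3)])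
  have face: "f F face_of X + (\<lambda>y. c *\<^sub>R y) ` Y" if "F face_of X + Y" for F
    unfolding f_def by (rule rescaled_summand_face[OF X Y that c])
  have mono: "f F \<subseteq> f G \<longleftrightarrow> F \<subseteq> G" if FG: "F face_of X + Y" "G face_of X + Y" for F G
  proof
    assume sub: "f F \<subseteq> f G"
    show "F \<subseteq> G"
    proof
      fix z assume z: "z \<in> F"
      then have "z \<in> X + Y" using face_of_imp_subset FG by blast
      then obtain x y where xy: "z = x + y" "x \<in> X" "y \<in> Y" by (rule set_plus_elim)
      then have "x + c *\<^sub>R y \<in> f G" using z sub mem[OF FG(1)] by auto
      then show "z \<in> G" using mem[OF FG(2)] xy by simp
    qed
  next
    assume "F \<subseteq> G"
    then show "f F \<subseteq> f G" unfolding f_def by blast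
  qed
  have "bij_betw f {F. F face_of X + Y} {G. G face_of X + (\<lambda>y. c *\<^sub>R y) ` Y}"
    unfolding bij_betw_def
  proof
    show "inj_on f {F. F face_of X + Y}"
    proof (rule inj_onI)
      fix F G assume "F \<in> {F. F face_of X + Y}" "G \<in> {F. F face_of X + Y}" "f F = f G"
      then show "F = G" using mono[of F G] mono[of G F] by simp
    qed
    show "f ` {F. F face_of X + Y} = {G. G face_of X + (\<lambda>y. c *\<^sub>R y) ` Y}"
    proof (intro equalityI subsetI)
      fix G assume "G \<in> {G. G face_of X + (\<lambda>y. c *\<^sub>R y) ` Y}"
      then have G: "G face_of X + (\<lambda>y. c *\<^sub>R y) ` Y" by simp
      let ?Y = "(\<lambda>y. c *\<^sub>R y) ` Y"
      have cY: "convex ?Y" using Y by (rule convex_scaling)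
      have i: "0 < 1 / c" using c by simp
      define F where "F = {x + (1/c) *\<^sub>R y | x y. x \<in> X \<and> y \<in> ?Y \<and> x + y \<in> G}"
      have YY: "(\<lambda>y. (1/c) *\<^sub>R y) ` ?Y = Y" using c by (force simp: image_image)
      have F: "F face_of X + Y"
        using rescaled_summand_face[OF X cY G i] unfolding F_def YY .
      have memF: "x + y \<in> F \<longleftrightarrow> x + c *\<^sub>R y \<in> G" if "x \<in> X" "y \<in> Y" for x y
        using rescaled_summand_mem_iff[OF X cY G i that(1), of "c *\<^sub>R y"] that c unfolding F_def by simp
      have "f F = G"
      proof (intro equalityI subsetI)
        fix z assume "z \<in> f F" then show "z \<in> G" unfolding f_def using memF by blast
      next
        fix z assume z: "z \<in> G"
        then have "z \<in> X + ?Y" using face_of_imp_subset[OF G] by blast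
        then obtain x y where "z = x + c *\<^sub>R y" "x \<in> X" "y \<in> Y" by (auto elim!: set_plus_elim)
        then show "z \<in> f F" unfolding f_def using memF z by blast
      qed
      then show "G \<in> f ` {F. F face_of X + Y}" using F by blast
    next
      fix G assume "G \<in> f ` {F. F face_of X + Y}"
      then show "G \<in> {G. G face_of X + (\<lambda>y. c *\<^sub>R y) ` Y}" using face by blast
    qed
  qed
  then show ?thesis unfolding comb_equiv_def using mono by blast
qed

lemma convex_plus_self: "convex Y \<Longrightarrow> Y + Y = (\<lambda>y. 2 *\<^sub>R y) ` (Y :: 'a::real_vector set)"
proof (intro equalityI subsetI)
  fix z assume Y: "convex Y" and "z \<in> Y + Y"
  then obtain x y where z: "z = x + y" "x \<in> Y" "y \<in> Y" by (auto elim: set_plus_elim)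
  then have "(1/2) *\<^sub>R x + (1/2) *\<^sub>R y \<in> Y" using convexD[OF Y] by simp
  moreover have "z = 2 *\<^sub>R ((1/2) *\<^sub>R x + (1/2) *\<^sub>R y)" using z by (simp add: scaleR_add_right)
  ultimately show "z \<in> (\<lambda>y. 2 *\<^sub>R y) ` Y" by blast
next
  fix z assume "z \<in> (\<lambda>y. 2 *\<^sub>R y) ` Y"
  then show "z \<in> Y + Y" by (auto simp: scaleR_2 intro: set_plus_intro)
qed

text \<open>For convex \<open>Y\<close>, the sum of \<open>Y\<close> with itself is \<open>Y\<close>
  scaled by 2, so this is an instance of rescaling.\<close>

lemma comb_equiv_repeated_summand:
  "convex X \<Longrightarrow> convex Y \<Longrightarrow> comb_equiv (X + Y) (X + (Y + Y))"
  using comb_equiv_rescaled_summand[of X Y 2] by (simp add: convex_plus_self)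

text \<open>Indices with equal image repeat a summand, and repetitions are removed one by one.
  Contraction creates them: different \<open>T\<close> can have the same trace
  \<open>T - S\<close>.\<close>

lemma comb_equiv_sum_reindex:
  fixes A :: "'i \<Rightarrow> 'a::real_vector set"
  assumes "finite I" "convex X" "\<And>i. convex (A i)"
  shows "comb_equiv (X + (\<Sum>i\<in>I. A (g i))) (X + (\<Sum>u\<in>g ` I. A u))"
  using assms(1,2)
proof (induction I arbitrary: X rule: finite_induct)
  case empty
  then show ?case by (simp add: comb_equiv_refl)
next
  case (insert i I)
  have c: "convex (X + A (g i))" by (intro convex_set_plus insert assms)
  have IH: "comb_equiv (X + (\<Sum>i\<in>insert i I. A (g i))) (X + A (g i) + (\<Sum>u\<in>g ` I. A u))"
    using insert.IH[OF c] insert.hyps by (simp add: add.assoc)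
  show ?case
  proof (cases "g i \<in> g ` I")
    case False
    then show ?thesis using IH insert.hyps by (simp add: add.assoc)
  next
    case True
    let ?R = "\<Sum>u\<in>g ` I - {g i}. A u"
    have r: "(\<Sum>u\<in>g ` I. A u) = A (g i) + ?R" using True insert.hyps by (simp add: sum.remove)
    have "convex (X + ?R)" by (intro convex_set_plus convex_set_sum insert assms)
    then have "comb_equiv (X + ?R + A (g i)) (X + ?R + (A (g i) + A (g i)))"
      by (intro comb_equiv_repeated_summand assms)
    from comb_equiv_sym[OF this]
    have "comb_equiv (X + A (g i) + (\<Sum>u\<in>g ` I. A u)) (X + (\<Sum>u\<in>g ` I. A u))"
      unfolding r by (simp add: ac_simps)
    then show ?thesis using comb_equiv_trans[OF IH] True by (simp add: insert_absorb)
  qed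
qed

text \<open>Injectivity is asked for on \<open>P\<close> only, because the maps in question collapse
  other parts of the space: addition on a product, relabelling of coordinates, and the
  parametrisation of a segment.\<close>

lemma comb_equiv_linear_image_inj_on:
  assumes f: "linear f" "inj_on f P" and P: "convex P"
  shows "comb_equiv P (f ` P)"
proof -
  have comb: "f ((1 - t) *\<^sub>R a + t *\<^sub>R b) = (1 - t) *\<^sub>R f a + t *\<^sub>R f b" for a b t
    by (simp add: linear_add[OF f(1)] linear_scale[OF f(1)])
  have inP: "(1 - t) *\<^sub>R a + t *\<^sub>R b \<in> P" if "a \<in> P" "b \<in> P" "0 \<le> t" "t \<le> 1" for a b and t :: real
    using convexD_alt[OF P] that by simp
  have face: "f ` F face_of f ` P" if F: "F face_of P" for F
    unfolding face_of_def
  proof (intro conjI ballI impI)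
    show "f ` F \<subseteq> f ` P" using face_of_imp_subset[OF F] by blast
    show "convex (f ` F)" using face_of_imp_convex[OF F] f(1) by (simp add: convex_linear_image)
    fix a b x assume h: "a \<in> f ` P" "b \<in> f ` P" "x \<in> f ` F" "x \<in> open_segment a b"
    obtain a' b' x' where 1: "a = f a'" "b = f b'" "x = f x'" "a' \<in> P" "b' \<in> P" "x' \<in> F"
      using h by blast
    obtain t where t: "0 < t" "t < 1" "x = (1 - t) *\<^sub>R a + t *\<^sub>R b" using h(4) by (auto simp: in_segment)
    have "f x' = f ((1 - t) *\<^sub>R a' + t *\<^sub>R b')" unfolding comb using t 1 by simp
    then have "x' = (1 - t) *\<^sub>R a' + t *\<^sub>R b'"
      using inj_onD[OF f(2)] face_of_imp_subset[OF F] 1 t inP[of a' b' t] by auto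
    then have "a' \<in> F" "b' \<in> F" using face_convex_combination2[OF F 1(4,5) t(1,2)] 1(6) by auto
    then show "a \<in> f ` F" "b \<in> f ` F" using 1 by auto
  qed
  have surj: "\<exists>F. F face_of P \<and> G = f ` F" if G: "G face_of f ` P" for G
  proof -
    obtain F where F: "F \<subseteq> P" "G = f ` F" using face_of_imp_subset[OF G] by (rule subset_imageE)
    have mem: "x \<in> F \<longleftrightarrow> f x \<in> G" if "x \<in> P" for x
      using inj_on_image_mem_iff[OF f(2) that F(1)] F(2) by simp
    have "F face_of P"
      unfolding face_of_def
    proof (intro conjI ballI impI F(1))
      show "convex F"
        unfolding convex_alt
      proof (intro ballI allI impI)
        fix x y u assume h: "x \<in> F" "y \<in> F" "0 \<le> u \<and> u \<le> (1::real)"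
        have "(1 - u) *\<^sub>R f x + u *\<^sub>R f y \<in> G"
          using convexD_alt[OF face_of_imp_convex[OF G]] h F by blast
        then show "(1 - u) *\<^sub>R x + u *\<^sub>R y \<in> F" using mem[OF inP] h F comb by auto
      qed
      fix a b x assume h: "a \<in> P" "b \<in> P" "x \<in> F" "x \<in> open_segment a b"
      obtain t where t: "0 < t" "t < 1" "x = (1 - t) *\<^sub>R a + t *\<^sub>R b" using h(4) by (auto simp: in_segment)
      have "f ((1 - t) *\<^sub>R a + t *\<^sub>R b) \<in> G" using h(3) F(2) t(3) by blast
      then have "(1 - t) *\<^sub>R f a + t *\<^sub>R f b \<in> G" unfolding comb .
      then have "f a \<in> G" "f b \<in> G"
        using face_convex_combination2[OF G _ _ t(1,2)] h by blast+
      then show "a \<in> F" "b \<in> F" using mem h by auto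
    qed
    then show ?thesis using F by blast
  qed
  have mono: "f ` F \<subseteq> f ` G \<longleftrightarrow> F \<subseteq> G" if "F face_of P" "G face_of P" for F G
    using inj_on_image_subset_iff[OF f(2)] that face_of_imp_subset by blast
  have "bij_betw ((`) f) {F. F face_of P} {G. G face_of f ` P}"
    unfolding bij_betw_def
  proof
    show "inj_on ((`) f) {F. F face_of P}"
    proof (rule inj_onI)
      fix F G assume "F \<in> {F. F face_of P}" "G \<in> {F. F face_of P}" "f ` F = f ` G"
      then show "F = G" using mono[of F G] mono[of G F] by simp
    qed
    show "(`) f ` {F. F face_of P} = {G. G face_of f ` P}" using face surj by blast
  qed
  then show ?thesis unfolding comb_equiv_def using mono by blast
qed

text \<open>With disjoint supports a sum determines both its summands, so addition is injective on
  the product.\<close>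

lemma convex_plus_Times_comb_equiv:
  fixes P Q :: "rinf set"
  assumes "convex P" "convex Q" "S \<inter> T = {}"
    and "\<And>x. x \<in> P \<Longrightarrow> Poly_Mapping.keys x \<subseteq> S" "\<And>y. y \<in> Q \<Longrightarrow> Poly_Mapping.keys y \<subseteq> T"
  shows "comb_equiv (P \<times> Q) (P + Q)"
  unfolding set_plus_image
proof (rule comb_equiv_linear_image_inj_on)
  show "linear (\<lambda>(x, y). x + y :: rinf)"
    by (rule linearI) (auto simp: scaleR_add_right)
  show "convex (P \<times> Q)" using assms by (intro convex_Times)
  show "inj_on (\<lambda>(x, y). x + y) (P \<times> Q)"
  proof (rule inj_onI, clarify)
    fix x y x' y' assume h: "x \<in> P" "y \<in> Q" "x' \<in> P" "y' \<in> Q" "x + y = x' + y'"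
    have z: "Poly_Mapping.lookup u i = 0" if "Poly_Mapping.keys u \<subseteq> U" "i \<notin> U" for u :: rinf and U i
      using that by (auto simp: in_keys_iff)
    have eq: "Poly_Mapping.lookup x i + Poly_Mapping.lookup y i =
        Poly_Mapping.lookup x' i + Poly_Mapping.lookup y' i" for i
      using h(5) by (metis lookup_add)
    have "Poly_Mapping.lookup x i = Poly_Mapping.lookup x' i" for i
    proof (cases "i \<in> S")
      case True
      then have "i \<notin> T" using assms(3) by blast
      then show ?thesis using eq[of i] z[OF assms(5)] h by simp
    next
      case False
      then show ?thesis using z[OF assms(4)] h by simp
    qed
    then have "x = x'" by (simp add: poly_mapping_eqI)
    then show "x = x' \<and> y = y'" using h by simp
  qed
qed

section \<open>Nestohedra of connected building sets\<close>

abbreviation unit_vec :: "nat \<Rightarrow> rinf" where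
  "unit_vec i \<equiv> Poly_Mapping.single i 1"

definition std_simplex :: "nat set \<Rightarrow> rinf set" where
  "std_simplex S = convex hull (unit_vec ` S)"

definition selection_point :: "nat set set \<Rightarrow> (nat set \<Rightarrow> nat) \<Rightarrow> rinf" where
  "selection_point B c = (\<Sum>T\<in>B. unit_vec (c T))"

definition coord_sum :: "nat set \<Rightarrow> rinf \<Rightarrow> real" where
  "coord_sum S x = (\<Sum>i\<in>S. Poly_Mapping.lookup x i)"

lemma linear_lookup: "linear (\<lambda>x :: rinf. Poly_Mapping.lookup x i)"
  by (rule linearI) (simp_all add: lookup_add lookup_scaleR_poly_mapping)

lemma linear_coord_sum: "linear (coord_sum S)"
proof -
  have "coord_sum S = (\<lambda>x. \<Sum>i\<in>S. Poly_Mapping.lookup x i)" by (auto simp: coord_sum_def)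
  then show ?thesis
    using linear_compose_sum[of S "\<lambda>i x. Poly_Mapping.lookup x i"] linear_lookup by fastforce
qed

lemma convex_std_simplex: "convex (std_simplex S)"
  by (simp add: std_simplex_def)

lemma nestohedron_eq: "nestohedron B = (\<Sum>S\<in>B. std_simplex S)"
  by (simp add: nestohedron_def std_simplex_def)

lemma convex_nestohedron: "convex (nestohedron B)"
  unfolding nestohedron_eq by (intro convex_set_sum convex_std_simplex)

lemma sum_unit_vec_sets:
  assumes "finite B"
  shows "(\<Sum>T\<in>B. unit_vec ` \<phi> T) = selection_point B ` Pi B \<phi>"
  unfolding set_sum_alt[OF assms]
proof (intro equalityI subsetI)
  fix x assume "x \<in> {sum s B |s. \<forall>i\<in>B. s i \<in> unit_vec ` \<phi> i}"
  then obtain s where s: "x = sum s B" "\<forall>T\<in>B. \<exists>i\<in>\<phi> T. s T = unit_vec i" by (auto simp: image_iff)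
  then obtain c where c: "\<forall>T\<in>B. c T \<in> \<phi> T \<and> s T = unit_vec (c T)" by metis
  then have "x = selection_point B c" unfolding selection_point_def s(1) by (intro sum.cong) auto
  then show "x \<in> selection_point B ` Pi B \<phi>" using c by blast
next
  fix x assume "x \<in> selection_point B ` Pi B \<phi>"
  then show "x \<in> {sum s B |s. \<forall>i\<in>B. s i \<in> unit_vec ` \<phi> i}"
    by (auto simp: selection_point_def Pi_iff)
qed

text \<open>Convex hulls commute with Minkowski sums, and a sum of vertex sets consists of the sums
  of one vertex from each.\<close>

lemma sum_std_simplex:
  "finite B \<Longrightarrow> (\<Sum>T\<in>B. std_simplex (\<phi> T)) = convex hull (selection_point B ` Pi B \<phi>)"
  by (simp add: std_simplex_def sum_unit_vec_sets flip: convex_hull_set_sum)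

lemma linear_minimum_face:
  fixes N :: "'a::real_vector set"
  assumes "convex N" "linear g" "\<And>x. x \<in> N \<Longrightarrow> m \<le> (g x :: real)"
  shows "{x \<in> N. g x = m} face_of N"
  unfolding face_of_def
proof (intro conjI ballI impI)
  have g: "g ((1 - t) *\<^sub>R a + t *\<^sub>R b) = (1 - t) * g a + t * g b" for a b t
    by (simp add: linear_add[OF assms(2)] linear_scale[OF assms(2)])
  show "convex {x \<in> N. g x = m}"
    unfolding convex_alt
  proof (intro ballI allI impI)
    fix x y u assume "x \<in> {x \<in> N. g x = m}" "y \<in> {x \<in> N. g x = m}" "0 \<le> u \<and> u \<le> (1::real)"
    then show "(1 - u) *\<^sub>R x + u *\<^sub>R y \<in> {x \<in> N. g x = m}"
      using convexD_alt[OF assms(1)] by (auto simp: g) (simp add: algebra_simps)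
  qed
  fix a b x assume h: "a \<in> N" "b \<in> N" "x \<in> {x \<in> N. g x = m}" "x \<in> open_segment a b"
  obtain t where t: "0 < t" "t < 1" "x = (1 - t) *\<^sub>R a + t *\<^sub>R b" using h(4) by (auto simp: in_segment)
  have "(1 - t) * (g a - m) + t * (g b - m) = 0" using h(3) g[of t a b] unfolding t(3) by (simp add: left_diff_distrib right_diff_distrib)
  moreover have "0 \<le> (1 - t) * (g a - m)" "0 \<le> t * (g b - m)" using assms(3) h t by auto
  ultimately have "(1 - t) * (g a - m) = 0 \<and> t * (g b - m) = 0" by linarith
  then show "a \<in> {x \<in> N. g x = m}" "b \<in> {x \<in> N. g x = m}" using t h by auto
qed auto

definition restrict_set :: "nat set set \<Rightarrow> nat set \<Rightarrow> nat set set" where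
  "restrict_set B S = {T \<in> B. T \<subseteq> S}"

text \<open>Traces are collected without multiplicity, although a face of the nestohedron contains
  one summand for each \<open>T\<close>; \<open>comb_equiv_sum_reindex\<close> bridges the
  difference.\<close>

definition contract_set :: "nat set set \<Rightarrow> nat set \<Rightarrow> nat set set" where
  "contract_set B S = (\<lambda>T. T - S) ` {T \<in> B. \<not> T \<subseteq> S}"

text \<open>Only connected building sets: \<open>V\<close> is a member. Varying the selection at
  \<open>V\<close> alone already produces the full dimension.\<close>

locale building_set =
  fixes V :: "nat set" and B :: "nat set set"
  assumes finite_V: "finite V" and top: "V \<in> B"
    and sub: "T \<in> B \<Longrightarrow> T \<subseteq> V" and nonempty: "T \<in> B \<Longrightarrow> T \<noteq> {}"
    and single: "i \<in> V \<Longrightarrow> {i} \<in> B"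
    and union: "S \<in> B \<Longrightarrow> T \<in> B \<Longrightarrow> S \<inter> T \<noteq> {} \<Longrightarrow> S \<union> T \<in> B"
begin

section \<open>Selections and the faces they span\<close>

lemma finite_B: "finite B"
  using finite_subset[of B "Pow V"] sub finite_V by auto

lemma finite_member: "T \<in> B \<Longrightarrow> finite T"
  using sub finite_V finite_subset by blast

lemma V_nonempty: "V \<noteq> {}" using top nonempty by blast

abbreviation N :: "rinf set" where "N \<equiv> nestohedron B"
abbreviation pt :: "(nat set \<Rightarrow> nat) \<Rightarrow> rinf" where "pt \<equiv> selection_point B"
abbreviation Sel :: "(nat set \<Rightarrow> nat) set" where "Sel \<equiv> Pi B (\<lambda>T. T)"

lemma N_eq: "N = convex hull (pt ` Sel)"
  unfolding nestohedron_eq by (rule sum_std_simplex[OF finite_B])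

lemma finite_pts: "finite (pt ` Sel)"
  unfolding sum_unit_vec_sets[OF finite_B, symmetric]
  using finite_member by (intro finite_set_sum) auto

lemma polytope_N: "polytope N"
  unfolding N_eq using finite_pts polytope_def by blast

lemma selection_exists: "\<exists>c. c \<in> Sel"
  using bchoice[of B "\<lambda>T i. i \<in> T"] nonempty by auto

lemma pt_in_N: "c \<in> Sel \<Longrightarrow> pt c \<in> N"
  unfolding N_eq by (intro hull_inc) auto

lemma N_nonempty: "N \<noteq> {}"
  using selection_exists pt_in_N by blast

lemma pt_upd: "T \<in> B \<Longrightarrow> pt (c(T := i)) = pt c - unit_vec (c T) + unit_vec i"
proof -
  assume T: "T \<in> B"
  have "(\<Sum>U\<in>B - {T}. unit_vec ((c(T := i)) U)) = (\<Sum>U\<in>B - {T}. unit_vec (c U))"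
    by (intro sum.cong) auto
  then show ?thesis unfolding selection_point_def using finite_B T by (simp add: sum.remove[of B T])
qed

lemma pt_cong: "(\<And>T. T \<in> B \<Longrightarrow> c T = d T) \<Longrightarrow> pt c = pt d"
  unfolding selection_point_def by (auto intro!: sum.cong)

lemma Sel_upd: "c \<in> Sel \<Longrightarrow> i \<in> T \<Longrightarrow> c(T := i) \<in> Sel"
  by (auto simp: Pi_iff)

lemma face_exchange:
  assumes F: "F face_of N" and c: "c \<in> Sel" "pt c \<in> F" and d: "d \<in> Sel" "pt d \<in> F" and T: "T \<in> B"
  shows "pt (c(T := d T)) \<in> F"
proof -
  let ?x = "pt (c(T := d T))" and ?y = "pt (d(T := c T))"
  have "c T \<in> T" "d T \<in> T" using c d T by auto
  then have in_N: "?x \<in> N" "?y \<in> N" using c d by (auto intro!: pt_in_N Sel_upd)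
  have "?x + ?y = pt c + pt d" by (simp add: pt_upd[OF T])
  then have "(1 - 1/2) *\<^sub>R ?x + (1/2) *\<^sub>R ?y = (1/2) *\<^sub>R pt c + (1/2) *\<^sub>R pt d"
    by (simp flip: scaleR_add_right)
  also have "\<dots> \<in> F" using c d by (intro convexD[OF face_of_imp_convex[OF F]]) auto
  finally show ?thesis using face_convex_combination2(1)[OF F in_N, of "1/2"] by simp
qed

text \<open>The map \<phi> of the overview, for the face \<open>F\<close>.\<close>

definition choices :: "rinf set \<Rightarrow> nat set \<Rightarrow> nat set" where
  "choices F T = {c T | c. c \<in> Sel \<and> pt c \<in> F}"

lemma choices_sub: "T \<in> B \<Longrightarrow> choices F T \<subseteq> T"
  by (auto simp: choices_def Pi_iff)

text \<open>Choices at different members are independent: starting from a point of \<open>F\<close>,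
  the wanted selection is reached by exchanging one entry at a time.\<close>

lemma pt_in_face:
  assumes F: "F face_of N" and c: "\<And>T. T \<in> B \<Longrightarrow> c T \<in> choices F T"
  shows "pt c \<in> F"
proof -
  have "finite A \<Longrightarrow> A \<subseteq> B \<Longrightarrow> \<exists>d\<in>Sel. pt d \<in> F \<and> (\<forall>T\<in>A. d T = c T)" for A
  proof (induction A rule: finite_induct)
    case empty
    have "c V \<in> choices F V" using c top .
    then show ?case unfolding choices_def by auto
  next
    case (insert T A)
    then obtain d where d: "d \<in> Sel" "pt d \<in> F" "\<forall>T\<in>A. d T = c T" by blast
    obtain e where e: "e \<in> Sel" "pt e \<in> F" "c T = e T"
      using c[of T] insert.prems unfolding choices_def by auto
    have "e T \<in> T" using e insert.prems by (auto simp: Pi_iff)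
    then have "d(T := e T) \<in> Sel" "pt (d(T := e T)) \<in> F"
      using face_exchange[OF F d(1,2) e(1,2)] insert.prems d(1) Sel_upd by auto
    moreover have "\<forall>U\<in>insert T A. (d(T := e T)) U = c U" using d(3) e(3) by auto
    ultimately show ?case by blast
  qed
  then obtain d where "pt d \<in> F" "\<forall>T\<in>B. d T = c T" using finite_B by blast
  then show ?thesis using pt_cong[of d c] by simp
qed

lemma face_eq_hull:
  assumes F: "F face_of N" shows "F = convex hull (pt ` {c \<in> Sel. pt c \<in> F})"
proof -
  have "F = convex hull (pt ` Sel \<inter> F)"
    using face_of_convex_hull_finite[OF finite_pts] F unfolding N_eq by blast
  also have "pt ` Sel \<inter> F = pt ` {c \<in> Sel. pt c \<in> F}" by blast
  finally show ?thesis .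
qed

lemma face_point_exists: "F face_of N \<Longrightarrow> F \<noteq> {} \<Longrightarrow> \<exists>c\<in>Sel. pt c \<in> F"
proof (rule ccontr)
  assume F: "F face_of N" "F \<noteq> {}" and "\<not> (\<exists>c\<in>Sel. pt c \<in> F)"
  then have "{c \<in> Sel. pt c \<in> F} = {}" by blast
  with F face_eq_hull[OF F(1)] show False by simp
qed

text \<open>Exchange yields a point of \<open>F\<close> that selects \<open>i\<close> at
  \<open>T\<close> and \<open>j\<close> at \<open>T'\<close>. Swapping the two entries is a legal
  selection, since \<open>i\<close> and \<open>j\<close> lie in both sets, and gives the same point,
  which thus has \<open>i\<close> at \<open>T'\<close>.\<close>

lemma choices_consistent:
  assumes F: "F face_of N" and T: "T \<in> B" "T' \<in> B" and i: "i \<in> choices F T" "i \<in> T'"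
    and j: "j \<in> choices F T'" "j \<in> T"
  shows "i \<in> choices F T'"
proof (cases "T = T'")
  case False
  obtain c where c: "c \<in> Sel" "pt c \<in> F" "i = c T" using i by (auto simp: choices_def)
  obtain c' where c': "c' \<in> Sel" "pt c' \<in> F" "j = c' T'" using j by (auto simp: choices_def)
  define d where "d = c(T' := j)"
  have dF: "pt d \<in> F" unfolding d_def c'(3) by (rule face_exchange[OF F c(1,2) c'(1,2) T(2)])
  have d: "d \<in> Sel" "d T = i" "d T' = j"
    using c c'(1,3) T False by (auto simp: d_def Pi_iff)
  define e where "e = d(T := j, T' := i)"
  have "pt e = pt d" unfolding e_def using T False d(2,3) by (simp add: pt_upd)
  moreover have "e \<in> Sel" unfolding e_def using d(1) i(2) j(2) by (intro Sel_upd)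
  moreover have "i = e T'" by (simp add: e_def)
  ultimately show ?thesis using dF unfolding choices_def by auto
qed (use i in simp)

lemma coord_sum_pt: "finite S \<Longrightarrow> coord_sum S (pt c) = card {T \<in> B. c T \<in> S}"
proof -
  assume S: "finite S"
  have "coord_sum S (pt c) = (\<Sum>T\<in>B. coord_sum S (unit_vec (c T)))"
    unfolding selection_point_def by (rule linear_sum[OF linear_coord_sum])
  also have "\<dots> = (\<Sum>T\<in>B. if c T \<in> S then 1 else 0)"
    using S by (simp add: coord_sum_def lookup_single when_def)
  also have "\<dots> = card {T \<in> B. c T \<in> S}" using finite_B by (simp flip: sum.inter_filter)
  finally show ?thesis .
qed

section \<open>Faces of minimal coordinate sum and their product structure\<close>

definition tight_face :: "nat set \<Rightarrow> rinf set" where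
  "tight_face S = {x \<in> N. coord_sum S x = card {T \<in> B. T \<subseteq> S}}"

text \<open>Whatever is selected, each member contained in \<open>S\<close> contributes 1 to the
  coordinate sum over \<open>S\<close>.\<close>

lemma coord_sum_ge: assumes S: "S \<subseteq> V" and x: "x \<in> N" shows "card {T \<in> B. T \<subseteq> S} \<le> coord_sum S x"
proof -
  have fS: "finite S" using S finite_V finite_subset by blast
  let ?H = "{x. real (card {T \<in> B. T \<subseteq> S}) \<le> coord_sum S x}"
  have "N \<subseteq> ?H"
    unfolding N_eq
  proof (rule hull_minimal)
    show "pt ` Sel \<subseteq> ?H"
    proof clarify
      fix c assume c: "c \<in> Sel"
      have "card {T \<in> B. T \<subseteq> S} \<le> card {T \<in> B. c T \<in> S}"
      proof (rule card_mono)
        show "{T \<in> B. T \<subseteq> S} \<subseteq> {T \<in> B. c T \<in> S}" using c unfolding Pi_iff by blast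
      qed (simp add: finite_B)
      then show "card {T \<in> B. T \<subseteq> S} \<le> coord_sum S (pt c)" using fS by (simp add: coord_sum_pt)
    qed
    have "convex (coord_sum S -` {real (card {T \<in> B. T \<subseteq> S})..})"
      by (intro convex_linear_vimage linear_coord_sum convex_real_interval)
    then show "convex ?H" by (simp add: vimage_def)
  qed
  then show ?thesis using x by blast
qed

lemma tight_face_face: "S \<subseteq> V \<Longrightarrow> tight_face S face_of N"
  unfolding tight_face_def
  by (intro linear_minimum_face convex_nestohedron linear_coord_sum coord_sum_ge)

text \<open>The minimum is attained exactly when no member other than those contained in
  \<open>S\<close> selects inside \<open>S\<close>.\<close>

lemma pt_in_tight_face:
  assumes S: "S \<subseteq> V" and c: "c \<in> Sel"
  shows "pt c \<in> tight_face S \<longleftrightarrow> (\<forall>T\<in>B. c T \<in> S \<longrightarrow> T \<subseteq> S)"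
proof -
  have fS: "finite S" using S finite_V finite_subset by blast
  have sub: "{T \<in> B. T \<subseteq> S} \<subseteq> {T \<in> B. c T \<in> S}" using c by (auto simp: Pi_iff)
  have "pt c \<in> tight_face S \<longleftrightarrow> card {T \<in> B. T \<subseteq> S} = card {T \<in> B. c T \<in> S}"
    using pt_in_N[OF c] by (auto simp: tight_face_def coord_sum_pt[OF fS])
  also have "\<dots> \<longleftrightarrow> {T \<in> B. T \<subseteq> S} = {T \<in> B. c T \<in> S}"
    using card_subset_eq[OF _ sub] finite_B by auto
  also have "\<dots> \<longleftrightarrow> (\<forall>T\<in>B. c T \<in> S \<longrightarrow> T \<subseteq> S)" using sub by auto
  finally show ?thesis .
qed

lemma tight_face_eq_sum:
  assumes S: "S \<subseteq> V"
  shows "tight_face S = (\<Sum>T\<in>B. std_simplex (if T \<subseteq> S then T else T - S))"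
proof -
  have "{c \<in> Sel. pt c \<in> tight_face S} = Pi B (\<lambda>T. if T \<subseteq> S then T else T - S)"
    using pt_in_tight_face[OF S] by (fastforce simp: Pi_iff split: if_splits)
  then show ?thesis
    using face_eq_hull[OF tight_face_face[OF S]] by (simp add: sum_std_simplex finite_B)
qed

lemma keys_N: "x \<in> N \<Longrightarrow> Poly_Mapping.keys x \<subseteq> V"
proof -
  let ?H = "{x :: rinf. Poly_Mapping.keys x \<subseteq> V}"
  have "N \<subseteq> ?H"
    unfolding N_eq
  proof (rule hull_minimal)
    show "pt ` Sel \<subseteq> ?H"
    proof clarify
      fix c i assume c: "c \<in> Sel" and "i \<in> Poly_Mapping.keys (pt c)"
      then have "i \<in> (\<Union>T\<in>B. Poly_Mapping.keys (unit_vec (c T)))"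
        using keys_sum[of "\<lambda>T. unit_vec (c T)" B] unfolding selection_point_def by blast
      then show "i \<in> V" using c sub by (auto simp: Pi_iff)
    qed
    show "convex ?H"
      unfolding convex_alt
      by (auto simp: in_keys_iff subset_iff lookup_add lookup_scaleR_poly_mapping simp del: add_eq_0_iff)
        (metis add.right_neutral mult_zero_right)
  qed
  then show "x \<in> N \<Longrightarrow> Poly_Mapping.keys x \<subseteq> V" by blast
qed

lemma building_set_restrict: "S \<in> B \<Longrightarrow> building_set S (restrict_set B S)"
  using finite_member single sub nonempty union
  by unfold_locales (auto simp: restrict_set_def)

lemma building_set_contract:
  assumes "S \<in> B" "S \<noteq> V" shows "building_set (V - S) (contract_set B S)"
proof
  show "finite (V - S)" using finite_V by simp
  show "V - S \<in> contract_set B S" using top assms sub by (auto simp: contract_set_def)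
  show "T \<subseteq> V - S" "T \<noteq> {}" if "T \<in> contract_set B S" for T
    using that sub by (auto simp: contract_set_def)
  show "{i} \<in> contract_set B S" if "i \<in> V - S" for i
    using single[of i] that unfolding contract_set_def by (intro image_eqI[of _ _ "{i}"]) auto
  fix X Y assume "X \<in> contract_set B S" "Y \<in> contract_set B S" and n: "X \<inter> Y \<noteq> {}"
  then obtain T T' where T: "X = T - S" "Y = T' - S" "T \<in> B" "T' \<in> B" "\<not> T \<subseteq> S"
    by (auto simp: contract_set_def)
  then have "T \<union> T' \<in> B" using n union by blast
  moreover have "X \<union> Y = T \<union> T' - S" "\<not> T \<union> T' \<subseteq> S" using T by auto
  ultimately show "X \<union> Y \<in> contract_set B S" unfolding contract_set_def by blast
qed

lemma tight_face_comb_equiv: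
  assumes S: "S \<in> B" "S \<noteq> V"
  shows "comb_equiv (tight_face S) (nestohedron (restrict_set B S) \<times> nestohedron (contract_set B S))"
proof -
  let ?C = "{T \<in> B. \<not> T \<subseteq> S}"
  interpret R: building_set S "restrict_set B S" by (rule building_set_restrict[OF S(1)])
  interpret C: building_set "V - S" "contract_set B S" by (rule building_set_contract[OF S])
  have "B = restrict_set B S \<union> ?C" "restrict_set B S \<inter> ?C = {}" by (auto simp: restrict_set_def)
  then have "tight_face S = (\<Sum>T\<in>restrict_set B S. std_simplex (if T \<subseteq> S then T else T - S)) +
      (\<Sum>T\<in>?C. std_simplex (if T \<subseteq> S then T else T - S))"
    using tight_face_eq_sum[OF sub[OF S(1)]] finite_B R.finite_B by (metis (no_types, lifting) finite_Un sum.union_disjoint)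
  also have "(\<Sum>T\<in>restrict_set B S. std_simplex (if T \<subseteq> S then T else T - S)) = R.N"
    unfolding nestohedron_eq by (intro sum.cong) (auto simp: restrict_set_def)
  also have "(\<Sum>T\<in>?C. std_simplex (if T \<subseteq> S then T else T - S)) = (\<Sum>T\<in>?C. std_simplex (T - S))"
    by (intro sum.cong) auto
  finally have eq: "tight_face S = R.N + (\<Sum>T\<in>?C. std_simplex (T - S))" .
  have "comb_equiv (R.N + (\<Sum>T\<in>?C. std_simplex (T - S))) (R.N + C.N)"
    unfolding nestohedron_eq[of "contract_set B S"] unfolding contract_set_def
    by (rule comb_equiv_sum_reindex[OF _ convex_nestohedron convex_std_simplex]) (simp add: finite_B)
  moreover have "comb_equiv (R.N \<times> C.N) (R.N + C.N)"
    using R.keys_N C.keys_N by (intro convex_plus_Times_comb_equiv[of _ _ S "V - S"] convex_nestohedron) auto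
  ultimately show ?thesis unfolding eq using comb_equiv_trans comb_equiv_sym by blast
qed

text \<open>The vectors \<open>unit_vec i - unit_vec i0\<close> with \<open>i \<noteq> i0\<close>
  form a basis of the directions: they span all differences of selection points, and changing only
  the selection at \<open>V\<close> from \<open>i0\<close> to \<open>i\<close> realises each of
  them.\<close>

lemma adim_N: "adim N = card V - 1"
proof -
  obtain i0 where i0: "i0 \<in> V" using V_nonempty by blast
  define D where "D = (\<lambda>i. unit_vec i - unit_vec i0) ` (V - {i0})"
  let ?E = "{x - y |x y. x \<in> N \<and> y \<in> N}"
  have lk: "Poly_Mapping.lookup (unit_vec i - unit_vec i0) j = (if i = j then 1 else 0)"
    if "j \<noteq> i0" for i j using that by (simp add: lookup_minus lookup_single when_def)
  have inj: "inj_on (\<lambda>i. unit_vec i - unit_vec i0) (V - {i0})"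
    proof (rule inj_onI)
    fix i j assume h: "i \<in> V - {i0}" "j \<in> V - {i0}" "unit_vec i - unit_vec i0 = unit_vec j - unit_vec i0"
    then have "Poly_Mapping.lookup (unit_vec i) i = Poly_Mapping.lookup (unit_vec j) i" by simp
    then show "i = j" by (simp add: lookup_single when_def split: if_splits)
  qed
  have ind: "independent D"
  proof (rule independent_if_scalars_zero)
    show "finite D" using finite_V by (simp add: D_def)
    fix f x assume z: "(\<Sum>x\<in>D. f x *\<^sub>R x) = 0" and "x \<in> D"
    then obtain j where j: "j \<in> V" "j \<noteq> i0" "x = unit_vec j - unit_vec i0" by (auto simp: D_def)
    have "0 = Poly_Mapping.lookup (\<Sum>x\<in>D. f x *\<^sub>R x) j" using z by simp
    also have "\<dots> = (\<Sum>i\<in>V - {i0}. f (unit_vec i - unit_vec i0) * (if i = j then 1 else 0))"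
      unfolding D_def sum.reindex[OF inj] using lk[OF j(2)]
      by (simp add: lookup_sum lookup_scaleR_poly_mapping)
    also have "\<dots> = f x" using finite_V j by (simp add: if_distrib cong: if_cong)
    finally show "f x = 0" by simp
  qed
  have un: "unit_vec i - unit_vec i0 \<in> span D" if "i \<in> V" for i
    using that by (cases "i = i0") (auto simp: D_def span_zero intro: span_base)
  have un2: "unit_vec i - unit_vec j \<in> span D" if "i \<in> V" "j \<in> V" for i j
    using span_diff[OF un[OF that(1)] un[OF that(2)]] by simp
  obtain c0 where c0: "c0 \<in> Sel" using selection_exists by blast
  have "N \<subseteq> {x. x - pt c0 \<in> span D}"
    unfolding N_eq
  proof (rule hull_minimal)
    show "pt ` Sel \<subseteq> {x. x - pt c0 \<in> span D}"
    proof clarify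
      fix c assume c: "c \<in> Sel"
      have "pt c - pt c0 = (\<Sum>T\<in>B. unit_vec (c T) - unit_vec (c0 T))"
        by (simp add: selection_point_def sum_subtractf)
      also have "\<dots> \<in> span D"
      proof (rule span_sum)
        fix T assume "T \<in> B"
        then have "c T \<in> V" "c0 T \<in> V" using c c0 sub by (auto simp: Pi_iff)
        then show "unit_vec (c T) - unit_vec (c0 T) \<in> span D" by (rule un2)
      qed
      finally show "pt c - pt c0 \<in> span D" .
    qed
    have "{x. x - pt c0 \<in> span D} = (\<lambda>x. x + pt c0) ` span D"
      by (auto intro!: image_eqI[of _ _ "_ - pt c0"])
    then show "convex {x. x - pt c0 \<in> span D}"
      by (simp add: convex_translation subspace_imp_convex add.commute[of _ "pt c0"])
  qed
  then have "?E \<subseteq> span D"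
  proof clarify
    fix x y assume "x \<in> N" "y \<in> N" "N \<subseteq> {x. x - pt c0 \<in> span D}"
    then have "x - pt c0 \<in> span D" "y - pt c0 \<in> span D" by auto
    then have "(x - pt c0) - (y - pt c0) \<in> span D" by (rule span_diff)
    then show "x - y \<in> span D" by simp
  qed
  moreover have "D \<subseteq> ?E"
  proof
    fix x assume "x \<in> D"
    then obtain i where i: "i \<in> V" "x = unit_vec i - unit_vec i0" by (auto simp: D_def)
    have "x = pt (c0(V := i)) - pt (c0(V := i0))" using i top by (simp add: pt_upd)
    moreover have "pt (c0(V := i)) \<in> N" "pt (c0(V := i0)) \<in> N"
      using i i0 c0 by (auto intro!: pt_in_N Sel_upd)
    ultimately show "x \<in> ?E" by blast
  qed
  ultimately have "span D = span ?E"
    unfolding span_eq using subset_trans[OF _ span_superset] by (intro conjI)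
  then have "dim ?E = card D" by (rule dim_eq_card[OF _ ind])
  then show ?thesis
    unfolding adim_def using card_image[OF inj] finite_V i0 by (simp add: D_def)
qed

text \<open>For \<open>i \<notin> S\<close> some point of \<open>tight_face S\<close> selects
  \<open>i\<close> at \<open>V\<close>. If \<open>i \<in> T\<close>, this point is not in
  \<open>tight_face T\<close>, because \<open>V\<close> is not contained in
  \<open>T\<close>.\<close>

lemma tight_face_eq_imp_subset: "S \<in> B \<Longrightarrow> S \<noteq> V \<Longrightarrow> T \<in> B \<Longrightarrow> T \<noteq> V \<Longrightarrow> tight_face S = tight_face T \<Longrightarrow> T \<subseteq> S"
proof
  fix i assume h: "S \<in> B" "S \<noteq> V" "T \<in> B" "T \<noteq> V" "tight_face S = tight_face T" "i \<in> T"
  show "i \<in> S"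
  proof (rule ccontr)
    assume i: "i \<notin> S"
    have ne: "\<forall>U\<in>B. \<exists>j. j \<in> U \<and> (j \<in> S \<longrightarrow> U \<subseteq> S)" using nonempty by blast
    then obtain c where c: "\<And>U. U \<in> B \<Longrightarrow> c U \<in> U \<and> (c U \<in> S \<longrightarrow> U \<subseteq> S)" by metis
    have "i \<in> V" using sub h by blast
    then have d: "c(V := i) \<in> Sel" using c by (auto simp: Pi_iff)
    have "pt (c(V := i)) \<in> tight_face S"
      unfolding pt_in_tight_face[OF sub[OF h(1)] d] using c i by auto
    then have "V \<subseteq> T"
      using h(6) top unfolding h(5) pt_in_tight_face[OF sub[OF h(3)] d] by auto
    then show False using sub[OF h(3)] h(4) by blast
  qed
qed

lemma inj_on_tight_face: "inj_on tight_face (B - {V})"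
  using tight_face_eq_imp_subset by (intro inj_onI) blast

lemma simple_N: "simple_polytope N" and is_facet_N: "is_facet F N \<longleftrightarrow> F \<in> tight_face ` (B - {V})"
proof -
  \<comment> \<open>The factors have dimensions \<open>card S - 1\<close> and
    \<open>card (V - S) - 1\<close>, together one less than \<open>card V - 1\<close>.\<close>
  have facet: "is_facet (tight_face S) N" if S: "S \<in> B" "S \<noteq> V" for S
  proof -
    interpret R: building_set S "restrict_set B S" by (rule building_set_restrict[OF S(1)])
    interpret C: building_set "V - S" "contract_set B S" by (rule building_set_contract[OF S])
    have face: "tight_face S face_of N" by (rule tight_face_face[OF sub[OF S(1)]])
    have p: "polytope (R.N \<times> C.N)" "R.N \<times> C.N \<noteq> {}"
      using R.polytope_N C.polytope_N R.N_nonempty C.N_nonempty polytope_Times by auto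
    have eq: "comb_equiv (R.N \<times> C.N) (tight_face S)" by (rule comb_equiv_sym[OF tight_face_comb_equiv[OF S]])
    obtain f where "face_lattice_iso (R.N \<times> C.N) (tight_face S) f"
      using comb_equiv_obtain[OF eq p face_of_polytope[OF polytope_N face]] by blast
    then have ne: "tight_face S \<noteq> {}" by (rule face_lattice_iso.Q_nonempty)
    have "adim (tight_face S) = adim (R.N \<times> C.N)"
      using adim_comb_equiv[OF eq p face_of_polytope[OF polytope_N face]] by simp
    also have "\<dots> = adim R.N + adim C.N"
      using R.N_nonempty C.N_nonempty by (intro adim_Times[OF R.polytope_N C.polytope_N]) auto
    also have "\<dots> = (card S - 1) + (card (V - S) - 1)" unfolding R.adim_N C.adim_N ..
    also have "\<dots> + 1 = card V - 1"
    proof -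
      have "card S > 0" using nonempty[OF S(1)] finite_member[OF S(1)] by (simp add: card_gt_0_iff)
      moreover have "card (V - S) > 0" using C.V_nonempty finite_V by (simp add: card_gt_0_iff)
      moreover have "card (V - S) = card V - card S" "card S \<le> card V"
        using sub[OF S(1)] finite_V by (auto intro: card_Diff_subset finite_subset card_mono)
      ultimately show ?thesis by simp
    qed
    finally show ?thesis using face ne by (simp add: is_facet_def adim_N)
  qed
  have contained: "\<exists>S\<in>B - {V}. F \<subseteq> tight_face S" if F: "F face_of N" "F \<noteq> N" "F \<noteq> {}" for F
  proof -
    \<comment> \<open>If everything could be selected at \<open>V\<close>, consistency with
      \<open>V\<close> would make every element of every member a choice, and \<open>F\<close> would
      contain all generators of \<open>N\<close>.\<close>
    have "choices F V \<noteq> V"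
    proof
      assume full: "choices F V = V"
      obtain c0 where c0: "c0 \<in> Sel" "pt c0 \<in> F" using face_point_exists[OF F(1) F(3)] by blast
      have all: "i \<in> choices F T" if T: "T \<in> B" "i \<in> T" for T i
      proof (rule choices_consistent[OF F(1) top T(1)])
        show "i \<in> choices F V" using full sub T by blast
        show "c0 T \<in> choices F T" using c0 by (auto simp: choices_def)
        show "c0 T \<in> V" using c0 T sub by (auto simp: Pi_iff)
      qed (use T in auto)
      have "pt ` Sel \<subseteq> F" using all pt_in_face[OF F(1)] by (auto simp: Pi_iff)
      then have "N \<subseteq> F" unfolding N_eq by (rule hull_minimal[where S = convex]) (rule face_of_imp_convex[OF F(1)])
      then show False using F face_of_imp_subset by blast
    qed
    then obtain i where i: "i \<in> V" "i \<notin> choices F V" using choices_sub[OF top] by blast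
    define A where "A = {S \<in> B. S \<subseteq> V - choices F V}"
    have A: "finite A" "{i} \<in> A" using finite_B single i by (auto simp: A_def)
    then have "A \<noteq> {}" by blast
    then obtain S where SA: "S \<in> A" and max: "\<forall>T\<in>A. S \<subseteq> T \<longrightarrow> S = T"
      using finite_has_maximal[OF A(1)] by blast
    then have S: "S \<in> B" "S \<subseteq> V - choices F V" by (auto simp: A_def)
    have SV: "S \<noteq> V"
    proof
      assume "S = V"
      then have "choices F V = {}" using S choices_sub[OF top] by blast
      then show False using face_point_exists[OF F(1) F(3)] by (auto simp: choices_def)
    qed
    \<comment> \<open>Suppose \<open>T\<close> sticks out of \<open>S\<close> and has a choice
      \<open>k\<close> in \<open>S\<close>. By maximality of \<open>S\<close>, the member
      \<open>T \<union> S\<close> meets the choices at \<open>V\<close>, necessarily in some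
      \<open>j\<close> of \<open>T\<close>; consistency of \<open>T\<close> and \<open>V\<close>
      then makes \<open>k\<close> a choice at \<open>V\<close>, against
      \<open>k \<in> S\<close>.\<close>
    have avoid: "choices F T \<inter> S = {}" if T: "T \<in> B" "\<not> T \<subseteq> S" for T
    proof (rule ccontr)
      assume "choices F T \<inter> S \<noteq> {}"
      then obtain k where k: "k \<in> choices F T" "k \<in> S" by blast
      have kT: "k \<in> T" using k choices_sub T by blast
      then have TS: "T \<union> S \<in> B" using union T S k by blast
      have "\<not> T \<union> S \<subseteq> V - choices F V"
        using max TS T(2) by (auto simp: A_def)
      then obtain j where j: "j \<in> T" "j \<in> choices F V" using S T sub by blast
      have "k \<in> choices F V"
        by (rule choices_consistent[OF F(1) T(1) top k(1) _ j(2,1)]) (use sub T kT in blast)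
      then show False using k S by blast
    qed
    have "pt c \<in> tight_face S" if c: "c \<in> Sel" "pt c \<in> F" for c
    proof -
      have SV': "S \<subseteq> V" using S sub by blast
      have "c T \<in> choices F T" for T using c unfolding choices_def by blast
      then show ?thesis unfolding pt_in_tight_face[OF SV' c(1)] using avoid by blast
    qed
    then have "pt ` {c \<in> Sel. pt c \<in> F} \<subseteq> tight_face S" by blast
    then have "convex hull (pt ` {c \<in> Sel. pt c \<in> F}) \<subseteq> tight_face S"
      by (rule hull_minimal[where S = convex]) (use S sub tight_face_face face_of_imp_convex in blast)
    then have "F \<subseteq> tight_face S" using face_eq_hull[OF F(1)] by simp
    then show ?thesis using S SV by blast
  qed
  show iff: "is_facet F N \<longleftrightarrow> F \<in> tight_face ` (B - {V})" for F
  proof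
    assume F: "is_facet F N"
    note m = is_facet_iff_maximal[OF polytope_N N_nonempty]
    have "F face_of N" "F \<noteq> N" "F \<noteq> {}" using F unfolding m by simp_all
    then obtain S where S: "S \<in> B - {V}" "F \<subseteq> tight_face S" using contained by blast
    have "is_facet (tight_face S) N" using facet S by blast
    then have "tight_face S face_of N" "tight_face S \<noteq> N" unfolding m by simp_all
    then have "tight_face S = F" using F S(2) unfolding m by blast
    then show "F \<in> tight_face ` (B - {V})" using S by blast
  qed (use facet in blast)
  show "simple_polytope N"
    unfolding simple_polytope_def
  proof (intro conjI polytope_N N_nonempty allI impI)
    fix v assume ev: "v extreme_point_of N"
    then have vf: "{v} face_of N" by (simp add: face_of_singleton)
    obtain r where r: "r \<in> Sel" "v = pt r" using extreme_point_of_convex_hull ev unfolding N_eq by blast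
    have unique: "c T = r T" if c: "c \<in> Sel" "pt c = pt r" "T \<in> B" for c T
    proof (rule ccontr)
      assume n: "c T \<noteq> r T"
      have "pt (r(T := c T)) \<in> {v}" using face_exchange[OF vf, of r c T] c r by simp
      then have "unit_vec (c T) = unit_vec (r T)" using r(2) c(3) by (simp add: pt_upd)
      then have "Poly_Mapping.lookup (unit_vec (c T)) (c T) = Poly_Mapping.lookup (unit_vec (r T)) (c T)" by simp
      then show False using n by (simp add: lookup_single when_def)
    qed
    have consistent: "r T = r T'" if T: "T \<in> B" "T' \<in> B" "r T \<in> T'" "r T' \<in> T" for T T'
    proof -
      have "choices {v} U = {r U}" if "U \<in> B" for U
      proof
        show "choices {v} U \<subseteq> {r U}"
        proof
          fix i assume "i \<in> choices {v} U"
          then obtain c where "c \<in> Sel" "pt c = pt r" "i = c U" unfolding choices_def r(2) by blast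
          then show "i \<in> {r U}" using unique[of c U] that by simp
        qed
        show "{r U} \<subseteq> choices {v} U" using r unfolding choices_def by blast
      qed
      then show ?thesis using choices_consistent[OF vf T(1,2), of "r T" "r T'"] T by auto
    qed
    \<comment> \<open>These are the \<open>S\<close> whose \<open>tight_face\<close> contains the
      vertex. The selected element maps them bijectively to \<open>V\<close>; since \<open>V\<close>
      itself is one of them and gives no facet, \<open>card V - 1\<close> facets remain.\<close>
    define tight where "tight = {S \<in> B. \<forall>T\<in>B. r T \<in> S \<longrightarrow> T \<subseteq> S}"
    have "bij_betw r tight V"
      unfolding bij_betw_def
    proof
      show "inj_on r tight"
      proof (rule inj_onI)
        fix S T assume h: "S \<in> tight" "T \<in> tight" "r S = r T"
        have "r S \<in> S" "r T \<in> T" using r h by (auto simp: tight_def Pi_iff)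
        then show "S = T" using h unfolding tight_def by auto
      qed
      show "r ` tight = V"
      proof (intro equalityI subsetI)
        fix i assume "i \<in> r ` tight" then show "i \<in> V" using r sub by (auto simp: tight_def Pi_iff)
      next
        fix i assume i: "i \<in> V"
        \<comment> \<open>The tight set that selects \<open>i\<close> is the union of all members
          selecting \<open>i\<close>; it is a member because they share \<open>i\<close>.\<close>
        let ?I = "{T \<in> B. r T = i}" and ?S = "\<Union>{T \<in> B. r T = i}"
        have iT: "i \<in> T" if "T \<in> ?I" for T using that r by (auto simp: Pi_iff)
        have "{i} \<in> ?I" using single[OF i] r by (auto simp: Pi_iff)
        then have "i \<in> ?S" by blast
        have Union: "finite A \<Longrightarrow> A \<noteq> {} \<Longrightarrow> A \<subseteq> ?I \<Longrightarrow> \<Union>A \<in> B" for A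
        proof (induction A rule: finite_ne_induct)
          case (insert T A)
          then obtain U where U: "U \<in> A" by blast
          have "T \<inter> \<Union>A \<noteq> {}" using insert.prems U iT[of T] iT[of U] by blast
          then show ?case using insert union by auto
        qed auto
        have SB: "?S \<in> B" using Union[of ?I] \<open>{i} \<in> ?I\<close> finite_B by auto
        have rS: "r ?S = i"
        proof -
          obtain T where T: "T \<in> ?I" "r ?S \<in> T" using r SB by (auto simp: Pi_iff)
          then show ?thesis using consistent[of T ?S] \<open>i \<in> ?S\<close> SB by auto
        qed
        \<comment> \<open>If \<open>T\<close> selects inside \<open>?S\<close>, consistency forces
          \<open>T \<union> ?S\<close> to select inside \<open>?S\<close>, hence to select
          \<open>i\<close>; so this union is itself one of the sets united in
          \<open>?S\<close>.\<close>
        have "T \<subseteq> ?S" if T: "T \<in> B" "r T \<in> ?S" for T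
        proof -
          have "r T \<in> T" using r T by (auto simp: Pi_iff)
          then have TS: "T \<union> ?S \<in> B" using union T SB by blast
          let ?k = "r (T \<union> ?S)"
          have "?k \<in> T \<union> ?S" using r TS by (auto simp: Pi_iff)
          moreover have "?k = r T" if "?k \<in> T"
            using consistent[OF T(1) TS] \<open>r T \<in> T\<close> that by auto
          ultimately have kS: "?k \<in> ?S" using T(2) by auto
          have "?k = r ?S" by (rule consistent[OF TS SB kS]) (use rS \<open>i \<in> ?S\<close> in auto)
          then have "T \<union> ?S \<in> ?I" using TS rS by auto
          then show ?thesis by blast
        qed
        then have "?S \<in> tight" using SB by (auto simp: tight_def)
        then have "r ?S \<in> r ` tight" by (rule imageI)
        then show "i \<in> r ` tight" unfolding rS .
      qed
    qed
    then have "card tight = card V" by (rule bij_betw_same_card)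
    moreover have "V \<in> tight" using top sub by (auto simp: tight_def)
    ultimately have "card (tight - {V}) = card V - 1" by simp
    moreover have "{F. is_facet F N \<and> v \<in> F} = tight_face ` (tight - {V})"
    proof -
      have "v \<in> tight_face S \<longleftrightarrow> S \<in> tight" if "S \<in> B" for S
        using pt_in_tight_face[OF sub[OF that] r(1)] r(2) that by (auto simp: tight_def)
      then show ?thesis unfolding iff by (auto simp: tight_def)
    qed
    moreover have "inj_on tight_face (tight - {V})"
      by (rule inj_on_subset[OF inj_on_tight_face]) (auto simp: tight_def)
    ultimately show "card {F. is_facet F N \<and> v \<in> F} = adim N" by (simp add: card_image adim_N)
  qed
qed

section \<open>Boundary, indecomposability and relabelling of nestohedra\<close>

lemma type_dim_N: "type_dim (comb_type N) = card V - 1"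
  using type_dim_comb_type[OF simple_N] adim_N by simp

lemma
  assumes S: "S \<in> B" "S \<noteq> V"
  shows simple_tight_face: "simple_polytope (tight_face S)"
    and comb_type_tight_face: "comb_type (tight_face S) =
      comb_type (nestohedron (restrict_set B S)) + comb_type (nestohedron (contract_set B S))"
proof -
  interpret R: building_set S "restrict_set B S" by (rule building_set_restrict[OF S(1)])
  interpret C: building_set "V - S" "contract_set B S" by (rule building_set_contract[OF S])
  note s = R.simple_N C.simple_N
  have eq: "comb_equiv (cart_prod R.N C.N) (tight_face S)"
    by (rule comb_equiv_trans[OF comb_equiv_sym[OF comb_equiv_cart_prod] comb_equiv_sym[OF tight_face_comb_equiv[OF S]]])
  show t: "simple_polytope (tight_face S)"
    by (rule simple_polytope_comb_equiv[OF eq simple_polytope_cart_prod[OF s]])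
      (rule face_of_polytope[OF polytope_N tight_face_face[OF sub[OF S(1)]]])
  show "comb_type (tight_face S) = comb_type R.N + comb_type C.N"
    using comb_type_eq_iff[OF simple_polytope_cart_prod[OF s] t] eq comb_type_cart_prod[OF s] by simp
qed

lemma facets_N: "{F. is_facet F N} = tight_face ` (B - {V})"
  using is_facet_N by blast

lemma facets_N_simple: "is_facet F N \<Longrightarrow> simple_polytope F"
  unfolding is_facet_N using simple_tight_face by blast

lemma facets_simple_N: "facets_simple (comb_type N)"
  by (rule facets_simple_comb_type[OF simple_N facets_N_simple])

lemma facet_sum_N: "facet_sum (comb_type N) = (\<Sum>S\<in>B - {V}.
    gen (comb_type (nestohedron (restrict_set B S)) + comb_type (nestohedron (contract_set B S))))"
proof -
  have "facet_sum (comb_type N) = (\<Sum>F\<in>{F. is_facet F N}. gen (comb_type F))"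
    by (rule facet_sum_comb_type[OF simple_N facets_N_simple])
  also have "\<dots> = (\<Sum>S\<in>B - {V}. gen (comb_type (tight_face S)))"
    unfolding facets_N by (simp add: sum.reindex[OF inj_on_tight_face])
  finally show ?thesis by (simp add: comb_type_tight_face)
qed

lemma card_facets_N: "card {F. is_facet F (rep_simple_type (comb_type N))} = card B - 1"
  using card_facets_rep[OF simple_N facets_N_simple] top finite_B
  by (simp add: facets_N card_image[OF inj_on_tight_face])

text \<open>A selection in both faces would choose at \<open>S \<union> T\<close> an element of
  \<open>S\<close> or of \<open>T\<close>, and tightness would squeeze the union into that
  set.\<close>

lemma tight_faces_disjoint:
  assumes S: "S \<in> B" "T \<in> B" "S \<inter> T = {}" "S \<union> T \<in> B"
  shows "tight_face S \<inter> tight_face T = {}"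
proof (rule ccontr)
  assume n: "tight_face S \<inter> tight_face T \<noteq> {}"
  have V: "S \<subseteq> V" "T \<subseteq> V" using S sub by auto
  have "(tight_face S \<inter> tight_face T) face_of N" by (intro face_of_Int tight_face_face V)
  then obtain c where c: "c \<in> Sel" "pt c \<in> tight_face S" "pt c \<in> tight_face T"
    using face_point_exists[OF _ n] by blast
  have "c (S \<union> T) \<in> S \<union> T" using c(1) S(4) by (auto simp: Pi_iff)
  then have "S \<union> T \<subseteq> S \<or> S \<union> T \<subseteq> T"
    using c(2,3) S(4) unfolding pt_in_tight_face[OF V(1) c(1)] pt_in_tight_face[OF V(2) c(1)] by blast
  then show False using S(3) nonempty[OF S(1)] nonempty[OF S(2)] by blast
qed

text \<open>The base facet belongs to \<open>{a}\<close>. It is disjoint from the facet of any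
  \<open>S\<close> avoiding \<open>a\<close>. If \<open>a \<in> S\<close>, the facet of an outside
  vertex \<open>i\<close> is disjoint from both. All unions involved contain \<open>a\<close>, so
  \<open>star\<close> makes them members. In \<open>mas_bs\<close> the set \<open>{a, c}\<close> is
  missing, but membership of \<open>P_Mas\<close> in an extension is part of the assumption
  there.\<close>

lemma indecomposable_N:
  assumes a: "a \<in> V" "V \<noteq> {a}" and star: "\<And>S. S \<subseteq> V \<Longrightarrow> a \<in> S \<Longrightarrow> S \<in> B"
  shows "indecomposable (comb_type N)"
proof (rule indecomposableI[OF simple_N])
  have aB: "{a} \<in> B" using a by (intro star) auto
  show "is_facet (tight_face {a}) N" unfolding is_facet_N using aB a by blast
  fix F assume "is_facet F N"
  then obtain S where S: "S \<in> B" "S \<noteq> V" "F = tight_face S" unfolding is_facet_N by blast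
  have SV: "S \<subseteq> V" by (rule sub[OF S(1)])
  show "F = tight_face {a} \<or> F \<inter> tight_face {a} = {} \<or>
    (\<exists>G. is_facet G N \<and> F \<inter> G = {} \<and> G \<inter> tight_face {a} = {})"
  proof (cases "a \<in> S")
    case False
    then have "tight_face S \<inter> tight_face {a} = {}"
      using SV a by (intro tight_faces_disjoint S aB star) auto
    then show ?thesis using S(3) by blast
  next
    case True
    obtain i where i: "i \<in> V" "i \<notin> S" using SV S(2) by blast
    have "tight_face S \<inter> tight_face {i} = {}"
      using SV i True by (intro tight_faces_disjoint S single star) auto
    moreover have "tight_face {i} \<inter> tight_face {a} = {}"
      using a i True by (intro tight_faces_disjoint single star) auto
    moreover have "is_facet (tight_face {i}) N" unfolding is_facet_N using i True a single by blast
    ultimately show ?thesis using S(3) by blast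
  qed
qed

lemma building_set_image:
  assumes \<sigma>: "inj_on \<sigma> V"
  shows "building_set (\<sigma> ` V) ((`) \<sigma> ` B)"
proof
  show "finite (\<sigma> ` V)" using finite_V by simp
  show "\<sigma> ` V \<in> (`) \<sigma> ` B" using top by blast
  show "T \<subseteq> \<sigma> ` V" "T \<noteq> {}" if "T \<in> (`) \<sigma> ` B" for T using that sub nonempty by auto
  show "{i} \<in> (`) \<sigma> ` B" if "i \<in> \<sigma> ` V" for i using that single by force
  fix S T assume "S \<in> (`) \<sigma> ` B" "T \<in> (`) \<sigma> ` B" "S \<inter> T \<noteq> {}"
  then obtain S' T' where h: "S = \<sigma> ` S'" "T = \<sigma> ` T'" "S' \<in> B" "T' \<in> B" by blast
  then have "\<sigma> ` (S' \<inter> T') = S \<inter> T" using inj_on_image_Int[OF \<sigma>] sub by simp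
  then have "S' \<union> T' \<in> B" using h union \<open>S \<inter> T \<noteq> {}\<close> by auto
  then show "S \<union> T \<in> (`) \<sigma> ` B" using h by (auto simp: image_Un[symmetric])
qed

lemma comb_type_relabel:
  assumes \<sigma>: "inj_on \<sigma> V"
  shows "comb_type (nestohedron ((`) \<sigma> ` B)) = comb_type N"
proof -
  interpret I: building_set "\<sigma> ` V" "(`) \<sigma> ` B" by (rule building_set_image[OF \<sigma>])
  define f :: "rinf \<Rightarrow> rinf" where "f x = (\<Sum>i\<in>V. Poly_Mapping.lookup x i *\<^sub>R unit_vec (\<sigma> i))" for x
  have lin: "linear f"
    unfolding f_def by (rule linearI)
      (simp_all add: lookup_add lookup_scaleR_poly_mapping scaleR_add_left sum.distrib scaleR_sum_right)
  have f_unit: "f (unit_vec i) = unit_vec (\<sigma> i)" if "i \<in> V" for i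
    using that finite_V by (simp add: f_def lookup_single when_def if_distrib[of "\<lambda>r. r *\<^sub>R _"] cong: if_cong)
  have f_simplex: "f ` std_simplex T = std_simplex (\<sigma> ` T)" if "T \<in> B" for T
  proof -
    have "f ` unit_vec ` T = unit_vec ` \<sigma> ` T"
      unfolding image_image using f_unit sub[OF that] by (intro image_cong) auto
    then show ?thesis by (simp add: std_simplex_def lin convex_hull_linear_image)
  qed
  have f_plus: "f ` (X + Y) = f ` X + f ` Y" for X Y
    by (force simp: set_plus_def linear_add[OF lin])
  have f_sum: "f ` (\<Sum>T\<in>A. std_simplex T) = (\<Sum>T\<in>A. f ` std_simplex T)" for A
    by (induction A rule: infinite_finite_induct) (auto simp: f_plus linear_0[OF lin])
  have "f ` N = (\<Sum>T\<in>B. std_simplex (\<sigma> ` T))"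
    unfolding nestohedron_eq f_sum using f_simplex by (intro sum.cong) auto
  also have "\<dots> = I.N"
  proof -
    have "inj_on ((`) \<sigma>) B" using \<sigma> sub by (intro inj_on_subset[OF inj_on_image_Pow[OF \<sigma>]]) auto
    then show ?thesis unfolding nestohedron_eq by (simp add: sum.reindex)
  qed
  finally have img: "f ` N = I.N" .
  have "inj_on f N"
  proof (rule inj_onI)
    fix x y assume h: "x \<in> N" "y \<in> N" "f x = f y"
    have lk: "Poly_Mapping.lookup (f z) (\<sigma> j) = Poly_Mapping.lookup z j" if "j \<in> V" for z j
    proof -
      have "Poly_Mapping.lookup (f z) (\<sigma> j) = (\<Sum>i\<in>V. if i = j then Poly_Mapping.lookup z i else 0)"
        unfolding f_def lookup_sum using inj_on_eq_iff[OF \<sigma>] that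
        by (intro sum.cong) (auto simp: lookup_scaleR_poly_mapping lookup_single when_def)
      then show ?thesis using that finite_V by simp
    qed
    show "x = y"
    proof (rule poly_mapping_eqI)
      fix j
      show "Poly_Mapping.lookup x j = Poly_Mapping.lookup y j"
      proof (cases "j \<in> V")
        case True then show ?thesis using lk h(3) by metis
      next
        case False then show ?thesis using keys_N h by (metis in_keys_iff subsetD)
      qed
    qed
  qed
  then have "comb_equiv N I.N"
    using comb_equiv_linear_image_inj_on[OF lin _ convex_nestohedron] img by metis
  then show ?thesis using comb_type_eq_iff[OF simple_N I.simple_N] by simp
qed

end

section \<open>The four families of building sets\<close>

text \<open>
  In the notation of the paper, \<open>a\<close> and \<open>b\<close> are the vertices \<open>1\<close> and \<open>n + 1\<close> of \<open>B(\<Gamma>, n)\<close>, and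
  \<open>a\<close>, \<open>b\<close>, \<open>c\<close> are the vertices \<open>1\<close>, \<open>2\<close>, \<open>n + 1\<close> of \<open>B(P, n)\<close>.
\<close>

definition full_bs :: "nat set \<Rightarrow> nat set set" where
  "full_bs V = {S. S \<subseteq> V \<and> S \<noteq> {}}"

definition star_bs :: "nat \<Rightarrow> nat set \<Rightarrow> nat set set" where
  "star_bs a V = {S. S \<subseteq> V \<and> (a \<in> S \<or> (\<exists>i. S = {i}))}"

definition gamma_bs :: "nat \<Rightarrow> nat \<Rightarrow> nat set \<Rightarrow> nat set set" where
  "gamma_bs a b V = {S. S \<subseteq> V \<and> S \<noteq> {} \<and> (b \<in> S \<longrightarrow> a \<in> S \<or> S = {b})}"

definition mas_bs :: "nat \<Rightarrow> nat \<Rightarrow> nat \<Rightarrow> nat set \<Rightarrow> nat set set" where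
  "mas_bs a b c V = {S. S \<subseteq> V \<and> (a \<in> S \<and> (c \<in> S \<longrightarrow> b \<in> S) \<or> (\<exists>i. S = {i}))}"

lemma building_set_full: "finite V \<Longrightarrow> V \<noteq> {} \<Longrightarrow> building_set V (full_bs V)"
  by unfold_locales (auto simp: full_bs_def)

lemma building_set_star: "finite V \<Longrightarrow> a \<in> V \<Longrightarrow> building_set V (star_bs a V)"
  by unfold_locales (auto simp: star_bs_def)

lemma building_set_gamma: "finite V \<Longrightarrow> a \<in> V \<Longrightarrow> building_set V (gamma_bs a b V)"
  by unfold_locales (auto simp: gamma_bs_def)

lemma building_set_mas: "finite V \<Longrightarrow> a \<in> V \<Longrightarrow> b \<in> V \<Longrightarrow> building_set V (mas_bs a b c V)"
  by unfold_locales (auto simp: mas_bs_def)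

section \<open>Restrictions and contractions within the four families\<close>

lemma restrict_full: "S \<subseteq> V \<Longrightarrow> restrict_set (full_bs V) S = full_bs S"
  by (auto simp: restrict_set_def full_bs_def)

lemma restrict_star: "S \<subseteq> V \<Longrightarrow> restrict_set (star_bs a V) S = star_bs a S"
  by (auto simp: restrict_set_def star_bs_def)

lemma restrict_gamma: "S \<subseteq> V \<Longrightarrow> restrict_set (gamma_bs a b V) S = gamma_bs a b S"
  by (auto simp: restrict_set_def gamma_bs_def)

lemma gamma_without: "b \<notin> S \<Longrightarrow> gamma_bs a b S = full_bs S"
  by (auto simp: gamma_bs_def full_bs_def)

lemma restrict_mas: "S \<subseteq> V \<Longrightarrow> restrict_set (mas_bs a b c V) S = mas_bs a b c S"
  by (auto simp: restrict_set_def mas_bs_def)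

lemma mas_without: "c \<notin> S \<Longrightarrow> mas_bs a b c S = star_bs a S"
  by (auto simp: mas_bs_def star_bs_def)

text \<open>As preimages of a member \<open>U\<close> of the contraction only \<open>U\<close> and
  \<open>U \<union> S\<close> are tried; in each contraction below one of them works.\<close>

lemma contract_setI:
  assumes "\<And>T. T \<in> B \<Longrightarrow> \<not> T \<subseteq> S \<Longrightarrow> T - S \<in> C"
    and "\<And>U. U \<in> C \<Longrightarrow> (U \<in> B \<or> U \<union> S \<in> B) \<and> U \<inter> S = {} \<and> U \<noteq> {}"
  shows "contract_set B S = C"
proof
  show "contract_set B S \<subseteq> C" using assms(1) by (auto simp: contract_set_def)
  show "C \<subseteq> contract_set B S"
  proof
    fix U assume U: "U \<in> C"
    then obtain T where T: "T = U \<or> T = U \<union> S" "T \<in> B" using assms(2) by blast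
    then have "U = T - S" "\<not> T \<subseteq> S" using assms(2)[OF U] by auto
    then show "U \<in> contract_set B S" using T unfolding contract_set_def by blast
  qed
qed

lemma contract_full: "S \<subseteq> V \<Longrightarrow> contract_set (full_bs V) S = full_bs (V - S)"
  by (rule contract_setI) (auto simp: full_bs_def)

lemma contract_star_center: "S \<subseteq> V \<Longrightarrow> a \<in> S \<Longrightarrow> contract_set (star_bs a V) S = full_bs (V - S)"
  by (rule contract_setI) (auto simp: full_bs_def star_bs_def)

lemma contract_star_leaf: "i \<in> V \<Longrightarrow> i \<noteq> a \<Longrightarrow> contract_set (star_bs a V) {i} = star_bs a (V - {i})"
  by (rule contract_setI) (auto simp: star_bs_def)

lemma contract_gamma_center: "S \<subseteq> V \<Longrightarrow> a \<in> S \<Longrightarrow> contract_set (gamma_bs a b V) S = full_bs (V - S)"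
  by (rule contract_setI) (auto simp: full_bs_def gamma_bs_def)

lemma contract_gamma_other:
  "S \<subseteq> V \<Longrightarrow> a \<notin> S \<Longrightarrow> b \<notin> S \<Longrightarrow> contract_set (gamma_bs a b V) S = gamma_bs a b (V - S)"
  by (rule contract_setI) (auto simp: gamma_bs_def)

lemma contract_gamma_last: "b \<in> V \<Longrightarrow> contract_set (gamma_bs a b V) {b} = full_bs (V - {b})"
  by (rule contract_setI) (auto simp: full_bs_def gamma_bs_def)

text \<open>Once \<open>a\<close> is contracted, sets avoiding \<open>c\<close> are unrestricted,
  while a set with \<open>c\<close> still has to contain \<open>b\<close> unless it is
  \<open>{c}\<close>. So \<open>b\<close> and \<open>c\<close> become the two distinguished vertices
  of a \<open>gamma_bs\<close>.\<close>

lemma contract_mas_1: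
  "S \<subseteq> V \<Longrightarrow> a \<in> S \<Longrightarrow> b \<notin> S \<Longrightarrow> c \<notin> S \<Longrightarrow> contract_set (mas_bs a b c V) S = gamma_bs b c (V - S)"
  by (rule contract_setI) (auto simp: gamma_bs_def mas_bs_def)

lemma contract_mas_2:
  "S \<subseteq> V \<Longrightarrow> a \<in> S \<Longrightarrow> b \<in> S \<Longrightarrow> contract_set (mas_bs a b c V) S = full_bs (V - S)"
  by (rule contract_setI) (auto simp: full_bs_def mas_bs_def)

text \<open>A set with \<open>a\<close> satisfies the condition on \<open>c\<close> after adjoining
  \<open>b\<close>, so the contraction is the whole star.\<close>

lemma contract_mas_b: "a \<noteq> b \<Longrightarrow> b \<in> V \<Longrightarrow> contract_set (mas_bs a b c V) {b} = star_bs a (V - {b})"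
  by (rule contract_setI) (auto simp: star_bs_def mas_bs_def)

lemma contract_mas_c: "a \<noteq> c \<Longrightarrow> c \<in> V \<Longrightarrow> contract_set (mas_bs a b c V) {c} = star_bs a (V - {c})"
  by (rule contract_setI) (auto simp: star_bs_def mas_bs_def)

lemma contract_mas_other:
  "i \<notin> {a, b, c} \<Longrightarrow> i \<in> V \<Longrightarrow> contract_set (mas_bs a b c V) {i} = mas_bs a b c (V - {i})"
  by (rule contract_setI) (auto simp: mas_bs_def)

section \<open>Identification with the types in the statement\<close>

lemma bij_betw_extend:
  assumes "finite V" "finite W" "card V = card W" "A \<subseteq> V" "inj_on g A" "g ` A \<subseteq> W"
  obtains \<sigma> where "bij_betw \<sigma> V W" "\<And>x. x \<in> A \<Longrightarrow> \<sigma> x = g x"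
proof -
  have fA: "finite A" using assms finite_subset by blast
  have "card (V - A) = card (W - g ` A)"
    using assms fA by (simp add: card_Diff_subset card_image)
  then obtain h where h: "bij_betw h (V - A) (W - g ` A)"
    using finite_same_card_bij[of "V - A" "W - g ` A"] assms by auto
  let ?\<sigma> = "\<lambda>x. if x \<in> A then g x else h x"
  have "bij_betw ?\<sigma> A (g ` A)" using assms(5) by (auto simp: bij_betw_def inj_on_def)
  moreover have "bij_betw ?\<sigma> (V - A) (W - g ` A)" using h by (subst bij_betw_cong[of _ _ h]) auto
  ultimately have "bij_betw ?\<sigma> (A \<union> (V - A)) (g ` A \<union> (W - g ` A))"
    by (rule bij_betw_combine) auto
  then have "bij_betw ?\<sigma> V W" using assms by (simp add: Un_absorb1)
  then show ?thesis using that by simp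
qed

lemma image_building_sets:
  assumes \<sigma>: "inj_on \<sigma> V"
  shows "(`) \<sigma> ` full_bs V = full_bs (\<sigma> ` V)"
    "a \<in> V \<Longrightarrow> (`) \<sigma> ` star_bs a V = star_bs (\<sigma> a) (\<sigma> ` V)"
    "a \<in> V \<Longrightarrow> b \<in> V \<Longrightarrow> (`) \<sigma> ` gamma_bs a b V = gamma_bs (\<sigma> a) (\<sigma> b) (\<sigma> ` V)"
    "a \<in> V \<Longrightarrow> b \<in> V \<Longrightarrow> c \<in> V \<Longrightarrow>
      (`) \<sigma> ` mas_bs a b c V = mas_bs (\<sigma> a) (\<sigma> b) (\<sigma> c) (\<sigma> ` V)"
proof -
  have gen: "(`) \<sigma> ` {S. S \<subseteq> V \<and> P S} = {U. U \<subseteq> \<sigma> ` V \<and> Q U}"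
    if "\<And>S. S \<subseteq> V \<Longrightarrow> P S \<longleftrightarrow> Q (\<sigma> ` S)" for P Q
    using that by (auto elim!: subset_imageE)
  have mem: "\<sigma> x \<in> \<sigma> ` S \<longleftrightarrow> x \<in> S" if "S \<subseteq> V" "x \<in> V" for S x
    using inj_on_image_mem_iff[OF \<sigma>] that by blast
  have sing: "(\<exists>i. \<sigma> ` S = {i}) \<longleftrightarrow> (\<exists>i. S = {i})" if "S \<subseteq> V" for S
  proof
    assume "\<exists>i. \<sigma> ` S = {i}"
    then have "card (\<sigma> ` S) = 1" by auto
    then have "card S = 1" using card_image[OF inj_on_subset[OF \<sigma> that]] by simp
    then show "\<exists>i. S = {i}" by (auto simp: card_1_singleton_iff)
  qed auto
  have eqs: "\<sigma> ` S = {\<sigma> x} \<longleftrightarrow> S = {x}" if "S \<subseteq> V" "x \<in> V" for S x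
    using inj_on_image_eq_iff[OF \<sigma> that(1), of "{x}"] that by simp
  show "(`) \<sigma> ` full_bs V = full_bs (\<sigma> ` V)"
    unfolding full_bs_def by (rule gen) simp
  show "a \<in> V \<Longrightarrow> (`) \<sigma> ` star_bs a V = star_bs (\<sigma> a) (\<sigma> ` V)"
    unfolding star_bs_def by (rule gen) (simp add: mem sing)
  show "a \<in> V \<Longrightarrow> b \<in> V \<Longrightarrow> (`) \<sigma> ` gamma_bs a b V = gamma_bs (\<sigma> a) (\<sigma> b) (\<sigma> ` V)"
    unfolding gamma_bs_def by (rule gen) (simp add: mem eqs)
  show "a \<in> V \<Longrightarrow> b \<in> V \<Longrightarrow> c \<in> V \<Longrightarrow>
      (`) \<sigma> ` mas_bs a b c V = mas_bs (\<sigma> a) (\<sigma> b) (\<sigma> c) (\<sigma> ` V)"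
    unfolding mas_bs_def by (rule gen) (simp add: mem sing)
qed

lemma graph_building_set_complete:
  "graph_building_set {1..n + 1} (complete_edges n) = full_bs {1..n + 1}"
proof -
  have "induces_connected (complete_edges n) S" if S: "S \<subseteq> {1..n + 1}" for S
    unfolding induces_connected_def
  proof (intro ballI)
    fix u v assume uv: "u \<in> S" "v \<in> S"
    show "(u, v) \<in> {(x, y). x \<in> S \<and> y \<in> S \<and> {x, y} \<in> complete_edges n}\<^sup>*"
    proof (cases "u = v")
      case False
      then have "{u, v} \<in> complete_edges n" using uv S unfolding complete_edges_def by blast
      then show ?thesis using uv by (intro r_into_rtrancl) simp
    qed simp
  qed
  then show ?thesis by (auto simp: graph_building_set_def full_bs_def)
qed

lemma graph_building_set_star:
  "graph_building_set {1..n + 1} (star_edges n) = star_bs 1 {1..n + 1}"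
proof -
  let ?R = "\<lambda>S. {(x, y). x \<in> S \<and> y \<in> S \<and> {x, y} \<in> star_edges n}"
  have "\<exists>i. S = {i}" if S: "1 \<notin> S" "S \<noteq> {}" "induces_connected (star_edges n) S" for S
  proof -
    have empty: "?R S = {}" using S(1) by (auto simp: star_edges_def doubleton_eq_iff)
    have "\<forall>u\<in>S. \<forall>v\<in>S. u = v" using S(3) unfolding induces_connected_def empty rtrancl_empty by blast
    then show ?thesis using S(2) by blast
  qed
  moreover have "induces_connected (star_edges n) S" if S: "S \<subseteq> {1..n + 1}" "1 \<in> S" for S
  proof -
    have e: "{1, u} \<in> star_edges n" if "u \<in> S" "u \<noteq> 1" for u
      using that S unfolding star_edges_def by force
    have 1: "(1, u) \<in> (?R S)\<^sup>*" if "u \<in> S" for u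
      using e[OF that] that S(2) by (cases "u = 1") auto
    have 2: "(u, 1) \<in> (?R S)\<^sup>*" if "u \<in> S" for u
      using e[OF that] that S(2) by (cases "u = 1") (auto simp: insert_commute)
    show ?thesis unfolding induces_connected_def by (intro ballI rtrancl_trans[OF 2 1])
  qed
  moreover have "induces_connected (star_edges n) {i}" for i
    by (simp add: induces_connected_def)
  ultimately show ?thesis by (auto simp: graph_building_set_def star_bs_def)
qed

lemma B_Gamma_eq: "1 \<le> n \<Longrightarrow> B_Gamma n = gamma_bs 1 (n + 1) {1..n + 1}"
proof (intro equalityI subsetI)
  fix S assume "S \<in> B_Gamma n" and n: "1 \<le> n"
  then consider i where "S = {i}" "i \<in> {1..n+1}" | "S \<subseteq> {1..n}" "card S \<ge> 2"
    | J where "S = {1, n + 1} \<union> J" "J \<subseteq> {2..n}" unfolding B_Gamma_def by blast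
  then show "S \<in> gamma_bs 1 (n + 1) {1..n + 1}"
  proof cases
    case 2
    then show ?thesis by (fastforce simp: gamma_bs_def)
  next
    case 3
    have "J \<subseteq> {1..n+1}" using 3(2) by force
    then show ?thesis using 3 by (auto simp: gamma_bs_def)
  qed (auto simp: gamma_bs_def)
next
  fix S assume S: "S \<in> gamma_bs 1 (n + 1) {1..n + 1}" and n: "1 \<le> n"
  then have fin: "finite S" "S \<noteq> {}" by (auto simp: gamma_bs_def intro: finite_subset)
  then have "card S > 0" by (simp add: card_gt_0_iff)
  then consider "card S = 1" | "card S \<ge> 2" "n + 1 \<notin> S" | "card S \<ge> 2" "n + 1 \<in> S" by linarith
  then show "S \<in> B_Gamma n"
  proof cases
    case 1
    then show ?thesis using S by (auto simp: card_1_singleton_iff gamma_bs_def B_Gamma_def)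
  next
    case 2
    then have "S \<subseteq> {1..n}" using S by (auto simp: gamma_bs_def le_Suc_eq subset_iff)
    then show ?thesis using 2 by (auto simp: B_Gamma_def)
  next
    case 3
    then have "1 \<in> S" using S by (auto simp: gamma_bs_def)
    then have "S = {1, n + 1} \<union> (S - {1, n + 1})" using 3 by blast
    moreover have "S - {1, n + 1} \<subseteq> {2..n}" using S by (force simp: gamma_bs_def)
    ultimately show ?thesis unfolding B_Gamma_def by blast
  qed
qed

lemma B_Mas_eq: "2 \<le> n \<Longrightarrow> B_Mas n = mas_bs 1 2 (n + 1) {1..n + 1}"
proof (intro equalityI subsetI)
  fix S assume "S \<in> B_Mas n" and n: "2 \<le> n"
  then consider i where "S = {i}" "i \<in> {1..n+1}" | I where "S = {1, 2} \<union> I" "I \<subseteq> {3..n + 1}"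
    | J where "S = {1} \<union> J" "J \<noteq> {}" "J \<subseteq> {3..n}" unfolding B_Mas_def by blast
  then show "S \<in> mas_bs 1 2 (n + 1) {1..n + 1}"
  proof cases
    case 2
    have "I \<subseteq> {1..n+1}" using 2(2) by force
    then show ?thesis using 2 n by (auto simp: mas_bs_def)
  next
    case 3
    have "J \<subseteq> {1..n+1}" "n + 1 \<notin> J" using 3(3) by force+
    then show ?thesis using 3 n by (auto simp: mas_bs_def)
  qed (auto simp: mas_bs_def)
next
  fix S assume S: "S \<in> mas_bs 1 2 (n + 1) {1..n + 1}" and n: "2 \<le> n"
  then have sub: "S \<subseteq> {1..n + 1}" by (simp add: mas_bs_def)
  show "S \<in> B_Mas n"
  proof (cases "\<exists>i. S = {i}")
    case True
    then show ?thesis using sub by (auto simp: B_Mas_def)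
  next
    case False
    then have 1: "1 \<in> S" "n + 1 \<in> S \<longrightarrow> 2 \<in> S" using S by (auto simp: mas_bs_def)
    show ?thesis
    proof (cases "2 \<in> S")
      case True
      then have "S = {1, 2} \<union> (S - {1, 2})" using 1 by blast
      moreover have "S - {1, 2} \<subseteq> {3..n + 1}" using sub by force
      ultimately show ?thesis unfolding B_Mas_def by blast
    next
      case 2: False
      then have "S = {1} \<union> (S - {1})" "S - {1} \<noteq> {}" using 1 False by auto
      moreover have "S - {1} \<subseteq> {3..n}"
      proof
        fix i assume i: "i \<in> S - {1}"
        then have "i \<noteq> 2" "i \<noteq> n + 1" "i \<in> {1..n+1}" "i \<noteq> 1" using 2 1 sub by auto
        then show "i \<in> {3..n}" by auto
      qed
      ultimately show ?thesis unfolding B_Mas_def by blast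
    qed
  qed
qed

abbreviation bs_type :: "nat set set \<Rightarrow> simple_type" where
  "bs_type B \<equiv> comb_type (nestohedron B)"

lemma bs_type_singleton: "building_set V B \<Longrightarrow> card V = 1 \<Longrightarrow> bs_type B = 0"
  using building_set.type_dim_N[of V B] type_dim_eq_0_iff by simp

lemma comb_equiv_translation: "comb_equiv P ((\<lambda>x. a + x) ` P)"
  for a :: "'a::real_vector"
proof -
  have inj: "inj (\<lambda>x. a + x)" by (simp add: inj_on_def)
  have "bij_betw ((`) (\<lambda>x. a + x)) {F. F face_of P} {G. G face_of (\<lambda>x. a + x) ` P}"
    unfolding bij_betw_def faces_of_translation
    using inj by (auto simp: inj_on_def inj_image_eq_iff)
  then show ?thesis
    unfolding comb_equiv_def using inj_image_subset_iff[OF inj] by blast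
qed

lemma comb_equiv_segment:
  fixes w :: rinf assumes w: "w \<noteq> 0"
  shows "comb_equiv (closed_segment 0 (Poly_Mapping.single 0 1 :: rinf)) (closed_segment 0 w)"
proof -
  let ?u = "Poly_Mapping.single 0 1 :: rinf"
  define f :: "rinf \<Rightarrow> rinf" where "f x = Poly_Mapping.lookup x 0 *\<^sub>R w" for x
  have f: "linear f"
    unfolding f_def by (rule linearI) (simp_all add: lookup_add lookup_scaleR_poly_mapping scaleR_add_left)
  have "f ` closed_segment 0 ?u = closed_segment (f 0) (f ?u)"
    by (rule closed_segment_linear_image[OF f, symmetric])
  then have img: "f ` closed_segment 0 ?u = closed_segment 0 w" by (simp add: f_def)
  have "inj_on f (closed_segment 0 ?u)"
  proof (rule inj_onI)
    fix x y assume "x \<in> closed_segment 0 ?u" "y \<in> closed_segment 0 ?u" and eq: "f x = f y"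
    then obtain s t where "x = s *\<^sub>R ?u" "y = t *\<^sub>R ?u" by (auto simp: in_segment)
    then show "x = y" using eq w by (simp add: f_def lookup_scaleR_poly_mapping)
  qed
  then show ?thesis using comb_equiv_linear_image_inj_on[OF f _ convex_closed_segment] img by metis
qed

text \<open>Two singletons and the pair are the only connected building set on two vertices, and
  their simplices add up to a translated segment. This reconciles the separately defined
  one-dimensional members with the general description.\<close>

lemma bs_type_segment:
  assumes "building_set V B" "card V = 2" shows "bs_type B = segment_type"
proof -
  interpret building_set V B by fact
  obtain i j where ij: "V = {i, j}" "i \<noteq> j" using assms(2) by (auto simp: card_2_iff)
  have "S = {i} \<or> S = {j} \<or> S = {i, j}" if "S \<in> B" for S
    using sub[OF that] nonempty[OF that] ij by auto
  then have B: "B = {{i}, {j}, {i, j}}" using single top ij by auto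
  have "{i} \<noteq> {j}" "{i} \<noteq> {i, j}" "{j} \<noteq> {i, j}" using ij by auto
  then have "N = {unit_vec i} + ({unit_vec j} + closed_segment (unit_vec i) (unit_vec j))"
    unfolding nestohedron_eq B by (simp add: std_simplex_def segment_convex_hull)
  also have "closed_segment (unit_vec i) (unit_vec j) =
      {unit_vec i} + closed_segment 0 (unit_vec j - unit_vec i)"
    using closed_segment_translation[of "unit_vec i" 0 "unit_vec j - unit_vec i"]
    by (simp add: translation_eq_singleton_plus)
  finally have N: "N = (\<lambda>x. (unit_vec i + unit_vec j + unit_vec i) + x) ` closed_segment 0 (unit_vec j - unit_vec i)"
    unfolding translation_eq_singleton_plus[symmetric] by (simp add: image_image add.assoc)
  have "unit_vec j - unit_vec i \<noteq> 0"
  proof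
    assume "unit_vec j - unit_vec i = 0"
    then have "Poly_Mapping.lookup (unit_vec j) i = Poly_Mapping.lookup (unit_vec i) i" by simp
    then show False using ij by (simp add: lookup_single when_def)
  qed
  then have eq: "comb_equiv N (closed_segment 0 (Poly_Mapping.single 0 1 :: rinf))"
    unfolding N by (rule comb_equiv_sym[OF comb_equiv_trans[OF comb_equiv_segment comb_equiv_translation]])
  have "polytope (closed_segment 0 (Poly_Mapping.single 0 1 :: rinf))"
    unfolding segment_convex_hull polytope_def by (intro exI conjI) (rule finite.intros | rule refl)+
  then have "simple_polytope (closed_segment 0 (Poly_Mapping.single 0 1 :: rinf))"
    by (rule simple_polytope_comb_equiv[OF eq simple_N])
  then show ?thesis unfolding segment_type_def using comb_type_eq_iff simple_N eq by blast
qed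

lemma bs_type_full:
  assumes V: "finite V" "V \<noteq> {}" shows "bs_type (full_bs V) = Pe (card V - 1)"
proof -
  let ?W = "{1..card V - 1 + 1}"
  have c: "card V = card ?W" using V by (simp add: card_gt_0_iff Suc_pred')
  obtain \<sigma> where \<sigma>: "bij_betw \<sigma> V ?W" using bij_betw_extend[of V ?W "{}"] V c by auto
  then have inj: "inj_on \<sigma> V" and img: "\<sigma> ` V = ?W" by (auto simp: bij_betw_def)
  show ?thesis
    using building_set.comb_type_relabel[OF building_set_full[OF V] inj]
    unfolding image_building_sets(1)[OF inj] img
    by (simp only: Pe_def graph_associahedron_def graph_building_set_complete)
qed

lemma bs_type_star:
  assumes V: "finite V" "a \<in> V" shows "bs_type (star_bs a V) = St (card V - 1)"
proof -
  let ?W = "{1..card V - 1 + 1}"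
  have "card V > 0" using V by (auto simp: card_gt_0_iff)
  then have c: "card V = card ?W" by simp
  obtain \<sigma> where \<sigma>: "bij_betw \<sigma> V ?W" "\<And>x. x \<in> {a} \<Longrightarrow> \<sigma> x = 1"
    using bij_betw_extend[of V ?W "{a}" "\<lambda>_. 1"] V c by auto
  then have inj: "inj_on \<sigma> V" and img: "\<sigma> ` V = ?W" by (auto simp: bij_betw_def)
  have a: "\<sigma> a = 1" using \<sigma>(2) by simp
  show ?thesis
    using building_set.comb_type_relabel[OF building_set_star[OF V] inj]
    unfolding image_building_sets(2)[OF inj V(2)] img a
    by (simp only: St_def graph_associahedron_def graph_building_set_star)
qed

lemma bs_type_gamma:
  assumes V: "finite V" "a \<in> V" "b \<in> V" "a \<noteq> b"
  shows "bs_type (gamma_bs a b V) = P_Gamma (card V - 1)"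
proof -
  define n where "n = card V - 1"
  let ?W = "{1..n + 1}" and ?g = "\<lambda>x. if x = a then 1 else n + 1"
  have "card {a, b} \<le> card V" using V by (intro card_mono) auto
  then have n: "1 \<le> n" "card V = n + 1" using V(4) by (auto simp: n_def)
  have c: "card V = card ?W" using n by simp
  have g: "inj_on ?g {a, b}" "?g ` {a, b} \<subseteq> ?W" "{a, b} \<subseteq> V" using n V by (auto simp: inj_on_def)
  obtain \<sigma> where \<sigma>: "bij_betw \<sigma> V ?W" "\<And>x. x \<in> {a, b} \<Longrightarrow> \<sigma> x = ?g x"
    using bij_betw_extend[OF V(1) _ c g(3,1,2)] by auto
  then have inj: "inj_on \<sigma> V" and img: "\<sigma> ` V = ?W" by (auto simp: bij_betw_def)
  have ab: "\<sigma> a = 1" "\<sigma> b = n + 1" using \<sigma>(2) V(4) by auto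
  interpret building_set V "gamma_bs a b V" by (rule building_set_gamma[OF V(1,2)])
  have eq: "bs_type (gamma_bs a b V) = bs_type (B_Gamma n)"
    using comb_type_relabel[OF inj]
    unfolding image_building_sets(3)[OF inj V(2,3)] img ab B_Gamma_eq[OF n(1)] by (rule sym)
  have "bs_type (gamma_bs a b V) = P_Gamma n"
  proof (cases "n = 1")
    case True
    then have "card V = 2" using n by simp
    then show ?thesis using bs_type_segment[OF building_set_axioms] True by (simp add: P_Gamma_def)
  next
    case False
    then show ?thesis using eq n by (simp add: P_Gamma_def)
  qed
  then show ?thesis by (simp only: n_def)
qed

lemma bs_type_mas:
  assumes V: "finite V" "a \<in> V" "b \<in> V" "c \<in> V" and ne: "a \<noteq> b" "a \<noteq> c" "b \<noteq> c"
  shows "bs_type (mas_bs a b c V) = P_Mas (card V - 1)"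
proof -
  define n where "n = card V - 1"
  let ?W = "{1..n + 1}" and ?g = "\<lambda>x. if x = a then 1 else if x = b then 2 else n + 1"
  have "card {a, b, c} \<le> card V" using V by (intro card_mono) auto
  then have n: "2 \<le> n" "card V = n + 1" using ne by (auto simp: n_def)
  have c: "card V = card ?W" using n by simp
  have g: "inj_on ?g {a, b, c}" "?g ` {a, b, c} \<subseteq> ?W" "{a, b, c} \<subseteq> V"
    using n V by (auto simp: inj_on_def)
  obtain \<sigma> where \<sigma>: "bij_betw \<sigma> V ?W" "\<And>x. x \<in> {a, b, c} \<Longrightarrow> \<sigma> x = ?g x"
    using bij_betw_extend[OF V(1) _ c g(3,1,2)] by auto
  then have inj: "inj_on \<sigma> V" and img: "\<sigma> ` V = ?W" by (auto simp: bij_betw_def)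
  have abc: "\<sigma> a = 1" "\<sigma> b = 2" "\<sigma> c = n + 1" using \<sigma>(2) ne by auto
  interpret building_set V "mas_bs a b c V" by (rule building_set_mas[OF V(1,2,3)])
  have "bs_type (mas_bs a b c V) = bs_type (B_Mas n)"
    using comb_type_relabel[OF inj]
    unfolding image_building_sets(4)[OF inj V(2,3,4)] img abc B_Mas_eq[OF n(1)] by (rule sym)
  then have "bs_type (mas_bs a b c V) = P_Mas n" using n by (simp add: P_Mas_def)
  then show ?thesis by (simp only: n_def)
qed

section \<open>Counting the facets of the Mas family\<close>

lemma sum_Pow_by_card:
  assumes "finite M"
  shows "(\<Sum>J\<in>Pow M. f (card J)) = (\<Sum>s\<le>card M. of_nat (card M choose s) * (f s :: 'a::comm_ring_1))"
proof -
  have "(\<Sum>J\<in>Pow M. f (card J)) = (\<Sum>s\<in>{..card M}. \<Sum>J\<in>{J \<in> Pow M. card J = s}. f (card J))"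
    using assms by (intro sum.group[symmetric]) (auto intro: card_mono)
  also have "\<dots> = (\<Sum>s\<le>card M. of_nat (card M choose s) * f s)"
    using n_subsets[OF assms] by (intro sum.cong) auto
  finally show ?thesis .
qed

lemma sum_proper_Pow_by_card:
  assumes "finite M"
  shows "(\<Sum>J\<in>Pow M - {M}. f (card J)) = (\<Sum>s<card M. of_nat (card M choose s) * (f s :: 'a::comm_ring_1))"
proof -
  have "(\<Sum>J\<in>Pow M - {M}. f (card J)) = (\<Sum>J\<in>Pow M. f (card J)) - f (card M)"
    using assms by (subst sum_diff1) auto
  also have "\<dots> = (\<Sum>s<card M. of_nat (card M choose s) * f s)"
    unfolding sum_Pow_by_card[OF assms] lessThan_Suc_atMost[symmetric] by simp
  finally show ?thesis .
qed

text \<open>\<open>M\<close> holds the vertices other than \<open>a\<close>, \<open>b\<close>,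
  \<open>c\<close>. The terms come, in order, from the members \<open>{b}\<close> and
  \<open>{c}\<close>, from the singletons in \<open>M\<close>, and from the members containing
  \<open>a\<close>, sorted by whether they contain neither \<open>b\<close> nor \<open>c\<close>,
  only \<open>b\<close>, or both.\<close>

lemma facet_sum_mas:
  assumes M: "finite M" "a \<notin> M" "b \<notin> M" "c \<notin> M" and ne: "a \<noteq> b" "a \<noteq> c" "b \<noteq> c"
    and m: "m = card M"
  shows "facet_sum (bs_type (mas_bs a b c ({a, b, c} \<union> M))) =
      2 * gen (St (m + 1)) + of_nat m * gen (P_Mas (m + 1))
    + (\<Sum>s\<le>m. of_nat (m choose s) * (gen (St s) * gen (P_Gamma (m + 1 - s))))
    + (\<Sum>s\<le>m. of_nat (m choose s) * (gen (St (s + 1)) * gen (Pe (m - s))))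
    + (\<Sum>s<m. of_nat (m choose s) * (gen (P_Mas (s + 2)) * gen (Pe (m - s - 1))))"
proof -
  define V where "V = {a, b, c} \<union> M"
  define B where "B = mas_bs a b c V"
  define t where "t S = gen (bs_type (restrict_set B S) + bs_type (contract_set B S))" for S
  have V: "finite V" "a \<in> V" "b \<in> V" "c \<in> V" "card V = m + 3"
    using M ne m by (auto simp: V_def)
  interpret building_set V B unfolding B_def by (rule building_set_mas[OF V(1,2,3)])
  have r0: "bs_type (restrict_set B {i}) = 0" if "i \<in> V" for i
    using bs_type_singleton[OF building_set_restrict[OF single[OF that]]] by simp
  have tb: "t {b} = gen (St (m + 1))"
  proof -
    have "contract_set B {b} = star_bs a (V - {b})" unfolding B_def using ne V by (intro contract_mas_b)
    then show ?thesis using V ne by (simp add: t_def r0 bs_type_star)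
  qed
  have tc: "t {c} = gen (St (m + 1))"
  proof -
    have "contract_set B {c} = star_bs a (V - {c})" unfolding B_def using ne V by (intro contract_mas_c)
    then show ?thesis using V ne by (simp add: t_def r0 bs_type_star)
  qed
  have ti: "t {i} = gen (P_Mas (m + 1))" if i: "i \<in> M" for i
  proof -
    have i': "i \<notin> {a, b, c}" "i \<in> V" using i M by (auto simp: V_def)
    have "contract_set B {i} = mas_bs a b c (V - {i})" unfolding B_def using i' by (intro contract_mas_other)
    moreover have "bs_type (mas_bs a b c (V - {i})) = P_Mas (card (V - {i}) - 1)"
      using V i' ne by (intro bs_type_mas) auto
    ultimately show ?thesis using V i' by (simp add: t_def r0)
  qed
  have J: "finite J" "J \<subseteq> M" "J \<subseteq> V" "a \<notin> J" "b \<notin> J" "c \<notin> J" "card J \<le> m" if "J \<in> Pow M" for J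
    using that M m by (auto simp: V_def finite_subset card_mono)
  \<comment> \<open>The restriction has \<open>card J + 1\<close> vertices and the contraction
    \<open>m + 2 - card J\<close>; the indices are one less.\<close>
  have t1: "t ({a} \<union> J) = gen (St (card J)) * gen (P_Gamma (m + 1 - card J))" if "J \<in> Pow M" for J
  proof -
    note J = J[OF that]
    let ?S = "{a} \<union> J"
    have S: "?S \<subseteq> V" "b \<notin> ?S" "c \<notin> ?S" "card ?S = card J + 1" using J V ne by auto
    have r: "restrict_set B ?S = star_bs a ?S"
      unfolding B_def restrict_mas[OF S(1)] by (rule mas_without) (use S in blast)
    have c: "contract_set B ?S = gamma_bs b c (V - ?S)"
      unfolding B_def using S by (intro contract_mas_1) auto
    have "bs_type (star_bs a ?S) = St (card ?S - 1)" using J by (intro bs_type_star) auto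
    moreover have "bs_type (gamma_bs b c (V - ?S)) = P_Gamma (card (V - ?S) - 1)"
      using V S ne by (intro bs_type_gamma) auto
    moreover have "card (V - ?S) = m + 3 - (card J + 1)"
      using S V J by (subst card_Diff_subset) auto
    ultimately show ?thesis unfolding t_def r c using S(4) by (simp add: gen_add)
  qed
  have t2: "t ({a, b} \<union> J) = gen (St (card J + 1)) * gen (Pe (m - card J))" if "J \<in> Pow M" for J
  proof -
    note J = J[OF that]
    let ?S = "{a, b} \<union> J"
    have S: "?S \<subseteq> V" "c \<notin> ?S" "card ?S = card J + 2" using J V ne by auto
    have r: "restrict_set B ?S = star_bs a ?S"
      unfolding B_def restrict_mas[OF S(1)] by (rule mas_without) (use S in blast)
    have c: "contract_set B ?S = full_bs (V - ?S)"
      unfolding B_def using S by (intro contract_mas_2) auto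
    have "bs_type (star_bs a ?S) = St (card ?S - 1)" using J by (intro bs_type_star) auto
    moreover have "bs_type (full_bs (V - ?S)) = Pe (card (V - ?S) - 1)"
      using V S by (intro bs_type_full) auto
    moreover have "card (V - ?S) = m + 3 - (card J + 2)"
      using S V J by (subst card_Diff_subset) auto
    ultimately show ?thesis unfolding t_def r c using S(3) J(7) by (simp add: gen_add)
  qed
  have t3: "t ({a, b, c} \<union> J) = gen (P_Mas (card J + 2)) * gen (Pe (m - card J - 1))" if "J \<in> Pow M - {M}" for J
  proof -
    have "J \<in> Pow M" "J \<noteq> M" using that by auto
    note J = J[OF this(1)] this(2)
    let ?S = "{a, b, c} \<union> J"
    have S: "?S \<subseteq> V" "card ?S = card J + 3" using J V ne by auto
    have lt: "card J < m" using psubset_card_mono[of M J] J M m by auto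
    have r: "restrict_set B ?S = mas_bs a b c ?S"
      unfolding B_def using S by (simp only: restrict_mas)
    have c: "contract_set B ?S = full_bs (V - ?S)"
      unfolding B_def using S by (intro contract_mas_2) auto
    have card: "card (V - ?S) = m + 3 - (card J + 3)"
      using S V J by (subst card_Diff_subset) auto
    then have "V - ?S \<noteq> {}" using lt by (metis add_diff_cancel_right card.empty less_numeral_extra(3) zero_less_diff)
    then have "bs_type (full_bs (V - ?S)) = Pe (card (V - ?S) - 1)"
      using V by (intro bs_type_full) auto
    moreover have "bs_type (mas_bs a b c ?S) = P_Mas (card ?S - 1)" using J ne by (intro bs_type_mas) auto
    ultimately show ?thesis unfolding t_def r c using card S(2) by (simp add: gen_add)
  qed
  let ?A = "(\<lambda>i. {i}) ` M" and ?B1 = "(\<lambda>J. {a} \<union> J) ` Pow M"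
    and ?B2 = "(\<lambda>J. {a, b} \<union> J) ` Pow M" and ?B3 = "(\<lambda>J. {a, b, c} \<union> J) ` (Pow M - {M})"
  \<comment> \<open>The case \<open>J = {}\<close> of the first group is the vertex
    \<open>{a}\<close>. A set with \<open>a\<close> and \<open>c\<close> but without
    \<open>b\<close> is not a member. Only the last group has to leave out \<open>J = M\<close>,
    which would give \<open>V\<close>.\<close>
  have decomp: "B - {V} = {{b}} \<union> ({{c}} \<union> (?A \<union> (?B1 \<union> (?B2 \<union> ?B3))))"
  proof (intro equalityI subsetI)
    fix S assume S: "S \<in> B - {V}"
    then have SV: "S \<subseteq> V" "S \<noteq> V" by (auto simp: B_def mas_bs_def)
    show "S \<in> {{b}} \<union> ({{c}} \<union> (?A \<union> (?B1 \<union> (?B2 \<union> ?B3))))"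
    proof (cases "a \<in> S")
      case False
      then obtain i where "S = {i}" using S by (auto simp: B_def mas_bs_def)
      then show ?thesis using SV False by (auto simp: V_def)
    next
      case True
      let ?J = "S \<inter> M"
      have JP: "?J \<in> Pow M" by blast
      consider "b \<notin> S" "c \<notin> S \<or> S = {a}" | "b \<in> S" "c \<notin> S" | "b \<in> S" "c \<in> S"
        using S True ne by (auto simp: B_def mas_bs_def)
      then show ?thesis
      proof cases
        case 1
        then have "S = {a} \<union> ?J" using True SV by (auto simp: V_def)
        then show ?thesis using JP by blast
      next
        case 2
        then have "S = {a, b} \<union> ?J" using True SV by (auto simp: V_def)
        then show ?thesis using JP by blast
      next
        case 3
        then have e: "S = {a, b, c} \<union> ?J" using True SV by (auto simp: V_def)
        then have "?J \<noteq> M" using SV by (auto simp: V_def)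
        then show ?thesis using e JP by blast
      qed
    qed
  next
    fix S assume "S \<in> {{b}} \<union> ({{c}} \<union> (?A \<union> (?B1 \<union> (?B2 \<union> ?B3))))"
    then show "S \<in> B - {V}"
      using M ne by (fastforce simp: B_def mas_bs_def V_def)
  qed
  have fin: "finite ?A" "finite ?B1" "finite ?B2" "finite ?B3" using M by auto
  have inj: "inj_on (\<lambda>i. {i}) M" "inj_on (\<lambda>J. {a} \<union> J) (Pow M)" "inj_on (\<lambda>J. {a, b} \<union> J) (Pow M)"
    "inj_on (\<lambda>J. {a, b, c} \<union> J) (Pow M - {M})"
    using M by (auto simp: inj_on_def)
  have d1: "{{b}} \<inter> ({{c}} \<union> (?A \<union> (?B1 \<union> (?B2 \<union> ?B3)))) = {}"
    and d2: "{{c}} \<inter> (?A \<union> (?B1 \<union> (?B2 \<union> ?B3))) = {}" and d3: "?A \<inter> (?B1 \<union> (?B2 \<union> ?B3)) = {}"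
    and d4: "?B1 \<inter> (?B2 \<union> ?B3) = {}" and d5: "?B2 \<inter> ?B3 = {}"
    using M ne by auto
  have "facet_sum (bs_type B) = sum t (B - {V})" unfolding t_def by (rule facet_sum_N)
  also have "\<dots> = sum t {{b}} + (sum t {{c}} + (sum t ?A + (sum t ?B1 + (sum t ?B2 + sum t ?B3))))"
    unfolding decomp using fin by (simp only: sum.union_disjoint d1 d2 d3 d4 d5 finite_UnI finite.emptyI finite_insert)
  also have "sum t {{b}} = gen (St (m + 1))" using tb by simp
  also have "sum t {{c}} = gen (St (m + 1))" using tc by simp
  also have "sum t ?A = (\<Sum>i\<in>M. gen (P_Mas (m + 1)))" using ti by (simp add: sum.reindex inj)
  also have "\<dots> = of_nat m * gen (P_Mas (m + 1))" using m by simp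
  also have "sum t ?B1 = (\<Sum>J\<in>Pow M. gen (St (card J)) * gen (P_Gamma (m + 1 - card J)))"
    unfolding sum.reindex[OF inj(2)] o_def using t1 by (intro sum.cong) simp_all
  also have "\<dots> = (\<Sum>s\<le>m. of_nat (m choose s) * (gen (St s) * gen (P_Gamma (m + 1 - s))))"
    unfolding m by (rule sum_Pow_by_card[OF M(1)])
  also have "sum t ?B2 = (\<Sum>J\<in>Pow M. gen (St (card J + 1)) * gen (Pe (m - card J)))"
    unfolding sum.reindex[OF inj(3)] o_def using t2 by (intro sum.cong) simp_all
  also have "\<dots> = (\<Sum>s\<le>m. of_nat (m choose s) * (gen (St (s + 1)) * gen (Pe (m - s))))"
    unfolding m by (rule sum_Pow_by_card[OF M(1)])
  also have "sum t ?B3 = (\<Sum>J\<in>Pow M - {M}. gen (P_Mas (card J + 2)) * gen (Pe (m - card J - 1)))"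
    unfolding sum.reindex[OF inj(4)] o_def using t3 by (intro sum.cong) simp_all
  also have "\<dots> = (\<Sum>s<m. of_nat (m choose s) * (gen (P_Mas (s + 2)) * gen (Pe (m - s - 1))))"
    unfolding m by (rule sum_proper_Pow_by_card[OF M(1)])
  finally show ?thesis unfolding B_def V_def by (simp add: add.assoc)
qed

section \<open>The d-closure\<close>

lemma Pe_eq: "Pe n = bs_type (full_bs {1..n + 1})"
  using bs_type_full[of "{1..n + 1}"] by simp

lemma St_eq: "St n = bs_type (star_bs 1 {1..n + 1})"
  using bs_type_star[of "{1..n + 1}" 1] by simp

lemma P_Gamma_eq: "1 \<le> n \<Longrightarrow> P_Gamma n = bs_type (gamma_bs 1 (n + 1) {1..n + 1})"
  using bs_type_gamma[of "{1..n + 1}" 1 "n + 1"] by simp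

lemma P_Mas_eq: "2 \<le> n \<Longrightarrow> P_Mas n = bs_type (mas_bs 1 2 (n + 1) {1..n + 1})"
  using bs_type_mas[of "{1..n + 1}" 1 2 "n + 1"] by simp

lemma building_set_standard:
  "building_set {1..n + 1} (full_bs {1..n + 1})"
  "building_set {1..n + 1} (star_bs 1 {1..n + 1})"
  "building_set {1..n + 1} (gamma_bs 1 (n + 1) {1..n + 1})"
  "1 \<le> n \<Longrightarrow> building_set {1..n + 1} (mas_bs 1 2 (n + 1) {1..n + 1})"
  by (auto intro!: building_set_full building_set_star building_set_gamma building_set_mas)

lemma P_Mas_0: "P_Mas 0 = 0" and P_Gamma_0: "P_Gamma 0 = 0"
  by (simp_all add: P_Mas_def P_Gamma_def point_type_def comb_type_zero)

lemma P_Mas_1: "P_Mas 1 = Pe 1"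
  using bs_type_segment[OF building_set_standard(1)[of 1]] Pe_eq[of 1] by (simp add: P_Mas_def)

lemma type_dim_Pe: "type_dim (Pe n) = n"
  unfolding Pe_eq building_set.type_dim_N[OF building_set_standard(1)] by simp

lemma type_dim_St: "type_dim (St n) = n"
  unfolding St_eq building_set.type_dim_N[OF building_set_standard(2)] by simp

lemma type_dim_P_Gamma: "type_dim (P_Gamma n) = n"
proof (cases "n = 0")
  case False
  then have "1 \<le> n" by simp
  show ?thesis
    unfolding P_Gamma_eq[OF \<open>1 \<le> n\<close>] building_set.type_dim_N[OF building_set_standard(3)] by simp
qed (simp add: P_Gamma_0 type_dim_eq_0_iff)

lemma type_dim_P_Mas: "type_dim (P_Mas n) = n"
proof -
  consider "n = 0" | "n = 1" | "2 \<le> n" by linarith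
  then show ?thesis
  proof cases
    case 2
    then show ?thesis using P_Mas_1 type_dim_Pe[of 1] by simp
  next
    case 3
    then have "1 \<le> n" by simp
    show ?thesis
      unfolding P_Mas_eq[OF 3] building_set.type_dim_N[OF building_set_standard(4)[OF \<open>1 \<le> n\<close>]] by simp
  qed (simp add: P_Mas_0 type_dim_eq_0_iff)
qed

lemma Pe_0: "Pe 0 = 0" and St_0: "St 0 = 0"
  using type_dim_eq_0_iff type_dim_Pe type_dim_St by metis+

definition mas_closure :: "simple_type set" where
  "mas_closure = range Pe \<union> range St \<union> range P_Gamma \<union> range P_Mas"

lemma mas_closure_bs_type:
  "finite V \<Longrightarrow> V \<noteq> {} \<Longrightarrow> bs_type (full_bs V) \<in> mas_closure"
  "finite V \<Longrightarrow> a \<in> V \<Longrightarrow> bs_type (star_bs a V) \<in> mas_closure"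
  "finite V \<Longrightarrow> a \<in> V \<Longrightarrow> b \<in> V \<Longrightarrow> a \<noteq> b \<Longrightarrow> bs_type (gamma_bs a b V) \<in> mas_closure"
  "finite V \<Longrightarrow> a \<in> V \<Longrightarrow> b \<in> V \<Longrightarrow> c \<in> V \<Longrightarrow> a \<noteq> b \<Longrightarrow> a \<noteq> c \<Longrightarrow> b \<noteq> c \<Longrightarrow>
    bs_type (mas_bs a b c V) \<in> mas_closure"
  unfolding mas_closure_def by (simp_all add: bs_type_full bs_type_star bs_type_gamma bs_type_mas)

lemma (in building_set) restrict_singleton_type: "i \<in> V \<Longrightarrow> bs_type (restrict_set B {i}) = 0"
  using bs_type_singleton[OF building_set_restrict[OF single]] by simp

lemma zero_in_mas_closure: "0 \<in> mas_closure"
  unfolding mas_closure_def using Pe_0 by (metis UnI1 rangeI)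

lemma (in building_set) facet_sum_in_subring:
  assumes "\<And>S. S \<in> B \<Longrightarrow> S \<noteq> V \<Longrightarrow> bs_type (restrict_set B S) \<in> F \<and> bs_type (contract_set B S) \<in> F"
  shows "facets_simple (bs_type B) \<and> facet_sum (bs_type B) \<in> subring_generated F"
  unfolding facet_sum_N gen_add
  using assms facets_simple_N
  by (auto intro!: subring_generated_sum subring_generated.mult subring_generated.gen)

section \<open>Closedness of the four families under the boundary\<close>

lemma full_facets:
  assumes V: "finite V" "V \<noteq> {}"
  shows "facets_simple (bs_type (full_bs V)) \<and> facet_sum (bs_type (full_bs V)) \<in> subring_generated mas_closure"
proof (rule building_set.facet_sum_in_subring[OF building_set_full[OF V]])
  fix S assume S: "S \<in> full_bs V" "S \<noteq> V"
  then have S': "S \<subseteq> V" "S \<noteq> {}" "finite S" "V - S \<noteq> {}"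
    using V by (auto simp: full_bs_def finite_subset)
  show "bs_type (restrict_set (full_bs V) S) \<in> mas_closure \<and> bs_type (contract_set (full_bs V) S) \<in> mas_closure"
    unfolding restrict_full[OF S'(1)] contract_full[OF S'(1)]
    using S' V by (auto intro!: mas_closure_bs_type(1))
qed

lemma star_facets:
  assumes V: "finite V" "a \<in> V"
  shows "facets_simple (bs_type (star_bs a V)) \<and> facet_sum (bs_type (star_bs a V)) \<in> subring_generated mas_closure"
proof -
  interpret building_set V "star_bs a V" by (rule building_set_star[OF V])
  show ?thesis
  proof (rule facet_sum_in_subring)
    fix S assume S: "S \<in> star_bs a V" "S \<noteq> V"
    have S': "S \<subseteq> V" "finite S" "V - S \<noteq> {}" using S sub finite_member by auto
    show "bs_type (restrict_set (star_bs a V) S) \<in> mas_closure \<and> bs_type (contract_set (star_bs a V) S) \<in> mas_closure"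
    proof (cases "a \<in> S")
      case True
      show ?thesis
        unfolding restrict_star[OF S'(1)] contract_star_center[OF S'(1) True]
        using S' V True by (auto intro!: mas_closure_bs_type)
    next
      case False
      then obtain i where i: "S = {i}" "i \<in> V" "i \<noteq> a" using S by (auto simp: star_bs_def)
      show ?thesis
        unfolding i(1) restrict_singleton_type[OF i(2)] contract_star_leaf[OF i(2,3)]
        using V i by (auto intro!: mas_closure_bs_type zero_in_mas_closure)
    qed
  qed
qed

lemma gamma_facets:
  assumes V: "finite V" "a \<in> V" "b \<in> V" "a \<noteq> b"
  shows "facets_simple (bs_type (gamma_bs a b V)) \<and>
    facet_sum (bs_type (gamma_bs a b V)) \<in> subring_generated mas_closure"
proof -
  interpret building_set V "gamma_bs a b V" by (rule building_set_gamma[OF V(1,2)])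
  show ?thesis
  proof (rule facet_sum_in_subring)
    fix S assume S: "S \<in> gamma_bs a b V" "S \<noteq> V"
    have S': "S \<subseteq> V" "finite S" "V - S \<noteq> {}" "S \<noteq> {}" using S sub finite_member nonempty by auto
    consider "a \<in> S" | "a \<notin> S" "b \<notin> S" | "S = {b}" using S by (auto simp: gamma_bs_def)
    then show "bs_type (restrict_set (gamma_bs a b V) S) \<in> mas_closure \<and>
        bs_type (contract_set (gamma_bs a b V) S) \<in> mas_closure"
    proof cases
      case 1
      have "bs_type (gamma_bs a b S) \<in> mas_closure"
        using S' V 1 by (cases "b \<in> S") (auto simp: gamma_without intro!: mas_closure_bs_type)
      moreover have "bs_type (full_bs (V - S)) \<in> mas_closure" using S' V by (intro mas_closure_bs_type) auto
      ultimately show ?thesis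
        unfolding restrict_gamma[OF S'(1)] contract_gamma_center[OF S'(1) 1] by blast
    next
      case 2
      show ?thesis
        unfolding restrict_gamma[OF S'(1)] contract_gamma_other[OF S'(1) 2] gamma_without[OF 2(2)]
        using S' V 2 by (auto intro!: mas_closure_bs_type)
    next
      case 3
      show ?thesis
        unfolding 3 restrict_singleton_type[OF V(3)] contract_gamma_last[OF V(3)]
        using V by (auto intro!: mas_closure_bs_type zero_in_mas_closure)
    qed
  qed
qed

lemma mas_facets:
  assumes V: "finite V" "a \<in> V" "b \<in> V" "c \<in> V" and ne: "a \<noteq> b" "a \<noteq> c" "b \<noteq> c"
  shows "facets_simple (bs_type (mas_bs a b c V)) \<and>
    facet_sum (bs_type (mas_bs a b c V)) \<in> subring_generated mas_closure"
proof -
  interpret building_set V "mas_bs a b c V" by (rule building_set_mas[OF V(1,2,3)])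
  show ?thesis
  proof (rule facet_sum_in_subring)
    fix S assume S: "S \<in> mas_bs a b c V" "S \<noteq> V"
    have S': "S \<subseteq> V" "finite S" "V - S \<noteq> {}" using S sub finite_member by auto
    consider "a \<in> S" "b \<notin> S" "c \<notin> S" | "a \<in> S" "b \<in> S" | i where "S = {i}" "i \<in> V" "i \<noteq> a"
    proof (cases "a \<in> S")
      case True
      then have "c \<in> S \<longrightarrow> b \<in> S" using S ne by (auto simp: mas_bs_def)
      then show ?thesis using that(1,2) True by blast
    next
      case False
      then obtain i where "S = {i}" using S by (auto simp: mas_bs_def)
      then show ?thesis using that(3)[of i] S' False by simp
    qed
    then show "bs_type (restrict_set (mas_bs a b c V) S) \<in> mas_closure \<and>
        bs_type (contract_set (mas_bs a b c V) S) \<in> mas_closure"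
    proof cases
      case 1
      show ?thesis
        unfolding restrict_mas[OF S'(1)] contract_mas_1[OF S'(1) 1] mas_without[OF 1(3)]
        using S' V ne 1 by (auto intro!: mas_closure_bs_type)
    next
      case 2
      have "bs_type (mas_bs a b c S) \<in> mas_closure"
        using S' 2 ne by (cases "c \<in> S") (auto simp: mas_without intro!: mas_closure_bs_type)
      moreover have "bs_type (full_bs (V - S)) \<in> mas_closure" using S' V by (intro mas_closure_bs_type) auto
      ultimately show ?thesis
        unfolding restrict_mas[OF S'(1)] contract_mas_2[OF S'(1) 2] by blast
    next
      case 3
      have "bs_type (contract_set (mas_bs a b c V) {i}) \<in> mas_closure"
      proof (cases "i = b \<or> i = c")
        case True
        then have "contract_set (mas_bs a b c V) {i} = star_bs a (V - {i})"
          using contract_mas_b[OF ne(1) V(3), of c] contract_mas_c[OF ne(2) V(4), of b] by auto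
        then show ?thesis using V 3 by (auto intro!: mas_closure_bs_type)
      next
        case False
        then have "contract_set (mas_bs a b c V) {i} = mas_bs a b c (V - {i})"
          using 3 by (intro contract_mas_other) auto
        then show ?thesis using V ne 3 False by (auto intro!: mas_closure_bs_type)
      qed
      then show ?thesis
        unfolding 3(1) restrict_singleton_type[OF 3(2)] using zero_in_mas_closure by blast
    qed
  qed
qed

lemma mas_closure_facets:
  assumes "p \<in> mas_closure"
  shows "facets_simple p \<and> facet_sum p \<in> subring_generated mas_closure"
proof -
  have Pe: "?thesis" if "p = Pe n" for n unfolding that Pe_eq by (rule full_facets) auto
  have 0: "?thesis" if "p = 0" using Pe[of 0] that Pe_0 by simp
  consider n where "p = Pe n" | n where "p = St n" | n where "p = P_Gamma n" | n where "p = P_Mas n"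
    using assms unfolding mas_closure_def by blast
  then show ?thesis
  proof cases
    case 1 then show ?thesis by (rule Pe)
  next
    case 2
    show ?thesis unfolding 2 St_eq by (rule star_facets) auto
  next
    case 3
    show ?thesis
    proof (cases "n = 0")
      case False
      then have "1 \<le> n" by simp
      show ?thesis
        unfolding 3 P_Gamma_eq[OF \<open>1 \<le> n\<close>] using \<open>1 \<le> n\<close> by (intro gamma_facets) auto
    qed (use 0 3 P_Gamma_0 in simp)
  next
    case 4
    consider "n = 0" | "n = 1" | "2 \<le> n" by linarith
    then show ?thesis
    proof cases
      case 1 then show ?thesis using 0 4 P_Mas_0 by simp
    next
      case 2 then show ?thesis using Pe[of 1] 4 P_Mas_1 by simp
    next
      case 3
      show ?thesis unfolding 4 P_Mas_eq[OF 3] using 3 by (intro mas_facets) auto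
    qed
  qed
qed

lemma mas_closure_dim: "{p \<in> mas_closure. type_dim p = n} = {Pe n, St n, P_Gamma n, P_Mas n}"
  unfolding mas_closure_def using type_dim_Pe type_dim_St type_dim_P_Gamma type_dim_P_Mas by auto

lemma d_family_mas_closure: "d_family mas_closure"
  unfolding d_family_def polytope_family_def mas_closure_dim
  using bd_subring_generated[OF mas_closure_facets] by simp

text \<open>With a point as restricted factor the facet type is the contraction alone; being
  indecomposable, it is a member of \<open>H\<close> and not merely a product of members.\<close>

lemma (in building_set) facet_type_in_family:
  assumes H: "d_family H" "bs_type B \<in> H" and S: "S \<in> B" "S \<noteq> V"
    and r: "bs_type (restrict_set B S) = 0" and ind: "indecomposable (bs_type (contract_set B S))"
  shows "bs_type (contract_set B S) \<in> H"
proof -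
  have "bs_type (restrict_set B S) + bs_type (contract_set B S) \<in> products H"
    using facet_types_in_products[OF H facet_sum_N, of S] S finite_B by simp
  then show ?thesis using indecomposable_in_products r ind by simp
qed

lemma indecomposable_types:
  "finite V \<Longrightarrow> a \<in> V \<Longrightarrow> V \<noteq> {a} \<Longrightarrow> indecomposable (bs_type (full_bs V))"
  "finite V \<Longrightarrow> a \<in> V \<Longrightarrow> V \<noteq> {a} \<Longrightarrow> indecomposable (bs_type (star_bs a V))"
  "finite V \<Longrightarrow> a \<in> V \<Longrightarrow> V \<noteq> {a} \<Longrightarrow> indecomposable (bs_type (gamma_bs a b V))"
proof -
  assume V: "finite V" "a \<in> V" "V \<noteq> {a}"
  have "V \<noteq> {}" using V by blast
  show "indecomposable (bs_type (full_bs V))"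
    using building_set.indecomposable_N[OF building_set_full[OF V(1) \<open>V \<noteq> {}\<close>] V(2,3)]
    by (auto simp: full_bs_def)
  show "indecomposable (bs_type (star_bs a V))"
    using building_set.indecomposable_N[OF building_set_star[OF V(1,2)] V(2,3)]
    by (auto simp: star_bs_def)
  show "indecomposable (bs_type (gamma_bs a b V))"
    using building_set.indecomposable_N[OF building_set_gamma[OF V(1,2)] V(2,3)]
    by (auto simp: gamma_bs_def)
qed

text \<open>In \<open>P_Mas (n + 1)\<close> the vertex \<open>c\<close> contracts to
  \<open>St n\<close> and the vertex \<open>a\<close> to \<open>P_Gamma n\<close>; in
  \<open>St (n + 1)\<close> the centre contracts to \<open>Pe n\<close>. In dimension 0 all four
  types are the point \<open>P_Mas 0\<close>.\<close>

lemma mas_closure_minimal: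
  assumes H: "d_family H" "range P_Mas \<subseteq> H" shows "mas_closure \<subseteq> H"
proof -
  have 0: "0 \<in> H" using H(2) P_Mas_0 by (metis rangeI subsetD)
  have MH: "P_Mas n \<in> H" for n using H(2) by blast
  have SG: "St n \<in> H \<and> P_Gamma n \<in> H" if n: "1 \<le> n" for n
  proof -
    let ?V = "{1..n + 2}" and ?c = "n + 2"
    let ?B = "mas_bs 1 2 ?c ?V"
    interpret building_set ?V ?B by (rule building_set_mas) auto
    have V: "{?c} \<noteq> ?V" "{1} \<noteq> ?V" "1 \<in> ?V" "?c \<in> ?V" by (auto simp: set_eq_iff)
    have "bs_type ?B = P_Mas (n + 1)" using n by (subst bs_type_mas) auto
    then have BH: "bs_type ?B \<in> H" using MH by simp
    note F = facet_type_in_family[OF H(1) BH single _ restrict_singleton_type]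
    have c: "contract_set ?B {?c} = star_bs 1 (?V - {?c})" using n by (intro contract_mas_c) auto
    have n1: "?V - {?c} \<noteq> {1}" using n by (auto simp: set_eq_iff intro!: exI[of _ 2])
    have "bs_type (star_bs 1 (?V - {?c})) \<in> H"
      using F[OF V(4,1,4)] indecomposable_types(2)[of "?V - {?c}" 1] n1 n unfolding c by auto
    moreover have "bs_type (star_bs 1 (?V - {?c})) = St n" by (subst bs_type_star) auto
    moreover have a: "contract_set ?B {1} = gamma_bs 2 ?c (?V - {1})" using n by (intro contract_mas_1) auto
    have n2: "?V - {1} \<noteq> {2}" using n by (auto simp: set_eq_iff intro!: exI[of _ ?c])
    have "bs_type (gamma_bs 2 ?c (?V - {1})) \<in> H"
      using F[OF V(3,2,3)] indecomposable_types(3)[of "?V - {1}" 2 ?c] n2 n unfolding a by auto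
    moreover have "bs_type (gamma_bs 2 ?c (?V - {1})) = P_Gamma n" using n by (subst bs_type_gamma) auto
    ultimately show ?thesis by simp
  qed
  have PeH: "Pe n \<in> H" if n: "1 \<le> n" for n
  proof -
    let ?V = "{1..n + 2}"
    let ?B = "star_bs 1 ?V"
    interpret building_set ?V ?B by (rule building_set_star) auto
    have V: "{1} \<noteq> ?V" "1 \<in> ?V" by (auto simp: set_eq_iff)
    have "bs_type ?B = St (n + 1)" by (subst bs_type_star) auto
    then have BH: "bs_type ?B \<in> H" using SG[of "n + 1"] by simp
    have a: "contract_set ?B {1} = full_bs (?V - {1})" by (intro contract_star_center) auto
    have n2: "?V - {1} \<noteq> {2}" using n by (auto simp: set_eq_iff intro!: exI[of _ "n + 2"])
    have "bs_type (full_bs (?V - {1})) \<in> H"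
      using facet_type_in_family[OF H(1) BH single[OF V(2)] V(1) restrict_singleton_type[OF V(2)]]
        indecomposable_types(1)[of "?V - {1}" 2] n2 unfolding a by auto
    moreover have "bs_type (full_bs (?V - {1})) = Pe n"
      using n by (subst bs_type_full) (auto simp: set_eq_iff intro!: exI[of _ 2])
    ultimately show ?thesis by simp
  qed
  have "Pe n \<in> H \<and> St n \<in> H \<and> P_Gamma n \<in> H" for n
    using SG[of n] PeH[of n] 0 by (cases "n = 0") (auto simp: Pe_0 St_0 P_Gamma_0)
  then show ?thesis unfolding mas_closure_def using MH by auto
qed

text \<open>The facets number one less than the members, and on four vertices the building sets are
  strictly nested. Dimension 3 is the first to separate the types: on three vertices the star and
  the \<Gamma> building set coincide.\<close>

lemma card_dim_3: "card {Pe 3, St 3, P_Gamma 3, P_Mas 3} = 4"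
proof -
  let ?V = "{1..3 + 1 :: nat}"
  have sub: "mas_bs 1 2 (3 + 1) ?V \<subset> star_bs 1 ?V" "star_bs 1 ?V \<subset> gamma_bs 1 (3 + 1) ?V"
    "gamma_bs 1 (3 + 1) ?V \<subset> full_bs ?V"
  proof -
    \<comment> \<open>The witnesses of strictness: \<open>{1, 4}\<close> has 4 without 2,
      \<open>{2, 3}\<close> avoids the centre 1, and \<open>{2, 4}\<close> has 4 without 1.\<close>
    have "{1, 4} \<in> star_bs 1 ?V - mas_bs 1 2 (3 + 1) ?V" by (auto simp: star_bs_def mas_bs_def)
    moreover have "mas_bs 1 2 (3 + 1) ?V \<subseteq> star_bs 1 ?V" by (auto simp: star_bs_def mas_bs_def)
    ultimately show "mas_bs 1 2 (3 + 1) ?V \<subset> star_bs 1 ?V" by blast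
    have "{2, 3} \<in> gamma_bs 1 (3 + 1) ?V - star_bs 1 ?V" by (auto simp: star_bs_def gamma_bs_def)
    moreover have "star_bs 1 ?V \<subseteq> gamma_bs 1 (3 + 1) ?V" by (auto simp: star_bs_def gamma_bs_def)
    ultimately show "star_bs 1 ?V \<subset> gamma_bs 1 (3 + 1) ?V" by blast
    have "{2, 4} \<in> full_bs ?V - gamma_bs 1 (3 + 1) ?V" by (auto simp: full_bs_def gamma_bs_def)
    moreover have "gamma_bs 1 (3 + 1) ?V \<subseteq> full_bs ?V" by (auto simp: full_bs_def gamma_bs_def)
    ultimately show "gamma_bs 1 (3 + 1) ?V \<subset> full_bs ?V" by blast
  qed
  define facets where "facets p = card {F. is_facet F (rep_simple_type p)}" for p
  have f: "facets (Pe 3) = card (full_bs ?V) - 1" "facets (St 3) = card (star_bs 1 ?V) - 1"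
    "facets (P_Gamma 3) = card (gamma_bs 1 (3 + 1) ?V) - 1"
    "facets (P_Mas 3) = card (mas_bs 1 2 (3 + 1) ?V) - 1"
    using building_set.card_facets_N[OF building_set_standard(1)[of 3]]
      building_set.card_facets_N[OF building_set_standard(2)[of 3]]
      building_set.card_facets_N[OF building_set_standard(3)[of 3]]
      building_set.card_facets_N[OF building_set_standard(4)[of 3]]
      Pe_eq[of 3] St_eq[of 3] P_Gamma_eq[of 3] P_Mas_eq[of 3]
    unfolding facets_def by simp_all
  note finite_sub = finite_subset[OF psubset_imp_subset]
  have fin1: "finite (full_bs ?V)" by (rule building_set.finite_B[OF building_set_standard(1)])
  have fin2: "finite (gamma_bs 1 (3 + 1) ?V)" by (rule finite_sub[OF sub(3) fin1])
  have fin3: "finite (star_bs 1 ?V)" by (rule finite_sub[OF sub(2) fin2])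
  have fin4: "finite (mas_bs 1 2 (3 + 1) ?V)" by (rule finite_sub[OF sub(1) fin3])
  have "?V \<in> mas_bs 1 2 (3 + 1) ?V" by (auto simp: mas_bs_def)
  then have "card (mas_bs 1 2 (3 + 1) ?V) > 0" using fin4 by (auto simp: card_gt_0_iff)
  then have "facets (P_Mas 3) < facets (St 3)" "facets (St 3) < facets (P_Gamma 3)"
    "facets (P_Gamma 3) < facets (Pe 3)"
    using psubset_card_mono[OF fin3 sub(1)] psubset_card_mono[OF fin2 sub(2)]
      psubset_card_mono[OF fin1 sub(3)] unfolding f by linarith+
  then have "Pe 3 \<noteq> St 3" "Pe 3 \<noteq> P_Gamma 3" "Pe 3 \<noteq> P_Mas 3" "St 3 \<noteq> P_Gamma 3" "St 3 \<noteq> P_Mas 3"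
    "P_Gamma 3 \<noteq> P_Mas 3" by auto
  then show ?thesis by simp
qed

lemma line_family_range: "(\<And>n. type_dim (f n) = n) \<Longrightarrow> line_family (range f)"
proof -
  assume "\<And>n. type_dim (f n) = n"
  then have "{p \<in> range f. type_dim p = n} = {f n}" for n by auto
  then show ?thesis by (simp add: line_family_def polytope_family_def)
qed

text \<open>A line family contributes one type per dimension, so the number of types in any single
  dimension bounds the number of line families from below.\<close>

lemma union_of_line_families_card:
  assumes "union_of_line_families j G" shows "card {p \<in> G. type_dim p = n} \<le> j"
proof -
  obtain L where L: "\<And>i. i < j \<Longrightarrow> line_family (L i)" "G = (\<Union>i<j. L i)"
    using assms unfolding union_of_line_families_def by blast
  have "{p \<in> G. type_dim p = n} = (\<Union>i<j. {p \<in> L i. type_dim p = n})" using L(2) by blast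
  then have "card {p \<in> G. type_dim p = n} \<le> (\<Sum>i<j. card {p \<in> L i. type_dim p = n})"
    using card_UN_le[of "{..<j}" "\<lambda>i. {p \<in> L i. type_dim p = n}"] by simp
  also have "\<dots> = j" using L(1) by (simp add: line_family_def)
  finally show ?thesis .
qed

lemma has_complexity_P_Mas: "has_complexity (range P_Mas) 4"
  unfolding has_complexity_def
proof (intro conjI exI[of _ mas_closure] allI impI)
  show "polytope_family (range P_Mas)"
    using line_family_range[of P_Mas] type_dim_P_Mas by (simp add: line_family_def)
  show "is_d_closure (range P_Mas) mas_closure"
    unfolding is_d_closure_def
    using d_family_mas_closure mas_closure_minimal by (auto simp: mas_closure_def)
  show "union_of_line_families 4 mas_closure"
    unfolding union_of_line_families_def
  proof (intro exI conjI allI impI)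
    let ?L = "\<lambda>i :: nat. range ([Pe, St, P_Gamma, P_Mas] ! i)"
    show "line_family (?L i)" if "i < 4" for i
      using that type_dim_Pe type_dim_St type_dim_P_Gamma type_dim_P_Mas
      by (auto simp: less_Suc_eq numeral_eq_Suc intro!: line_family_range)
    show "mas_closure = (\<Union>i<4. ?L i)"
      by (auto simp: mas_closure_def numeral_eq_Suc lessThan_Suc)
  qed
  show "\<not> union_of_line_families j mas_closure" if "j < 4" for j
    using union_of_line_families_card[of j mas_closure 3] that card_dim_3 mas_closure_dim by auto
qed simp

theorem theorem4p7:
  shows "(\<forall>n::nat. n \<ge> 2 \<longrightarrow>
      bd (gen (P_Mas n)) =
        2 * gen (St (n - 1))
      + of_nat (n - 2) * gen (P_Mas (n - 1))
      + (\<Sum>s\<in>{..n - 2}. of_nat ((n - 2) choose s) * (gen (St s) * gen (P_Gamma (n - s - 1))))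
      + (\<Sum>s\<in>{..n - 2}. of_nat ((n - 2) choose s) * (gen (St (s + 1)) * gen (Pe (n - s - 2))))
      + (\<Sum>s\<in>{..<n - 2}. of_nat ((n - 2) choose s) * (gen (P_Mas (s + 2)) * gen (Pe (n - s - 3)))))
    \<and> has_complexity {P_Mas n |n. True} 4"
proof (intro conjI allI impI)
  have "{P_Mas n |n. True} = range P_Mas" by auto
  then show "has_complexity {P_Mas n |n. True} 4" using has_complexity_P_Mas by simp
  fix n :: nat assume n: "2 \<le> n"
  \<comment> \<open>The number of vertices other than 1, 2 and \<open>n + 1\<close>.\<close>
  define m where "m = n - 2"
  have nm: "n = m + 2" using n by (simp add: m_def)
  have V: "{1..n + 1} = {1, 2, n + 1} \<union> {3..n}" using n by auto
  have "facet_sum (bs_type (mas_bs 1 2 (n + 1) ({1, 2, n + 1} \<union> {3..n}))) =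
      2 * gen (St (m + 1)) + of_nat m * gen (P_Mas (m + 1))
    + (\<Sum>s\<le>m. of_nat (m choose s) * (gen (St s) * gen (P_Gamma (m + 1 - s))))
    + (\<Sum>s\<le>m. of_nat (m choose s) * (gen (St (s + 1)) * gen (Pe (m - s))))
    + (\<Sum>s<m. of_nat (m choose s) * (gen (P_Mas (s + 2)) * gen (Pe (m - s - 1))))"
    using n by (intro facet_sum_mas) (auto simp: m_def)
  then have eq: "bd (gen (P_Mas n)) = \<dots>" by (simp only: bd_gen P_Mas_eq[OF n] V)
  show "bd (gen (P_Mas n)) =
        2 * gen (St (n - 1))
      + of_nat (n - 2) * gen (P_Mas (n - 1))
      + (\<Sum>s\<in>{..n - 2}. of_nat ((n - 2) choose s) * (gen (St s) * gen (P_Gamma (n - s - 1))))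
      + (\<Sum>s\<in>{..n - 2}. of_nat ((n - 2) choose s) * (gen (St (s + 1)) * gen (Pe (n - s - 2))))
      + (\<Sum>s\<in>{..<n - 2}. of_nat ((n - 2) choose s) * (gen (P_Mas (s + 2)) * gen (Pe (n - s - 3))))"
    unfolding eq by (simp add: nm)
qed

end
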